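(* Let $p:[0,1]\times\mathbb{R}^3\to\mathbb{R}^+$ be a smooth map which is bounded with bounded derivatives, and let $u\in C^{1,2}_{b,div}([0,1]\times\mathbb{R}^3)$ be a solution of $$\partial_t u+(u\cdot\nabla)u=-\nabla p+\frac{\Delta u}{2},\qquad \mathrm{div}\,u=0.$$ Let $(e_1,e_2,e_3)$ be the canonical orthonormal basis of $\mathbb{R}^3$ and assume that $p(t,R^\epsilon x)=p(t,x)$ for all $(t,x)\in[0,1]\times\mathbb{R}^3$ and $\epsilon\in\mathbb{R}$, where $R^\epsilon:\mathbb{R}^3\to\mathbb{R}^3$ is the rotation of angle $\epsilon$ about the axis $e_3$. Define, for $t\in[0,1]$, $$l_t:=\langle W_t,e_1\rangle\langle v^{P_u}_t,e_2\rangle-\langle W_t,e_2\rangle\langle v^{P_u}_t,e_1\rangle .$$ Then the process $$\mathcal{I}_t:=l_t+\int_0^t\langle \mathrm{rot}\,u_{1-s}(W_s),e_3\rangle\,ds$$ is an $(\mathcal{F}^{P_u}_t)$-local martingale on $(W,\mathcal{B}(W)^{P_u},P_u)$.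
   Context: $W:=C([0,1],\mathbb{R}^3)$ with the uniform norm and Borel sigma-field $\mathcal{B}(W)$; $(W_t)_{t\in[0,1]}$ is the evaluation process $W_t(\omega)=\omega(t)$. For a Borel probability $\nu$ on $W$, $\mathcal{B}(W)^\nu$ is the $\nu$-completion of $\mathcal{B}(W)$ and $(\mathcal{F}^\nu_t)$ is the $\nu$-usual augmentation of the natural filtration of $(W_t)$. $C^{1,2}_{b,div}([0,1]\times\mathbb{R}^3):=\{u\in C^{1,2}([0,1]\times\mathbb{R}^3;\mathbb{R}^3)\cap C_b([0,1]\times\mathbb{R}^3;\mathbb{R}^3):\ \mathrm{div}\,u(t,\cdot)=0\text{ for all }t\in[0,1]\}$. For such $u$, $P_u$ is the probability measure equivalent to the standard Wiener measure $\mu$ on $W$ (law of standard Brownian motion, $W_0=0$ $\mu$-a.s.) with density $$\frac{dP_u}{d\mu}:=\exp\left(-\int_0^1 u(1-t,W_t)\,dW_t-\frac12\int_0^1|u(1-t,W_t)|^2\,dt\right).$$ Under $P_u$, $(W_t)$ is a semi-martingale whose martingale part is a Brownian motion and whose drift is $v^{P_u}_t=-u(1-t,W_t)$ (this continuous version of the drift is used). $\mathrm{rot}\,u_t:\mathbb{R}^3\to\mathbb{R}^3$ denotes the rotational (curl) of the vector field $u_t:=u(t,\cdot)$. $\langle\cdot,\cdot\rangle$ is the Euclidean inner product of $\mathbb{R}^3$. *)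

theory Defs
  imports "HOL-Probability.Probability"
begin

section \<open>Vector calculus on \<open>[0,1] \<times> \<real>\<^sup>3\<close>\<close>

text \<open>
  A map on \<open>[0,1] \<times> \<real>\<^sup>3\<close> is represented by a total function \<open>real \<Rightarrow> real ^ 3 \<Rightarrow> 'b\<close> of which only
  the values at times in \<open>[0,1]\<close> are ever used. Time derivatives are taken within \<open>[0,1]\<close>, hence
  they are one-sided at the two end points.
\<close>

definition dt :: "(real \<Rightarrow> real ^ 3 \<Rightarrow> 'b::real_normed_vector) \<Rightarrow> real \<Rightarrow> real ^ 3 \<Rightarrow> 'b" where
  "dt f t x = vector_derivative (\<lambda>s. f s x) (at t within {0..1})"

definition pd :: "3 \<Rightarrow> (real ^ 3 \<Rightarrow> 'b::real_normed_vector) \<Rightarrow> real ^ 3 \<Rightarrow> 'b" where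
  "pd i f x = frechet_derivative f (at x) (axis i 1)"

definition grad :: "(real ^ 3 \<Rightarrow> real) \<Rightarrow> real ^ 3 \<Rightarrow> real ^ 3" where
  "grad f x = (\<chi> i. pd i f x)"

definition divergence :: "(real ^ 3 \<Rightarrow> real ^ 3) \<Rightarrow> real ^ 3 \<Rightarrow> real" where
  "divergence f x = (\<Sum>i\<in>UNIV. pd i f x $ i)"

definition laplacian :: "(real ^ 3 \<Rightarrow> 'b::real_normed_vector) \<Rightarrow> real ^ 3 \<Rightarrow> 'b" where
  "laplacian f x = (\<Sum>i\<in>UNIV. pd i (pd i f) x)"

text \<open>\<open>advection v f\<close> is \<open>(v \<cdot> \<nabla>) f\<close>.\<close>

definition advection ::
    "(real ^ 3 \<Rightarrow> real ^ 3) \<Rightarrow> (real ^ 3 \<Rightarrow> 'b::real_normed_vector) \<Rightarrow> real ^ 3 \<Rightarrow> 'b" where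
  "advection v f x = (\<Sum>i\<in>UNIV. (v x $ i) *\<^sub>R pd i f x)"

definition rot :: "(real ^ 3 \<Rightarrow> real ^ 3) \<Rightarrow> real ^ 3 \<Rightarrow> real ^ 3" where
  "rot f x = vector
     [pd 2 f x $ 3 - pd 3 f x $ 2,
      pd 3 f x $ 1 - pd 1 f x $ 3,
      pd 1 f x $ 2 - pd 2 f x $ 1]"

definition rotation_e3 :: "real \<Rightarrow> real ^ 3 \<Rightarrow> real ^ 3" where
  "rotation_e3 \<epsilon> x = vector
     [cos \<epsilon> * x $ 1 - sin \<epsilon> * x $ 2,
      sin \<epsilon> * x $ 1 + cos \<epsilon> * x $ 2,
      x $ 3]"

definition cont_strip :: "(real \<Rightarrow> real ^ 3 \<Rightarrow> 'b::real_normed_vector) \<Rightarrow> bool" where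
  "cont_strip f \<longleftrightarrow> continuous_on ({0..1} \<times> UNIV) (\<lambda>(t, x). f t x)"

definition bounded_strip :: "(real \<Rightarrow> real ^ 3 \<Rightarrow> 'b::real_normed_vector) \<Rightarrow> bool" where
  "bounded_strip f \<longleftrightarrow> bounded ((\<lambda>(t, x). f t x) ` ({0..1} \<times> UNIV))"

definition time_differentiable :: "(real \<Rightarrow> real ^ 3 \<Rightarrow> 'b::real_normed_vector) \<Rightarrow> bool" where
  "time_differentiable f \<longleftrightarrow>
     (\<forall>t\<in>{0..1}. \<forall>x. (\<lambda>s. f s x) differentiable (at t within {0..1}))"

definition space_differentiable :: "(real \<Rightarrow> real ^ 3 \<Rightarrow> 'b::real_normed_vector) \<Rightarrow> bool" where
  "space_differentiable f \<longleftrightarrow> (\<forall>t\<in>{0..1}. \<forall>x. f t differentiable (at x))"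

definition C12 :: "(real \<Rightarrow> real ^ 3 \<Rightarrow> 'b::real_normed_vector) \<Rightarrow> bool" where
  "C12 u \<longleftrightarrow>
     cont_strip u \<and>
     time_differentiable u \<and> cont_strip (dt u) \<and>
     space_differentiable u \<and> (\<forall>i. cont_strip (\<lambda>t. pd i (u t))) \<and>
     (\<forall>i. space_differentiable (\<lambda>t. pd i (u t))) \<and>
     (\<forall>i j. cont_strip (\<lambda>t. pd j (pd i (u t))))"

definition C12_b_div :: "(real \<Rightarrow> real ^ 3 \<Rightarrow> real ^ 3) set" where
  "C12_b_div = {u. C12 u \<and> bounded_strip u \<and> (\<forall>t\<in>{0..1}. \<forall>x. divergence (u t) x = 0)}"

text \<open>Iterated partial derivatives; \<open>None\<close> stands for time, \<open>Some i\<close> for the \<open>i\<close>-th coordinate.\<close>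

fun iterated_pd ::
    "3 option list \<Rightarrow> (real \<Rightarrow> real ^ 3 \<Rightarrow> 'b::real_normed_vector) \<Rightarrow> real \<Rightarrow> real ^ 3 \<Rightarrow> 'b" where
  "iterated_pd [] f = f"
| "iterated_pd (None # \<alpha>) f = dt (iterated_pd \<alpha> f)"
| "iterated_pd (Some i # \<alpha>) f = (\<lambda>t. pd i (iterated_pd \<alpha> f t))"

definition smooth_bounded_derivatives ::
    "(real \<Rightarrow> real ^ 3 \<Rightarrow> 'b::real_normed_vector) \<Rightarrow> bool" where
  "smooth_bounded_derivatives f \<longleftrightarrow>
     (\<forall>\<alpha>. time_differentiable (iterated_pd \<alpha> f) \<and> space_differentiable (iterated_pd \<alpha> f) \<and>
          cont_strip (iterated_pd \<alpha> f) \<and> bounded_strip (iterated_pd \<alpha> f))"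

definition navier_stokes ::
    "(real \<Rightarrow> real ^ 3 \<Rightarrow> real) \<Rightarrow> (real \<Rightarrow> real ^ 3 \<Rightarrow> real ^ 3) \<Rightarrow> bool" where
  "navier_stokes p u \<longleftrightarrow>
     (\<forall>t\<in>{0..1}. \<forall>x.
        dt u t x + advection (u t) (u t) x = - grad (p t) x + (1 / 2) *\<^sub>R laplacian (u t) x \<and>
        divergence (u t) x = 0)"


section \<open>The path space\<close>

text \<open>
  Continuous paths on \<open>[0,1]\<close> with the uniform distance. Its points are functions on \<open>real\<close> that
  equal \<open>undefined\<close> outside \<open>[0,1]\<close>, so the evaluation process is \<open>W\<^sub>t \<omega> = \<omega> t\<close>.
\<close>

type_synonym path = "real \<Rightarrow> real ^ 3"

definition path_metric :: "path metric" where
  "path_metric = cfunspace (top_of_set {0..1}) euclidean_metric"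

definition path_borel :: "path measure" where
  "path_borel = sigma (mspace path_metric) {U. openin (mtopology_of path_metric) U}"

text \<open>
  Filtrations are indexed by all of \<open>real\<close>, as in the library's notion of stopping time; they are
  constant from time 1 on.
\<close>

definition natural_filtration :: "real \<Rightarrow> path measure" where
  "natural_filtration t = sigma (mspace path_metric)
     {(\<lambda>\<omega>. \<omega> s) -` A \<inter> mspace path_metric | s A. s \<in> {0..1} \<and> s \<le> t \<and> A \<in> sets borel}"

definition usual_augmentation :: "path measure \<Rightarrow> real \<Rightarrow> path measure" where
  "usual_augmentation \<nu> t = sigma (mspace path_metric)
     (\<Inter>s\<in>{t<..}. sigma_sets (mspace path_metric)
        (sets (natural_filtration s) \<union> null_sets (completion \<nu>)))"


section \<open>Wiener measure, the Ito integral and the law \<open>P\<^sub>u\<close>\<close>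

definition wiener_measure :: "path measure \<Rightarrow> bool" where
  "wiener_measure \<mu> \<longleftrightarrow>
     prob_space \<mu> \<and> sets \<mu> = sets path_borel \<and>
     (AE \<omega> in \<mu>. \<omega> 0 = 0) \<and>
     (\<forall>s t i. 0 \<le> s \<longrightarrow> s < t \<longrightarrow> t \<le> 1 \<longrightarrow>
        distributed \<mu> lborel (\<lambda>\<omega>. (\<omega> t - \<omega> s) $ i)
          (\<lambda>x. ennreal (normal_density 0 (sqrt (t - s)) x))) \<and>
     (\<forall>(n::nat) \<tau>. (\<forall>k\<le>n. \<tau> k \<in> {0..1}) \<longrightarrow> (\<forall>k<n. \<tau> k < \<tau> (Suc k)) \<longrightarrow>
        prob_space.indep_vars \<mu> (\<lambda>_. borel) (\<lambda>(k, i) \<omega>. (\<omega> (\<tau> (Suc k)) - \<omega> (\<tau> k)) $ i)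
          ({..<n} \<times> (UNIV :: 3 set)))"

text \<open>
  A simple process is \<open>\<Sum>k<m. \<xi>\<^sub>k 1\<^bsub>(\<tau>\<^sub>k, \<tau>\<^sub>k\<^sub>+\<^sub>1]\<^esub>\<close> with bounded \<open>\<xi>\<^sub>k\<close> measurable at time \<open>\<tau>\<^sub>k\<close>.
\<close>

definition simple_integrand :: "nat \<Rightarrow> (nat \<Rightarrow> real) \<Rightarrow> (nat \<Rightarrow> path \<Rightarrow> real ^ 3) \<Rightarrow> bool" where
  "simple_integrand m \<tau> \<xi> \<longleftrightarrow>
     (\<forall>k\<le>m. \<tau> k \<in> {0..1}) \<and> (\<forall>k<m. \<tau> k \<le> \<tau> (Suc k)) \<and>
     (\<forall>k<m. \<xi> k \<in> borel_measurable (natural_filtration (\<tau> k)) \<and>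
            bounded (\<xi> k ` mspace path_metric))"

definition simple_process ::
    "nat \<Rightarrow> (nat \<Rightarrow> real) \<Rightarrow> (nat \<Rightarrow> path \<Rightarrow> real ^ 3) \<Rightarrow> real \<Rightarrow> path \<Rightarrow> real ^ 3" where
  "simple_process m \<tau> \<xi> t \<omega> =
     (\<Sum>k<m. indicat_real {\<tau> k<..\<tau> (Suc k)} t *\<^sub>R \<xi> k \<omega>)"

definition simple_integral ::
    "nat \<Rightarrow> (nat \<Rightarrow> real) \<Rightarrow> (nat \<Rightarrow> path \<Rightarrow> real ^ 3) \<Rightarrow> path \<Rightarrow> real" where
  "simple_integral m \<tau> \<xi> \<omega> = (\<Sum>k<m. \<xi> k \<omega> \<bullet> (\<omega> (\<tau> (Suc k)) - \<omega> (\<tau> k)))"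

text \<open>
  \<open>ito_integral \<mu> H I\<close>: the random variable \<open>I\<close> is a version of \<open>\<integral>\<^sub>0\<^sup>1 H\<^sub>t dW\<^sub>t\<close>, i.e. an \<open>L\<^sup>2(\<mu>)\<close>-limit of
  integrals of simple processes that converge to \<open>H\<close> in \<open>L\<^sup>2(dt \<otimes> \<mu>)\<close>.
\<close>

definition ito_integral ::
    "path measure \<Rightarrow> (real \<Rightarrow> path \<Rightarrow> real ^ 3) \<Rightarrow> (path \<Rightarrow> real) \<Rightarrow> bool" where
  "ito_integral \<mu> H I \<longleftrightarrow>
     I \<in> borel_measurable \<mu> \<and>
     (\<exists>m \<tau> \<xi>. (\<forall>n. simple_integrand (m n) (\<tau> n) (\<xi> n)) \<and>
        (\<lambda>n. \<integral>\<^sup>+\<omega>. (\<integral>\<^sup>+t\<in>{0..1}.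
            ennreal ((norm (H t \<omega> - simple_process (m n) (\<tau> n) (\<xi> n) t \<omega>))\<^sup>2) \<partial>lborel) \<partial>\<mu>)
          \<longlonglongrightarrow> 0 \<and>
        (\<lambda>n. \<integral>\<^sup>+\<omega>. ennreal ((I \<omega> - simple_integral (m n) (\<tau> n) (\<xi> n) \<omega>)\<^sup>2) \<partial>\<mu>)
          \<longlonglongrightarrow> 0)"

text \<open>
  \<open>drifted_law \<mu> u P\<close>: \<open>P\<close> is the measure \<open>P\<^sub>u\<close>. It does not depend on the version of the stochastic
  integral.
\<close>

definition drifted_law ::
    "path measure \<Rightarrow> (real \<Rightarrow> real ^ 3 \<Rightarrow> real ^ 3) \<Rightarrow> path measure \<Rightarrow> bool" where
  "drifted_law \<mu> u P \<longleftrightarrow>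
     (\<exists>I. ito_integral \<mu> (\<lambda>t \<omega>. u (1 - t) (\<omega> t)) I \<and>
        P = density \<mu> (\<lambda>\<omega>. ennreal (exp (- I \<omega>
              - 1 / 2 * (LINT t:{0..1}|lborel. (norm (u (1 - t) (\<omega> t)))\<^sup>2)))))"

text \<open>The continuous version of the drift of \<open>W\<close> under \<open>P\<^sub>u\<close>.\<close>

definition drift :: "(real \<Rightarrow> real ^ 3 \<Rightarrow> real ^ 3) \<Rightarrow> real \<Rightarrow> path \<Rightarrow> real ^ 3" where
  "drift u t \<omega> = - u (1 - t) (\<omega> t)"


section \<open>Local martingales on \<open>[0,1]\<close>\<close>

definition filtered_prob_space :: "'a measure \<Rightarrow> (real \<Rightarrow> 'a measure) \<Rightarrow> bool" where
  "filtered_prob_space M F \<longleftrightarrow>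
     prob_space M \<and> filtration (space M) F \<and> (\<forall>t. subalgebra M (F t))"

definition martingale :: "'a measure \<Rightarrow> (real \<Rightarrow> 'a measure) \<Rightarrow> (real \<Rightarrow> 'a \<Rightarrow> real) \<Rightarrow> bool" where
  "martingale M F X \<longleftrightarrow>
     filtered_prob_space M F \<and>
     (\<forall>t\<in>{0..1}. X t \<in> borel_measurable (F t) \<and> integrable M (X t)) \<and>
     (\<forall>s\<in>{0..1}. \<forall>t\<in>{s..1}. AE \<omega> in M. real_cond_exp M (F s) (X t) \<omega> = X s \<omega>)"

definition cadlag_on :: "real \<Rightarrow> real \<Rightarrow> (real \<Rightarrow> real) \<Rightarrow> bool" where
  "cadlag_on a b f \<longleftrightarrow>
     (\<forall>t\<in>{a..<b}. (f \<longlongrightarrow> f t) (at_right t)) \<and>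
     (\<forall>t\<in>{a<..b}. \<exists>l. (f \<longlongrightarrow> l) (at_left t))"

text \<open>
  The time horizon 1 belongs to the index set, so a localizing sequence has to reach it after
  finitely many steps, almost surely.
\<close>

definition local_martingale ::
    "'a measure \<Rightarrow> (real \<Rightarrow> 'a measure) \<Rightarrow> (real \<Rightarrow> 'a \<Rightarrow> real) \<Rightarrow> bool" where
  "local_martingale M F X \<longleftrightarrow>
     filtered_prob_space M F \<and>
     (\<forall>t\<in>{0..1}. X t \<in> borel_measurable (F t)) \<and>
     (\<forall>\<omega>\<in>space M. cadlag_on 0 1 (\<lambda>t. X t \<omega>)) \<and>
     (\<exists>T :: nat \<Rightarrow> 'a \<Rightarrow> real.
        (\<forall>n. stopping_time F (T n)) \<and>
        (\<forall>n. \<forall>\<omega>\<in>space M. 0 \<le> T n \<omega> \<and> T n \<omega> \<le> T (Suc n) \<omega> \<and> T n \<omega> \<le> 1) \<and>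
        (AE \<omega> in M. \<exists>n. T n \<omega> = 1) \<and>
        (\<forall>n. martingale M F (\<lambda>t \<omega>. X (min t (T n \<omega>)) \<omega>)))"

end

theory Submission
  imports Defs
begin


text \<open>
  Put \<open>f(t, x) = x\<^sub>2 u\<^sub>1(1 - t, x) - x\<^sub>1 u\<^sub>2(1 - t, x)\<close>, so that \<open>l\<^sub>t = f(t, W\<^sub>t)\<close>. Under \<open>P\<close> the path is a
  Brownian motion with drift \<open>- u(1 - t, W\<^sub>t)\<close>; hence the finite variation part of \<open>f(t, W\<^sub>t)\<close> has
  the density \<open>L f = \<partial>\<^sub>t f - u(1 - t) \<sqdot> \<nabla>f + \<Delta>f / 2\<close> along the path. Insert the Navier-Stokes
  equation for \<open>\<partial>\<^sub>t f\<close>. The convective terms cancel. The viscous terms cancel up to the cross terms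
  \<open>\<partial>\<^sub>2 u\<^sub>1 - \<partial>\<^sub>1 u\<^sub>2\<close> of the Laplacian of a product. The pressure contributes \<open>x\<^sub>2 \<partial>\<^sub>1 p - x\<^sub>1 \<partial>\<^sub>2 p\<close>, the
  derivative of \<open>p\<close> along rotations about the third axis up to sign, which is zero
  (\<open>rotation_invariant_gradient\<close>). So \<open>L f\<close> is minus the third component of the curl, and the process
  of the theorem is \<open>f(t, W\<^sub>t) - \<integral> L f\<close>.

  It remains to see that this is a local martingale under \<open>P\<close> for every \<open>f\<close> of class \<open>C\<^sup>1\<^sup>,\<^sup>2\<close>
  (\<open>process_local_martingale\<close>). The proof reads everything off the Euler scheme on the grid \<open>k / n\<close>
  and needs no stochastic calculus beyond the Ito isometry.

  The density of \<open>P\<close> is the limit of the weights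
  \<open>exp (- \<Sum> u \<sqdot> \<Delta>W - \<Sum> |u|\<^sup>2 / (2 n))\<close>. Such a weight is a product of one factor (\<open>tilt\<close>) per step, and
  each factor has mean one given the past, because increments of Brownian motion are independent of
  the past (\<open>decoupling_integral\<close>). Under the tilted law a step is Gaussian with mean \<open>- u / n\<close> and
  covariance \<open>1 / n\<close> times the identity (\<open>tilted_moments\<close>), so a second-order Taylor
  expansion shows that \<open>f\<close> changes over one step by \<open>L f / n\<close> in mean, with an error \<open>o(1 / n)\<close> that is
  uniform on balls (\<open>one_step_estimate\<close>). Summation up to the first grid time outside a ball shows
  that the stopped process is orthogonal to the past up to \<open>o(1)\<close> (\<open>euler_sum\<close>).

  For the passage to the limit, the Ito isometry identifies the stochastic integral in the density
  with the \<open>L\<^sup>2\<close> limit of the grid sums (\<open>grid_integral_L2_tendsto\<close>), the weights are bounded in \<open>L\<^sup>2\<close>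
  (\<open>euler_weight_square_bound\<close>), and a bound in \<open>L\<^sup>2\<close> together with almost sure convergence along a
  subsequence allows the exchange of limit and expectation (\<open>girsanov_limit\<close>). This gives total mass
  one for \<open>P\<close> and exact orthogonality for the process stopped at the exit from a ball
  (\<open>stopped_increment_orthogonal\<close>).

  The localizing times are the exits from the closed balls of radius \<open>n\<close>. They are entrance times of
  open sets, hence stopping times of the right-continuous augmentation
  (\<open>exit_time_stopping_time\<close>) and limits of the grid exit times (\<open>exit_index_tendsto\<close>); as a path on
  \<open>[0,1]\<close> is bounded, they equal 1 eventually.
\<close>

section \<open>Continuous paths and their past\<close>

abbreviation paths :: "path set" where "paths \<equiv> mspace path_metric"

lemma path_continuous: "\<omega> \<in> paths \<Longrightarrow> continuous_on {0..1} \<omega>"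
  by (simp add: path_metric_def)

lemma path_metric_evaluation:
  assumes "\<omega> \<in> paths" "\<omega>' \<in> paths" "s \<in> {0..1}"
  shows "dist (\<omega> s) (\<omega>' s) \<le> mdist path_metric \<omega> \<omega>'"
proof -
  have "mdist path_metric \<omega> \<omega>' \<le> mdist path_metric \<omega> \<omega>'" by simp
  from mdist_cfunspace_imp_mdist_le[OF assms(1,2)[unfolded path_metric_def] this[unfolded path_metric_def], of s]
  show ?thesis using assms(3) by (simp add: path_metric_def)
qed

lemma space_path_borel [simp]: "space path_borel = paths"
  by (simp add: path_borel_def space_measure_of_conv)

lemma sets_path_borel: "sets path_borel = sigma_sets paths {U. openin (mtopology_of path_metric) U}"
  unfolding path_borel_def by (rule sets_measure_of) (auto dest!: openin_subset)

lemma measurable_evaluation: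
  assumes s: "s \<in> {0..1}"
  shows "(\<lambda>\<omega>. \<omega> s) \<in> borel_measurable path_borel"
proof (rule borel_measurableI)
  fix S :: "(real^3) set" assume S: "open S"
  interpret Metric_space paths "mdist path_metric" by simp
  have "openin (mtopology_of path_metric) ((\<lambda>\<omega>. \<omega> s) -` S \<inter> paths)"
    unfolding mtopology_of_def openin_mtopology
  proof (intro conjI ballI allI impI)
    fix \<omega> assume w: "\<omega> \<in> (\<lambda>\<omega>. \<omega> s) -` S \<inter> paths"
    then obtain r where r: "r > 0" "ball (\<omega> s) r \<subseteq> S" using S openE by blast
    show "\<exists>r>0. mball \<omega> r \<subseteq> (\<lambda>\<omega>. \<omega> s) -` S \<inter> paths"
      using r path_metric_evaluation[OF _ _ s] w
      by (intro exI[of _ r]) (fastforce simp: subset_iff)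
  qed auto
  then show "(\<lambda>\<omega>. \<omega> s) -` S \<inter> space path_borel \<in> sets path_borel"
    by (auto simp: sets_path_borel intro: sigma_sets.Basic)
qed

lemma space_natural_filtration [simp]: "space (natural_filtration t) = paths"
  by (simp add: natural_filtration_def space_measure_of_conv)

lemma sets_natural_filtration:
  "sets (natural_filtration t) = sigma_sets paths
     {(\<lambda>\<omega>. \<omega> s) -` A \<inter> paths | s A. s \<in> {0..1} \<and> s \<le> t \<and> A \<in> sets borel}"
  unfolding natural_filtration_def by (rule sets_measure_of) auto

lemma measurable_evaluation_filtration:
  assumes "s \<in> {0..1}" "s \<le> t"
  shows "(\<lambda>\<omega>. \<omega> s) \<in> borel_measurable (natural_filtration t)"
  by (rule measurableI) (use assms in \<open>auto simp: sets_natural_filtration intro!: sigma_sets.Basic\<close>)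

lemma sets_natural_filtration_mono:
  "s \<le> t \<Longrightarrow> sets (natural_filtration s) \<subseteq> sets (natural_filtration t)"
  unfolding sets_natural_filtration by (rule sigma_sets_mono') force

lemma sets_natural_filtration_path_borel: "sets (natural_filtration t) \<subseteq> sets path_borel"
proof -
  have "(\<lambda>\<omega>. \<omega> s) -` A \<inter> paths \<in> sets path_borel" if "s \<in> {0..1}" "A \<in> sets borel" for s A
    using measurable_sets[OF measurable_evaluation[OF that(1)] that(2)] by simp
  then show ?thesis unfolding sets_natural_filtration
    by (intro sets.sigma_sets_subset[of _ path_borel, simplified]) auto
qed

lemma measurable_natural_filtration_mono:
  "f \<in> borel_measurable (natural_filtration s) \<Longrightarrow> s \<le> t \<Longrightarrow> f \<in> borel_measurable (natural_filtration t)"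
  using sets_natural_filtration_mono[of s t] by (auto simp: measurable_def)

lemma cont_strip_slice:
  fixes g :: "real \<Rightarrow> real ^ 3 \<Rightarrow> 'b::real_normed_vector"
  assumes "cont_strip g" "t \<in> {0..1}"
  shows "continuous_on UNIV (g t)"
proof -
  have "continuous_on UNIV ((\<lambda>(t, x). g t x) \<circ> (\<lambda>x. (t, x)))"
    using assms unfolding cont_strip_def
    by (intro continuous_on_compose continuous_intros) (auto elim: continuous_on_subset)
  then show ?thesis by (simp add: o_def)
qed

lemma cont_strip_path:
  fixes g :: "real \<Rightarrow> real ^ 3 \<Rightarrow> 'b::real_normed_vector"
  assumes "cont_strip g" "\<omega> \<in> paths"
  shows "continuous_on {0..1} (\<lambda>t. g t (\<omega> t))"
proof -
  have "continuous_on {0..1} ((\<lambda>(t, x). g t x) \<circ> (\<lambda>t. (t, \<omega> t)))"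
    using assms(1) path_continuous[OF assms(2)] unfolding cont_strip_def
    by (intro continuous_on_compose continuous_intros) (auto elim: continuous_on_subset)
  then show ?thesis by (simp add: o_def)
qed

lemma grid_time: "k \<le> n \<Longrightarrow> real k / real n \<in> {0..1}"
  by (auto simp: divide_simps)

lemma grid_time_mono: "j \<le> k \<Longrightarrow> real j / real n \<le> real k / real n"
  by (auto simp: divide_simps)

text \<open>
  The upper end of the sum moves with \<open>n\<close>, because integer parts of \<open>t n\<close> and exit indices occur
  there below. Cell by cell the sum differs from the integral by at most the oscillation of \<open>\<phi>\<close> over
  a cell, by the mean value theorem for the primitive.\<close>

lemma riemann_sum_tendsto:
  fixes \<phi> :: "real \<Rightarrow> real"
  assumes \<phi>: "continuous_on {0..1} \<phi>" and m: "\<And>n. m n \<le> n"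
    and r: "(\<lambda>n. real (m n) / real n) \<longlonglongrightarrow> r"
  shows "(\<lambda>n. \<Sum>k<m n. \<phi> (real k / real n) / real n) \<longlonglongrightarrow> (LINT s:{0..r}|lborel. \<phi> s)"
proof -
  define F where "F x = integral {0..x} \<phi>" for x
  have F: "(F has_real_derivative \<phi> x) (at x within {0..1})" if "x \<in> {0..1}" for x
    unfolding F_def using integral_has_real_derivative[OF \<phi> that] .
  then have contF: "continuous_on {0..1} F"
    by (meson DERIV_continuous_on)
  have r01: "r \<in> {0..1}"
  proof -
    have "real (m n) / real n \<in> {0..1}" for n using m[of n] by (auto simp: divide_simps)
    then show ?thesis using closed_sequentially[OF closed_real_atLeastAtMost _ r] by blast
  qed
  have "F r = (LINT s:{0..r}|lborel. \<phi> s)"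
    unfolding F_def using r01
    by (intro set_borel_integral_eq_integral(2)[symmetric] borel_integrable_atLeastAtMost' continuous_on_subset[OF \<phi>]) auto
  moreover have "(\<lambda>n. F (real (m n) / real n)) \<longlonglongrightarrow> F r"
  proof (rule continuous_on_tendsto_compose[OF contF r r01])
    show "\<forall>\<^sub>F n in sequentially. real (m n) / real n \<in> {0..1}"
      using m by (intro always_eventually) (auto simp: divide_simps)
  qed
  moreover have "(\<lambda>n. (\<Sum>k<m n. \<phi> (real k / real n) / real n) - F (real (m n) / real n)) \<longlonglongrightarrow> 0"
  proof (rule LIMSEQ_I)
    fix e :: real assume e: "e > 0"
    have "uniformly_continuous_on {0..1} \<phi>" by (rule compact_uniformly_continuous[OF \<phi>]) auto
    then obtain d where d: "d > 0" "\<And>x y. x \<in> {0..1} \<Longrightarrow> y \<in> {0..1} \<Longrightarrow> dist y x < d \<Longrightarrow> dist (\<phi> y) (\<phi> x) < e/2"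
      using half_gt_zero[OF e] unfolding uniformly_continuous_on_def by blast
    obtain N :: nat where N: "N > 0" "1 / real N < d" using d(1) using nat_approx_posE zero_less_Suc by blast
    show "\<exists>no. \<forall>n\<ge>no. norm ((\<Sum>k<m n. \<phi> (real k / real n) / real n) - F (real (m n) / real n) - 0) < e"
    proof (intro exI allI impI)
      fix n assume n: "n \<ge> N"
      then have n0: "n > 0" using N(1) by simp
      have "1 / real n \<le> 1 / real N" using N(1) n by (intro frac_le) auto
      then have nd: "1 / real n < d" using N(2) by simp
      have step: "\<bar>\<phi> (real k / real n) / real n - (F (real (Suc k) / real n) - F (real k / real n))\<bar> \<le> e/2 / real n"
        if k: "k < n" for k
      proof -
        let ?a = "real k / real n" and ?b = "real (Suc k) / real n"
        have ab: "?a \<le> ?b" "0 \<le> ?a" "?b \<le> 1" "?b - ?a = 1 / real n" using k by (auto simp: divide_simps)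
        have "\<exists>x\<in>{?a..?b}. F ?b - F ?a = \<phi> x * (?b - ?a)"
        proof (rule mvt_very_simple[OF ab(1)])
          fix x assume x: "?a \<le> x" "x \<le> ?b"
          have "x \<in> {0..1}" using order.trans[OF ab(2) x(1)] order.trans[OF x(2) ab(3)] by simp
          from F[OF this] have "(F has_real_derivative \<phi> x) (at x within {?a..?b})"
            by (rule DERIV_subset) (use ab(2,3) in \<open>simp only: atLeastatMost_subset_iff, blast\<close>)
          then show "(F has_derivative (*) (\<phi> x)) (at x within {?a..?b})"
            by (simp add: has_field_derivative_def)
        qed
        then obtain x where x: "x \<in> {?a..?b}" "F ?b - F ?a = \<phi> x * (1 / real n)" using ab by auto
        have "dist x ?a < d" using x(1) ab(4) nd by (auto simp: dist_real_def)
        moreover have "?a \<le> x" "x \<le> ?b" using x(1) by auto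
        then have "x \<in> {0..1}" "?a \<in> {0..1}"
          using order.trans[OF ab(2), of x] order.trans[OF _ ab(3), of x] order.trans[OF ab(1,3)] ab(2)
          unfolding atLeastAtMost_iff by blast+
        ultimately have "dist (\<phi> x) (\<phi> ?a) < e/2" by (intro d(2))
        then have "\<bar>\<phi> ?a - \<phi> x\<bar> / real n \<le> e/2 / real n"
          by (intro divide_right_mono) (auto simp: dist_real_def abs_minus_commute)
        moreover have "\<phi> ?a / real n - (F ?b - F ?a) = (\<phi> ?a - \<phi> x) / real n"
          unfolding x(2) by (simp add: diff_divide_distrib)
        ultimately show ?thesis by (simp add: abs_divide)
      qed
      have "F (real (m n) / real n) = (\<Sum>k<m n. F (real (Suc k) / real n) - F (real k / real n))"
        by (subst sum_lessThan_telescope) (simp add: F_def)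
      then have "\<bar>(\<Sum>k<m n. \<phi> (real k / real n) / real n) - F (real (m n) / real n)\<bar>
           = \<bar>\<Sum>k<m n. \<phi> (real k / real n) / real n - (F (real (Suc k) / real n) - F (real k / real n))\<bar>"
        by (simp add: sum_subtractf)
      also have "\<dots> \<le> (\<Sum>k<m n. e/2 / real n)"
        using m[of n] by (intro order.trans[OF sum_abs] sum_mono step) auto
      also have "\<dots> \<le> e/2" using m[of n] n0 e by (auto simp: field_simps)
      finally show "norm ((\<Sum>k<m n. \<phi> (real k / real n) / real n) - F (real (m n) / real n) - 0) < e"
        using e by simp
    qed
  qed
  ultimately have "(\<lambda>n. (\<Sum>k<m n. \<phi> (real k / real n) / real n) - F (real (m n) / real n) + F (real (m n) / real n)) \<longlonglongrightarrow> 0 + (LINT s:{0..r}|lborel. \<phi> s)"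
    by (intro tendsto_add) simp_all
  then show ?thesis by simp
qed


section \<open>Increments of Brownian motion are independent of the past\<close>

lemma borel_measurable_vecI:
  fixes f :: "'a \<Rightarrow> real ^ 'n"
  assumes "\<And>i. (\<lambda>x. f x $ i) \<in> borel_measurable M"
  shows "f \<in> borel_measurable M"
  unfolding borel_measurable_euclidean_space[of f]
  using assms by (simp add: Basis_vec_def inner_axis)

lemma borel_measurable_vec_nth [measurable (raw)]:
  fixes f :: "'a \<Rightarrow> real ^ 'n"
  assumes "f \<in> borel_measurable M"
  shows "(\<lambda>x. f x $ i) \<in> borel_measurable M"
  using borel_measurable_inner[OF assms borel_measurable_const[of "axis i 1"]] by (simp add: inner_axis)

locale brownian_paths =
  fixes \<mu> :: "path measure"
  assumes wiener: "wiener_measure \<mu>"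
begin

sublocale prob_space \<mu>
  using wiener by (simp add: wiener_measure_def)

lemma sets_wiener [measurable_cong]: "sets \<mu> = sets path_borel"
  using wiener by (simp add: wiener_measure_def)

lemma space_wiener [simp]: "space \<mu> = paths"
  using sets_eq_imp_space_eq[OF sets_wiener] by simp

lemma starts_at_zero: "AE \<omega> in \<mu>. \<omega> 0 = 0"
  using wiener by (simp add: wiener_measure_def)

lemma increment_normal:
  "0 \<le> s \<Longrightarrow> s < t \<Longrightarrow> t \<le> 1 \<Longrightarrow>
    distributed \<mu> lborel (\<lambda>\<omega>. (\<omega> t - \<omega> s) $ i) (\<lambda>x. ennreal (normal_density 0 (sqrt (t - s)) x))"
  using wiener unfolding wiener_measure_def by blast

lemma grid_increments_independent:
  assumes "\<And>k. k \<le> n \<Longrightarrow> \<tau> k \<in> {0..1}" "\<And>k. k < n \<Longrightarrow> \<tau> k < \<tau> (Suc k)"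
  shows "indep_vars (\<lambda>_. borel) (\<lambda>(k, i) \<omega>. (\<omega> (\<tau> (Suc k)) - \<omega> (\<tau> k)) $ i) ({..<n} \<times> (UNIV :: 3 set))"
proof -
  have "\<forall>n \<tau>. (\<forall>k\<le>n. \<tau> k \<in> {0..1}) \<longrightarrow> (\<forall>k<n. \<tau> k < \<tau> (Suc k)) \<longrightarrow>
      indep_vars (\<lambda>_. borel) (\<lambda>(k, i) \<omega>. (\<omega> (\<tau> (Suc k)) - \<omega> (\<tau> k)) $ i) ({..<n} \<times> (UNIV :: 3 set))"
    using wiener unfolding wiener_measure_def by (elim conjE)
  then show ?thesis using assms by blast
qed

lemma evaluation [measurable]: "s \<in> {0..1} \<Longrightarrow> (\<lambda>\<omega>. \<omega> s) \<in> borel_measurable \<mu>"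
  using measurable_evaluation[of s] by (simp only: measurable_cong_sets[OF sets_wiener refl])

lemma filtration_measurable:
  "f \<in> borel_measurable (natural_filtration s) \<Longrightarrow> f \<in> borel_measurable \<mu>"
  using sets_natural_filtration_path_borel[of s] by (auto simp: measurable_def sets_wiener)

lemma filtration_subset_events: "A \<in> sets (natural_filtration s) \<Longrightarrow> A \<in> sets \<mu>"
  using sets_natural_filtration_path_borel[of s] by (auto simp: sets_wiener)

lemma identity_measurable: "(\<lambda>\<omega>. \<omega>) \<in> \<mu> \<rightarrow>\<^sub>M natural_filtration s"
proof (rule measurableI)
  fix A assume A: "A \<in> sets (natural_filtration s)"
  have "(\<lambda>\<omega>. \<omega>) -` A \<inter> space \<mu> = A" using sets.sets_into_space[OF A] by auto
  then show "(\<lambda>\<omega>. \<omega>) -` A \<inter> space \<mu> \<in> sets \<mu>" using filtration_subset_events[OF A] by simp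
qed simp

text \<open>The sets that define the natural filtration are not stable under intersection; these are, and they
  generate the same sigma-algebra.\<close>

definition cylinders :: "real \<Rightarrow> path set set" where
  "cylinders s = {{\<omega> \<in> paths. \<forall>r\<in>J. \<omega> r \<in> A r} | J A.
     finite J \<and> J \<subseteq> {0..1} \<inter> {..s} \<and> (\<forall>r. A r \<in> sets borel)}"

lemma cylindersI:
  assumes "finite J" "J \<subseteq> {0..1} \<inter> {..s}" "\<And>r. A r \<in> sets borel"
  shows "{\<omega> \<in> paths. \<forall>r\<in>J. \<omega> r \<in> A r} \<in> cylinders s"
  unfolding cylinders_def mem_Collect_eq using assms by (intro exI[of _ J] exI[of _ A] conjI refl allI)

lemma cylindersE:
  assumes "C \<in> cylinders s"
  obtains J A where "C = {\<omega> \<in> paths. \<forall>r\<in>J. \<omega> r \<in> A r}" "finite J" "J \<subseteq> {0..1} \<inter> {..s}" "\<forall>r. A r \<in> sets borel"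
proof -
  from assms obtain J A where "C = {\<omega> \<in> paths. \<forall>r\<in>J. \<omega> r \<in> A r} \<and>
      finite J \<and> J \<subseteq> {0..1} \<inter> {..s} \<and> (\<forall>r. A r \<in> sets borel)"
    unfolding cylinders_def mem_Collect_eq by (elim exE)
  then show ?thesis by (intro that[of J A]) simp_all
qed

lemma Int_stable_cylinders: "Int_stable (cylinders s)"
proof (rule Int_stableI)
  fix C D assume *: "C \<in> cylinders s" "D \<in> cylinders s"
  obtain J A where C: "C = {\<omega> \<in> paths. \<forall>r\<in>J. \<omega> r \<in> A r}" "finite J" "J \<subseteq> {0..1} \<inter> {..s}" "\<forall>r. A r \<in> sets borel"
    by (rule cylindersE[OF *(1)])
  obtain K B where D: "D = {\<omega> \<in> paths. \<forall>r\<in>K. \<omega> r \<in> B r}" "finite K" "K \<subseteq> {0..1} \<inter> {..s}" "\<forall>r. B r \<in> sets borel"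
    by (rule cylindersE[OF *(2)])
  define E where "E r = (if r \<in> J then A r else UNIV) \<inter> (if r \<in> K then B r else UNIV)" for r
  have "{\<omega> \<in> paths. \<forall>r\<in>J \<union> K. \<omega> r \<in> E r} \<in> cylinders s"
    by (rule cylindersI) (use C(2-4) D(2-4) in \<open>simp_all add: E_def\<close>)
  also have "{\<omega> \<in> paths. \<forall>r\<in>J \<union> K. \<omega> r \<in> E r} = C \<inter> D"
    unfolding C(1) D(1) E_def by auto
  finally show "C \<inter> D \<in> cylinders s" .
qed

lemma sets_natural_filtration_cylinders: "sets (natural_filtration s) = sigma_sets paths (cylinders s)"
  unfolding sets_natural_filtration
proof (rule antisym)
  show "sigma_sets paths {(\<lambda>\<omega>. \<omega> r) -` A \<inter> paths | r A. r \<in> {0..1} \<and> r \<le> s \<and> A \<in> sets borel}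
      \<subseteq> sigma_sets paths (cylinders s)"
  proof (rule sigma_sets_mono', rule subsetI)
    fix C assume "C \<in> {(\<lambda>\<omega>. \<omega> r) -` A \<inter> paths | r A. r \<in> {0..1} \<and> r \<le> s \<and> A \<in> sets borel}"
    then obtain r A where *: "C = (\<lambda>\<omega>. \<omega> r) -` A \<inter> paths" "r \<in> {0..1}" "r \<le> s" "A \<in> sets borel"
      unfolding mem_Collect_eq by (elim exE conjE)
    have "{\<omega> \<in> paths. \<forall>r'\<in>{r}. \<omega> r' \<in> A} \<in> cylinders s"
      by (rule cylindersI) (use * in auto)
    also have "{\<omega> \<in> paths. \<forall>r'\<in>{r}. \<omega> r' \<in> A} = C" using *(1) by auto
    finally show "C \<in> cylinders s" .
  qed
  have "C \<in> sets (natural_filtration s)" if "C \<in> cylinders s" for C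
  proof -
    obtain J A where C: "C = {\<omega> \<in> paths. \<forall>r\<in>J. \<omega> r \<in> A r}" "finite J"
      "J \<subseteq> {0..1} \<inter> {..s}" "\<forall>r. A r \<in> sets borel"
      by (rule cylindersE[OF \<open>C \<in> cylinders s\<close>])
    have "{\<omega> \<in> space (natural_filtration s). \<forall>r\<in>J. \<omega> r \<in> A r} \<in> sets (natural_filtration s)"
    proof (rule sets.sets_Collect_finite_All[OF _ C(2)])
      fix r assume "r \<in> J"
      then show "{\<omega> \<in> space (natural_filtration s). \<omega> r \<in> A r} \<in> sets (natural_filtration s)"
        using measurable_sets[OF measurable_evaluation_filtration[of r s] C(4)[rule_format, of r]] C(3)
        by (auto simp: vimage_def Int_def conj_commute)
    qed
    then show ?thesis using C(1) by simp
  qed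
  then have "cylinders s \<subseteq> sets (natural_filtration s)" by blast
  from sets.sigma_sets_subset[OF this]
  show "sigma_sets paths (cylinders s)
      \<subseteq> sigma_sets paths {(\<lambda>\<omega>. \<omega> r) -` A \<inter> paths | r A. r \<in> {0..1} \<and> r \<le> s \<and> A \<in> sets borel}"
    by (simp add: sets_natural_filtration)
qed

text \<open>Wiener measure is given by independent increments over finite grids. After the times 0 and \<open>s\<close> are
  added to the times of the cylinder, the values of the path at these times are sums of increments
  up to \<open>s\<close>, since the path starts at 0 almost surely. So the cylinder agrees almost surely with an
  event about grid increments that precede the last one.\<close>

lemma cylinder_increment_independent:
  assumes st: "0 \<le> s" "s < t" "t \<le> 1" and C: "C \<in> cylinders s" and B: "B \<in> sets borel"
  shows "prob (C \<inter> ((\<lambda>\<omega>. \<omega> t - \<omega> s) -` B \<inter> paths)) = prob C * prob ((\<lambda>\<omega>. \<omega> t - \<omega> s) -` B \<inter> paths)"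
proof -
  obtain J0 A0 where C0: "C = {\<omega> \<in> paths. \<forall>r\<in>J0. \<omega> r \<in> A0 r}" "finite J0"
      "J0 \<subseteq> {0..1} \<inter> {..s}" "\<forall>r. A0 r \<in> sets borel"
    by (rule cylindersE[OF C])
  define J where "J = insert 0 (insert s J0)"
  define A where "A r = (if r \<in> J0 then A0 r else UNIV)" for r
  have J: "finite J" "J \<subseteq> {0..s}" "0 \<in> J" "s \<in> J" using C0(2,3) st by (auto simp: J_def)
  have A: "A r \<in> sets borel" for r using C0(4) by (auto simp: A_def)
  have CJ: "C = {\<omega> \<in> paths. \<forall>r\<in>J. \<omega> r \<in> A r}" unfolding C0 J_def A_def by auto
  define xs where "xs = sorted_list_of_set J"
  have xs: "sorted_wrt (<) xs" "set xs = J" "xs \<noteq> []" using J by (auto simp: xs_def strict_sorted_list_of_set)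
  define n where "n = length xs - 1"
  have len: "length xs = Suc n" using xs(3) by (simp add: n_def)
  \<comment> \<open>the grid \<open>0 = \<tau> 0 < \<dots> < \<tau> n = s < \<tau> (n + 1) = t\<close>\<close>
  define \<tau> where "\<tau> k = (if k \<le> n then xs ! k else t)" for k
  have inJ: "\<tau> k \<in> J" if "k \<le> n" for k using that len xs(2) by (auto simp: \<tau>_def)
  have mono: "xs ! i < xs ! j" if "i < j" "j \<le> n" for i j
    using sorted_wrt_nth_less[OF xs(1) that(1)] that(2) len by simp
  have \<tau>0: "\<tau> 0 = 0"
  proof -
    have "0 \<in> set xs" using J(3) xs(2) by simp
    then obtain j where j: "j \<le> n" "xs ! j = 0" unfolding in_set_conv_nth len less_Suc_eq_le by blast
    then have "j = 0" using mono[of 0 j] inJ[of 0] J(2) by (cases j) (auto simp: \<tau>_def subset_iff)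
    then show ?thesis using j by (simp add: \<tau>_def)
  qed
  have \<tau>n: "\<tau> n = s"
  proof -
    have "s \<in> set xs" using J(4) xs(2) by simp
    then obtain j where j: "j \<le> n" "xs ! j = s" unfolding in_set_conv_nth len less_Suc_eq_le by blast
    then have "j = n" using mono[of j n] inJ[of n] J(2) by (cases "j = n") (auto simp: \<tau>_def subset_iff)
    then show ?thesis using j by (simp add: \<tau>_def)
  qed
  have range: "\<tau> k \<in> {0..1}" if "k \<le> Suc n" for k
  proof (cases "k \<le> n")
    case True
    then have "\<tau> k \<in> {0..s}" using inJ J(2) by blast
    then show ?thesis using st by auto
  qed (use st in \<open>auto simp: \<tau>_def\<close>)
  have incr: "\<tau> k < \<tau> (Suc k)" if "k < Suc n" for k
  proof (cases "k = n")
    case True then show ?thesis using \<tau>n st by (simp add: \<tau>_def)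
  next
    case False then show ?thesis using that mono[of k "Suc k"] by (auto simp: \<tau>_def)
  qed
  define D :: "nat \<times> 3 \<Rightarrow> path \<Rightarrow> real" where "D = (\<lambda>(k, i) \<omega>. (\<omega> (\<tau> (Suc k)) - \<omega> (\<tau> k)) $ i)"
  have "indep_vars (\<lambda>_. borel) D ({..<Suc n} \<times> (UNIV :: 3 set))"
    unfolding D_def by (rule grid_increments_independent) (use range incr in auto)
  note ind = indep_var_restrict[OF this, of "{..<n} \<times> UNIV" "{n} \<times> UNIV"]
  let ?P1 = "PiM ({..<n} \<times> (UNIV :: 3 set)) (\<lambda>_. borel :: real measure)"
  let ?P2 = "PiM ({n} \<times> (UNIV :: 3 set)) (\<lambda>_. borel :: real measure)"
  have ind': "indep_var ?P1 (\<lambda>\<omega>. restrict (\<lambda>i. D i \<omega>) ({..<n} \<times> UNIV)) ?P2 (\<lambda>\<omega>. restrict (\<lambda>i. D i \<omega>) ({n} \<times> UNIV))"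
    by (rule ind) auto
  define E1 where "E1 = {f \<in> space ?P1. \<forall>k\<in>{..n}. (\<chi> i. \<Sum>j<k. f (j, i)) \<in> A (\<tau> k)}"
  define E2 where "E2 = {f \<in> space ?P2. (\<chi> i. f (n, i)) \<in> B}"
  have E1: "E1 \<in> sets ?P1"
    unfolding E1_def
  proof (rule sets.sets_Collect_finite_All)
    fix k assume k: "k \<in> {..n}"
    have "(\<lambda>f. (\<chi> i. \<Sum>j<k. f (j, i)) :: real ^ 3) \<in> borel_measurable ?P1"
      by (rule borel_measurable_vecI) (use k in \<open>auto intro!: borel_measurable_sum measurable_component_singleton\<close>)
    from measurable_sets[OF this A[of "\<tau> k"]]
    show "{f \<in> space ?P1. (\<chi> i. \<Sum>j<k. f (j, i)) \<in> A (\<tau> k)} \<in> sets ?P1"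
      by (simp add: vimage_def Int_def conj_commute)
  qed auto
  have E2: "E2 \<in> sets ?P2"
  proof -
    have "(\<lambda>f. (\<chi> i. f (n, i)) :: real ^ 3) \<in> borel_measurable ?P2"
      by (rule borel_measurable_vecI) (auto intro!: measurable_component_singleton)
    from measurable_sets[OF this B] show ?thesis
      by (simp add: E2_def vimage_def Int_def conj_commute)
  qed
  let ?X = "\<lambda>\<omega>. restrict (\<lambda>i. D i \<omega>) ({..<n} \<times> (UNIV :: 3 set))"
  let ?Y = "\<lambda>\<omega>. restrict (\<lambda>i. D i \<omega>) ({n} \<times> (UNIV :: 3 set))"
  have X: "?X \<in> \<mu> \<rightarrow>\<^sub>M ?P1" and Y: "?Y \<in> \<mu> \<rightarrow>\<^sub>M ?P2"
    using indep_var_rv1[OF ind'] indep_var_rv2[OF ind'] by auto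
  have Yeq: "?Y -` E2 \<inter> space \<mu> = (\<lambda>\<omega>. \<omega> t - \<omega> s) -` B \<inter> paths"
  proof -
    have "(\<chi> i. ?Y \<omega> (n, i)) = \<omega> t - \<omega> s" for \<omega>
      using \<tau>n by (simp add: D_def vec_eq_iff) (simp add: \<tau>_def)
    then show ?thesis by (auto simp: E2_def space_PiM)
  qed
  have vec: "(\<chi> i. \<Sum>j<k. ?X \<omega> (j, i)) = \<omega> (\<tau> k)" if "\<omega> 0 = 0" "k \<le> n" for \<omega> k
  proof (rule vec_eq_iff[THEN iffD2], rule allI)
    fix i
    have "(\<chi> i. \<Sum>j<k. ?X \<omega> (j, i)) $ i = (\<Sum>j<k. \<omega> (\<tau> (Suc j)) $ i - \<omega> (\<tau> j) $ i)"
      using that by (auto simp: D_def intro!: sum.cong)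
    also have "\<dots> = \<omega> (\<tau> k) $ i" by (subst sum_lessThan_telescope) (simp add: \<tau>0 that)
    finally show "(\<chi> i. \<Sum>j<k. ?X \<omega> (j, i)) $ i = \<omega> (\<tau> k) $ i" .
  qed
  have Jimg: "J = \<tau> ` {..n}"
  proof (rule antisym)
    show "\<tau> ` {..n} \<subseteq> J" using inJ by blast
    show "J \<subseteq> \<tau> ` {..n}"
    proof
      fix r assume "r \<in> J"
      then have "r \<in> set xs" using xs(2) by simp
      then obtain j where "j < length xs" "xs ! j = r" unfolding in_set_conv_nth by blast
      then show "r \<in> \<tau> ` {..n}" using len by (intro image_eqI[of _ _ j]) (simp_all add: \<tau>_def)
    qed
  qed
  have X_iff: "\<omega> \<in> ?X -` E1 \<inter> space \<mu> \<longleftrightarrow> \<omega> \<in> C" if "\<omega> 0 = 0" for \<omega>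
    unfolding E1_def CJ Jimg using vec[of \<omega>, OF that] by (auto simp: space_PiM)
  have AE1: "AE \<omega> in \<mu>. \<omega> \<in> ?X -` E1 \<inter> space \<mu> \<longleftrightarrow> \<omega> \<in> C"
    using starts_at_zero by eventually_elim (use X_iff in blast)
  have Cs: "C \<in> sets \<mu>"
    using C filtration_subset_events[of C s] sets_natural_filtration_cylinders by auto
  have Xs: "?X -` E1 \<inter> space \<mu> \<in> sets \<mu>" using measurable_sets[OF X E1] .
  have Ys: "?Y -` E2 \<inter> space \<mu> \<in> sets \<mu>" using measurable_sets[OF Y E2] .
  have "prob (C \<inter> (?Y -` E2 \<inter> space \<mu>)) = prob ((?X -` E1 \<inter> space \<mu>) \<inter> (?Y -` E2 \<inter> space \<mu>))"
    by (rule measure_eq_AE) (use AE1 Cs Xs Ys in auto)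
  also have "\<dots> = prob ((\<lambda>x. (?X x, ?Y x)) -` (E1 \<times> E2) \<inter> space \<mu>)"
    by (rule arg_cong[where f=prob]) auto
  also have "\<dots> = prob (?X -` E1 \<inter> space \<mu>) * prob (?Y -` E2 \<inter> space \<mu>)"
    by (rule indep_varD[OF ind' E1 E2])
  also have "prob (?X -` E1 \<inter> space \<mu>) = prob C"
    by (rule measure_eq_AE) (use AE1 Cs Xs in auto)
  finally show ?thesis unfolding Yeq .
qed

lemma increment_independent_of_past:
  assumes st: "0 \<le> s" "s < t" "t \<le> 1"
    and A: "A \<in> sets (natural_filtration s)" and B: "B \<in> sets borel"
  shows "prob (A \<inter> ((\<lambda>\<omega>. \<omega> t - \<omega> s) -` B \<inter> paths)) = prob A * prob ((\<lambda>\<omega>. \<omega> t - \<omega> s) -` B \<inter> paths)"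
proof -
  have rv: "random_variable borel (\<lambda>\<omega>. \<omega> t - \<omega> s)"
    using st by (intro borel_measurable_diff evaluation) auto
  let ?G = "{(\<lambda>\<omega>. \<omega> t - \<omega> s) -` B \<inter> space \<mu> | B. B \<in> sets borel}"
  have "indep_set (cylinders s) ?G"
  proof (rule indep_setI)
    show "cylinders s \<subseteq> events"
      using filtration_subset_events[of _ s] by (auto simp: sets_natural_filtration_cylinders)
    show "?G \<subseteq> events" using measurable_sets[OF rv] by auto
  qed (use cylinder_increment_independent[OF st] in auto)
  then have "indep_set (sigma_sets (space \<mu>) (cylinders s)) (sigma_sets (space \<mu>) ?G)"
  proof (rule indep_set_sigma_sets[OF _ Int_stable_cylinders])
    show "Int_stable ?G"
    proof (rule Int_stableI)
      fix a b assume "a \<in> ?G" "b \<in> ?G"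
      then obtain A B where "a = (\<lambda>\<omega>. \<omega> t - \<omega> s) -` A \<inter> space \<mu>" "b = (\<lambda>\<omega>. \<omega> t - \<omega> s) -` B \<inter> space \<mu>"
        "A \<in> sets borel" "B \<in> sets borel" by auto
      then show "a \<inter> b \<in> ?G" by (intro CollectI exI[of _ "A \<inter> B"]) auto
    qed
  qed
  from indep_setD[OF this, of A "(\<lambda>\<omega>. \<omega> t - \<omega> s) -` B \<inter> paths"] show ?thesis
    using A B by (auto simp: sets_natural_filtration_cylinders intro!: sigma_sets.Basic)
qed

lemma past_increment_law:
  assumes "0 \<le> s" "s < t" "t \<le> 1"
  shows "distr \<mu> (natural_filtration s \<Otimes>\<^sub>M borel) (\<lambda>\<omega>. (\<omega>, \<omega> t - \<omega> s)) =
    distr \<mu> (natural_filtration s) (\<lambda>\<omega>. \<omega>) \<Otimes>\<^sub>M distr \<mu> borel (\<lambda>\<omega>. \<omega> t - \<omega> s)"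
proof (rule pair_measure_eqI[symmetric])
  note [measurable] = identity_measurable[of s]
  have rv[measurable]: "(\<lambda>\<omega>. \<omega> t - \<omega> s) \<in> borel_measurable \<mu>"
    using assms by (intro borel_measurable_diff evaluation) auto
  show "sigma_finite_measure (distr \<mu> (natural_filtration s) (\<lambda>\<omega>. \<omega>))"
    and "sigma_finite_measure (distr \<mu> borel (\<lambda>\<omega>. \<omega> t - \<omega> s))"
    by (auto intro!: prob_space_imp_sigma_finite prob_space_distr)
  fix A and B :: "(real^3) set"
  assume "A \<in> sets (distr \<mu> (natural_filtration s) (\<lambda>\<omega>. \<omega>))" "B \<in> sets (distr \<mu> borel (\<lambda>\<omega>. \<omega> t - \<omega> s))"
  then have A[measurable]: "A \<in> sets (natural_filtration s)" and B[measurable]: "B \<in> sets borel" by auto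
  have AP: "A \<subseteq> paths" using sets.sets_into_space[OF A] by simp
  have "emeasure (distr \<mu> (natural_filtration s) (\<lambda>\<omega>. \<omega>)) A * emeasure (distr \<mu> borel (\<lambda>\<omega>. \<omega> t - \<omega> s)) B
      = emeasure \<mu> A * emeasure \<mu> ((\<lambda>\<omega>. \<omega> t - \<omega> s) -` B \<inter> paths)"
    using AP by (simp add: emeasure_distr Int_absorb2)
  also have "\<dots> = emeasure \<mu> (A \<inter> ((\<lambda>\<omega>. \<omega> t - \<omega> s) -` B \<inter> paths))"
    by (simp only: emeasure_eq_measure ennreal_mult' measure_nonneg
        increment_independent_of_past[OF assms A B])
  also have "A \<inter> ((\<lambda>\<omega>. \<omega> t - \<omega> s) -` B \<inter> paths) = (\<lambda>\<omega>. (\<omega>, \<omega> t - \<omega> s)) -` (A \<times> B) \<inter> space \<mu>"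
    using AP by auto
  also have "emeasure \<mu> \<dots> = emeasure (distr \<mu> (natural_filtration s \<Otimes>\<^sub>M borel) (\<lambda>\<omega>. (\<omega>, \<omega> t - \<omega> s))) (A \<times> B)"
    by (subst emeasure_distr) auto
  finally show "emeasure (distr \<mu> (natural_filtration s) (\<lambda>\<omega>. \<omega>)) A * emeasure (distr \<mu> borel (\<lambda>\<omega>. \<omega> t - \<omega> s)) B
    = emeasure (distr \<mu> (natural_filtration s \<Otimes>\<^sub>M borel) (\<lambda>\<omega>. (\<omega>, \<omega> t - \<omega> s))) (A \<times> B)" .
qed (simp cong: sets_pair_measure_cong)

text \<open>Since the increment is independent of the past, it may be taken from a second, independent path
  \<open>\<omega>'\<close>. This replaces conditional expectations given the past throughout.\<close>

lemma decoupling_nn_integral: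
  assumes st: "0 \<le> s" "s < t" "t \<le> 1"
    and F[measurable]: "F \<in> borel_measurable (natural_filtration s \<Otimes>\<^sub>M borel)"
  shows "(\<integral>\<^sup>+\<omega>. F (\<omega>, \<omega> t - \<omega> s) \<partial>\<mu>) = (\<integral>\<^sup>+\<omega>. \<integral>\<^sup>+\<omega>'. F (\<omega>, \<omega>' t - \<omega>' s) \<partial>\<mu> \<partial>\<mu>)"
proof -
  note [measurable] = identity_measurable[of s]
  have [measurable]: "(\<lambda>\<omega>. \<omega> t - \<omega> s) \<in> borel_measurable \<mu>"
    using st by (intro borel_measurable_diff evaluation) auto
  interpret N: prob_space "distr \<mu> borel (\<lambda>\<omega>. \<omega> t - \<omega> s)" by (rule prob_space_distr) simp
  have "(\<integral>\<^sup>+\<omega>. F (\<omega>, \<omega> t - \<omega> s) \<partial>\<mu>) = (\<integral>\<^sup>+z. F z \<partial>distr \<mu> (natural_filtration s \<Otimes>\<^sub>M borel) (\<lambda>\<omega>. (\<omega>, \<omega> t - \<omega> s)))"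
    by (subst nn_integral_distr) auto
  also have "\<dots> = (\<integral>\<^sup>+\<omega>. \<integral>\<^sup>+y. F (\<omega>, y) \<partial>distr \<mu> borel (\<lambda>\<omega>. \<omega> t - \<omega> s) \<partial>distr \<mu> (natural_filtration s) (\<lambda>\<omega>. \<omega>))"
    unfolding past_increment_law[OF st] by (subst N.nn_integral_fst) auto
  also have "\<dots> = (\<integral>\<^sup>+\<omega>. \<integral>\<^sup>+y. F (\<omega>, y) \<partial>distr \<mu> borel (\<lambda>\<omega>. \<omega> t - \<omega> s) \<partial>\<mu>)"
    by (subst nn_integral_distr) auto
  also have "\<dots> = (\<integral>\<^sup>+\<omega>. \<integral>\<^sup>+\<omega>'. F (\<omega>, \<omega>' t - \<omega>' s) \<partial>\<mu> \<partial>\<mu>)"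
    by (intro nn_integral_cong, subst nn_integral_distr) auto
  finally show ?thesis .
qed

lemma decoupling_integral:
  fixes F :: "path \<times> (real^3) \<Rightarrow> real"
  assumes st: "0 \<le> s" "s < t" "t \<le> 1"
    and F[measurable]: "F \<in> borel_measurable (natural_filtration s \<Otimes>\<^sub>M borel)"
    and int: "integrable \<mu> (\<lambda>\<omega>. F (\<omega>, \<omega> t - \<omega> s))"
  shows "(\<integral>\<omega>. F (\<omega>, \<omega> t - \<omega> s) \<partial>\<mu>) = (\<integral>\<omega>. \<integral>\<omega>'. F (\<omega>, \<omega>' t - \<omega>' s) \<partial>\<mu> \<partial>\<mu>)"
proof -
  note [measurable] = identity_measurable[of s]
  have [measurable]: "(\<lambda>\<omega>. \<omega> t - \<omega> s) \<in> borel_measurable \<mu>"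
    using st by (intro borel_measurable_diff evaluation) auto
  interpret N: prob_space "distr \<mu> borel (\<lambda>\<omega>. \<omega> t - \<omega> s)" by (rule prob_space_distr) simp
  interpret I: prob_space "distr \<mu> (natural_filtration s) (\<lambda>\<omega>. \<omega>)" by (rule prob_space_distr) simp
  interpret pair_prob_space "distr \<mu> (natural_filtration s) (\<lambda>\<omega>. \<omega>)" "distr \<mu> borel (\<lambda>\<omega>. \<omega> t - \<omega> s)" ..
  have "integrable (distr \<mu> (natural_filtration s \<Otimes>\<^sub>M borel) (\<lambda>\<omega>. (\<omega>, \<omega> t - \<omega> s))) F"
    using int by (subst integrable_distr_eq) auto
  then have iF: "integrable (distr \<mu> (natural_filtration s) (\<lambda>\<omega>. \<omega>) \<Otimes>\<^sub>M distr \<mu> borel (\<lambda>\<omega>. \<omega> t - \<omega> s)) F"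
    unfolding past_increment_law[OF st] .
  have "(\<integral>\<omega>. F (\<omega>, \<omega> t - \<omega> s) \<partial>\<mu>) = (\<integral>z. F z \<partial>distr \<mu> (natural_filtration s \<Otimes>\<^sub>M borel) (\<lambda>\<omega>. (\<omega>, \<omega> t - \<omega> s)))"
    by (subst integral_distr) auto
  also have "\<dots> = (\<integral>\<omega>. \<integral>y. F (\<omega>, y) \<partial>distr \<mu> borel (\<lambda>\<omega>. \<omega> t - \<omega> s) \<partial>distr \<mu> (natural_filtration s) (\<lambda>\<omega>. \<omega>))"
    unfolding past_increment_law[OF st] by (rule integral_fst'[OF iF, symmetric])
  also have "\<dots> = (\<integral>\<omega>. \<integral>y. F (\<omega>, y) \<partial>distr \<mu> borel (\<lambda>\<omega>. \<omega> t - \<omega> s) \<partial>\<mu>)"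
    by (subst integral_distr) auto
  also have "\<dots> = (\<integral>\<omega>. \<integral>\<omega>'. F (\<omega>, \<omega>' t - \<omega>' s) \<partial>\<mu> \<partial>\<mu>)"
    by (intro Bochner_Integration.integral_cong refl, subst integral_distr) auto
  finally show ?thesis .
qed

end


section \<open>Exponentially tilted Gaussian increments\<close>

lemma norm_sq_real3: "(norm (y :: real ^ 3))\<^sup>2 = (y$1)\<^sup>2 + (y$2)\<^sup>2 + (y$3)\<^sup>2"
  unfolding power2_norm_eq_inner inner_vec_def sum_3 by (simp add: power2_eq_square)

lemma norm_4_real3_le: "norm (y :: real ^ 3) ^ 4 \<le> 3 * ((y$1)^4 + (y$2)^4 + (y$3)^4)"
proof -
  have *: "(a + b + c)\<^sup>2 \<le> 3 * (a\<^sup>2 + b\<^sup>2 + c\<^sup>2)" for a b c :: real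
    using sum_squares_ge_zero[of "a - b" "b - c"] zero_le_power2[of "a - c"]
    by (simp add: power2_eq_square algebra_simps)
  have "norm y ^ 4 = ((norm y)\<^sup>2)\<^sup>2" by simp
  also have "\<dots> \<le> 3 * (((y$1)\<^sup>2)\<^sup>2 + ((y$2)\<^sup>2)\<^sup>2 + ((y$3)\<^sup>2)\<^sup>2)"
    unfolding norm_sq_real3 by (rule *)
  finally show ?thesis by simp
qed

text \<open>Completing the square: an exponential tilt only moves the mean of a Gaussian.\<close>

lemma normal_density_tilt:
  assumes "h > 0"
  shows "normal_density 0 (sqrt h) y * exp (- (a * y) - a\<^sup>2 * h / 2) = normal_density (- (a * h)) (sqrt h) y"
proof -
  have "- y\<^sup>2 / (2 * h) + (- (a * y) - a\<^sup>2 * h / 2) = - (y + a * h)\<^sup>2 / (2 * h)"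
    using assms by (simp add: field_simps power2_eq_square)
  then have "exp (- y\<^sup>2 / (2 * h)) * exp (- (a * y) - a\<^sup>2 * h / 2) = exp (- (y + a * h)\<^sup>2 / (2 * h))"
    by (simp only: exp_add[symmetric])
  then show ?thesis using assms by (simp add: normal_density_def)
qed

lemma normal_raw_moments:
  assumes s: "\<sigma> > 0"
  shows "has_bochner_integral lborel (\<lambda>x. normal_density m \<sigma> x * 1) 1"
    and "has_bochner_integral lborel (\<lambda>x. normal_density m \<sigma> x * x) m"
    and "has_bochner_integral lborel (\<lambda>x. normal_density m \<sigma> x * x ^ 2) (\<sigma>\<^sup>2 + m\<^sup>2)"
    and "has_bochner_integral lborel (\<lambda>x. normal_density m \<sigma> x * x ^ 4) (3 * \<sigma>^4 + 6 * \<sigma>\<^sup>2 * m\<^sup>2 + m^4)"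
proof -
  have c0: "has_bochner_integral lborel (\<lambda>x. normal_density m \<sigma> x) 1"
    using normal_moment_even[OF s, of m 0] by simp
  have c1: "has_bochner_integral lborel (\<lambda>x. normal_density m \<sigma> x * (x - m)) 0"
    using normal_moment_odd[OF s, of m 0] by simp
  have c2: "has_bochner_integral lborel (\<lambda>x. normal_density m \<sigma> x * (x - m) ^ 2) (\<sigma>\<^sup>2)"
    using normal_moment_even[OF s, of m 1] by simp
  have c3: "has_bochner_integral lborel (\<lambda>x. normal_density m \<sigma> x * (x - m) ^ 3) 0"
    using normal_moment_odd[OF s, of m 1] by (simp add: numeral_3_eq_3)
  have c4: "has_bochner_integral lborel (\<lambda>x. normal_density m \<sigma> x * (x - m) ^ 4) (3 * \<sigma>^4)"
  proof -
    have "fact (2 * 2) / ((2 / \<sigma>\<^sup>2)^2 * fact 2) = 3 * \<sigma>^4"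
      using s by (simp add: fact_numeral field_simps)
    then show ?thesis using normal_moment_even[OF s, of m 2] by simp
  qed
  show "has_bochner_integral lborel (\<lambda>x. normal_density m \<sigma> x * 1) 1" using c0 by simp
  have "has_bochner_integral lborel (\<lambda>x. normal_density m \<sigma> x * (x - m) + m * normal_density m \<sigma> x) (0 + m * 1)"
    by (intro has_bochner_integral_add has_bochner_integral_mult_right c0 c1)
  then show "has_bochner_integral lborel (\<lambda>x. normal_density m \<sigma> x * x) m" by (simp add: algebra_simps)
  have "has_bochner_integral lborel (\<lambda>x. normal_density m \<sigma> x * (x - m)^2
      + ((2 * m) * (normal_density m \<sigma> x * (x - m)) + m\<^sup>2 * normal_density m \<sigma> x)) (\<sigma>\<^sup>2 + (2 * m * 0 + m\<^sup>2 * 1))"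
    by (intro has_bochner_integral_add has_bochner_integral_mult_right c0 c1 c2)
  then show "has_bochner_integral lborel (\<lambda>x. normal_density m \<sigma> x * x ^ 2) (\<sigma>\<^sup>2 + m\<^sup>2)"
    by (simp add: algebra_simps power2_eq_square)
  have "has_bochner_integral lborel (\<lambda>x. normal_density m \<sigma> x * (x - m)^4
      + ((4 * m) * (normal_density m \<sigma> x * (x - m)^3) + ((6 * m\<^sup>2) * (normal_density m \<sigma> x * (x - m)^2)
      + ((4 * m^3) * (normal_density m \<sigma> x * (x - m)) + m^4 * normal_density m \<sigma> x))))
      (3 * \<sigma>^4 + (4 * m * 0 + (6 * m\<^sup>2 * \<sigma>\<^sup>2 + (4 * m^3 * 0 + m^4 * 1))))"
    by (intro has_bochner_integral_add has_bochner_integral_mult_right c0 c1 c2 c3 c4)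
  moreover have "normal_density m \<sigma> x * (x - m)^4
      + ((4 * m) * (normal_density m \<sigma> x * (x - m)^3) + ((6 * m\<^sup>2) * (normal_density m \<sigma> x * (x - m)^2)
      + ((4 * m^3) * (normal_density m \<sigma> x * (x - m)) + m^4 * normal_density m \<sigma> x)))
      = normal_density m \<sigma> x * x ^ 4" for x
    by (simp add: algebra_simps power2_eq_square power3_eq_cube power4_eq_xxxx)
  ultimately show "has_bochner_integral lborel (\<lambda>x. normal_density m \<sigma> x * x ^ 4) (3 * \<sigma>^4 + 6 * \<sigma>\<^sup>2 * m\<^sup>2 + m^4)"
    by (simp add: ac_simps)
qed

text \<open>One factor of the discrete Girsanov weight, for a step of length \<open>h\<close> with increment \<open>y\<close>; it turns
  the increment into one with drift \<open>- a\<close>.\<close>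

definition tilt :: "real ^ 3 \<Rightarrow> real \<Rightarrow> real ^ 3 \<Rightarrow> real" where
  "tilt a h y = exp (- (a \<bullet> y) - (norm a)\<^sup>2 * h / 2)"

lemma tilt_nonneg [simp]: "tilt a h y \<ge> 0"
  by (simp add: tilt_def)

lemma tilt_measurable [measurable (raw)]:
  assumes "f \<in> borel_measurable M" "g \<in> borel_measurable M"
  shows "(\<lambda>x. tilt (f x) h (g x)) \<in> borel_measurable M"
  unfolding tilt_def using assms by measurable

lemma tilt_prod: "tilt a h y = (\<Prod>i\<in>UNIV. exp (- (a$i * y$i) - (a$i)\<^sup>2 * h / 2))"
  unfolding tilt_def by (subst exp_sum[symmetric])
    (auto simp: inner_vec_def sum_3 norm_sq_real3 algebra_simps add_divide_distrib)

context brownian_paths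
begin

lemma increment_measurable [measurable]:
  "s \<in> {0..1} \<Longrightarrow> t \<in> {0..1} \<Longrightarrow> (\<lambda>\<omega>. \<omega> t - \<omega> s) \<in> borel_measurable \<mu>"
  by (intro borel_measurable_diff evaluation)

lemma increment_components_independent:
  assumes "0 \<le> s" "s < t" "t \<le> 1"
  shows "indep_vars (\<lambda>_. borel) (\<lambda>i \<omega>. (\<omega> t - \<omega> s) $ i) (UNIV :: 3 set)"
proof -
  let ?\<tau> = "\<lambda>k::nat. if k = 0 then s else t"
  have "indep_vars (\<lambda>_. borel) (\<lambda>(k, i) \<omega>. (\<omega> (?\<tau> (Suc k)) - \<omega> (?\<tau> k)) $ i) ({..<1} \<times> (UNIV :: 3 set))"
    by (rule grid_increments_independent) (use assms in auto)
  from indep_vars_restrict[OF this, of UNIV "\<lambda>i. {(0, i)}"]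
  have "indep_vars (\<lambda>i. PiM {(0, i)} (\<lambda>_. borel))
      (\<lambda>j \<omega>. restrict (\<lambda>x. (case x of (k, i) \<Rightarrow> \<lambda>\<omega>. (\<omega> (?\<tau> (Suc k)) - \<omega> (?\<tau> k)) $ i) \<omega>) {(0, j)}) (UNIV :: 3 set)"
    by (simp add: disjoint_family_on_def)
  from indep_vars_compose2[OF this, of "\<lambda>i f. f (0, i)" "\<lambda>_. borel"]
  show ?thesis by (simp add: measurable_component_singleton)
qed

text \<open>The tilt is a product over the three coordinates, which are independent, so that every coordinate
  becomes a Gaussian with shifted mean.\<close>

lemma tilted_product:
  fixes G :: "3 \<Rightarrow> real \<Rightarrow> real"
  assumes st: "0 \<le> s" "s < t" "t \<le> 1" and h: "h = t - s"
    and G: "\<And>i. has_bochner_integral lborel (\<lambda>x. normal_density (- (a$i * h)) (sqrt h) x * G i x) (c i)"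
    and Gm: "\<And>i. G i \<in> borel_measurable borel"
  shows "has_bochner_integral \<mu> (\<lambda>\<omega>. tilt a h (\<omega> t - \<omega> s) * (\<Prod>i\<in>UNIV. G i ((\<omega> t - \<omega> s) $ i))) (\<Prod>i\<in>UNIV. c i)"
proof -
  have h0: "h > 0" using st h by simp
  define E where "E i y = exp (- (a$i * y) - (a$i)\<^sup>2 * h / 2) * G i y" for i y
  have Em: "E i \<in> borel_measurable borel" for i unfolding E_def using Gm[of i] by measurable
  have ind: "indep_vars (\<lambda>_. borel) (\<lambda>i \<omega>. E i ((\<omega> t - \<omega> s) $ i)) UNIV"
    by (rule indep_vars_compose2[OF increment_components_independent[OF st]]) (use Em in auto)
  have eq: "normal_density 0 (sqrt h) y * E i y = normal_density (- (a$i * h)) (sqrt h) y * G i y" for i y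
    unfolding E_def normal_density_tilt[OF h0, symmetric] by (simp add: mult_ac)
  have int: "integrable \<mu> (\<lambda>\<omega>. E i ((\<omega> t - \<omega> s) $ i))" for i
    using G[of i] Em[of i] unfolding h
    by (subst distributed_integrable[OF increment_normal[OF st], symmetric])
      (auto simp: eq[unfolded h] has_bochner_integral_iff)
  have val: "(\<integral>\<omega>. E i ((\<omega> t - \<omega> s) $ i) \<partial>\<mu>) = c i" for i
    using G[of i] Em[of i] unfolding h
    by (subst distributed_integral[OF increment_normal[OF st], symmetric])
      (auto simp: eq[unfolded h] has_bochner_integral_iff)
  have "(\<lambda>\<omega>. \<Prod>i\<in>UNIV. E i ((\<omega> t - \<omega> s) $ i)) = (\<lambda>\<omega>. tilt a h (\<omega> t - \<omega> s) * (\<Prod>i\<in>UNIV. G i ((\<omega> t - \<omega> s) $ i)))"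
    by (simp add: tilt_prod E_def prod.distrib del: vector_minus_component)
  then show ?thesis
    using indep_vars_integrable[OF _ ind int] indep_vars_lebesgue_integral[OF _ ind int]
    by (simp add: has_bochner_integral_iff val del: vector_minus_component)
qed

lemma tilted_moments:
  assumes st: "0 \<le> s" "s < t" "t \<le> 1" and h: "h = t - s"
  shows "has_bochner_integral \<mu> (\<lambda>\<omega>. tilt a h (\<omega> t - \<omega> s)) 1"
    and "has_bochner_integral \<mu> (\<lambda>\<omega>. tilt a h (\<omega> t - \<omega> s) * (\<omega> t - \<omega> s) $ i) (- (a$i * h))"
    and "has_bochner_integral \<mu> (\<lambda>\<omega>. tilt a h (\<omega> t - \<omega> s) * ((\<omega> t - \<omega> s) $ i * (\<omega> t - \<omega> s) $ j))
           ((if i = j then h else 0) + a$i * a$j * h\<^sup>2)"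
    and "has_bochner_integral \<mu> (\<lambda>\<omega>. tilt a h (\<omega> t - \<omega> s) * (\<omega> t - \<omega> s) $ i ^ 4)
           (3 * h\<^sup>2 + 6 * h * (a$i * h)\<^sup>2 + (a$i * h)^4)"
proof -
  have h0: "sqrt h > 0" using st h by simp
  have sq: "(sqrt h)\<^sup>2 = h" "sqrt h ^ 4 = h\<^sup>2" using h0 by (simp_all add: power4_eq_xxxx power2_eq_square)
  have neg4: "(- x) ^ 4 = x ^ 4" for x :: real by simp
  have mom: "has_bochner_integral lborel (\<lambda>x. normal_density (- (a$k * h)) (sqrt h) x * 1) 1"
    "has_bochner_integral lborel (\<lambda>x. normal_density (- (a$k * h)) (sqrt h) x * x) (- (a$k * h))"
    "has_bochner_integral lborel (\<lambda>x. normal_density (- (a$k * h)) (sqrt h) x * x ^ 2) (h + (a$k * h)\<^sup>2)"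
    "has_bochner_integral lborel (\<lambda>x. normal_density (- (a$k * h)) (sqrt h) x * x ^ 4)
       (3 * h\<^sup>2 + 6 * h * (a$k * h)\<^sup>2 + (a$k * h)^4)" for k
    using normal_raw_moments[OF h0, of "- (a$k * h)", unfolded sq] by (simp_all only: power2_minus neg4)
  note P = tilted_product[OF st h]
  show "has_bochner_integral \<mu> (\<lambda>\<omega>. tilt a h (\<omega> t - \<omega> s)) 1"
    using P[of a "\<lambda>_ _. 1" "\<lambda>_. 1", OF mom(1)] by simp
  have single: "has_bochner_integral \<mu> (\<lambda>\<omega>. tilt a h (\<omega> t - \<omega> s) * f ((\<omega> t - \<omega> s) $ i)) c"
    if "has_bochner_integral lborel (\<lambda>x. normal_density (- (a$i * h)) (sqrt h) x * f x) c"
      and "f \<in> borel_measurable borel" for f c i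
  proof -
    have "has_bochner_integral \<mu> (\<lambda>\<omega>. tilt a h (\<omega> t - \<omega> s) *
        (\<Prod>k\<in>UNIV. if k = i then f ((\<omega> t - \<omega> s) $ k) else 1)) (\<Prod>k\<in>UNIV. if k = i then c else 1)"
      by (rule P[of a "\<lambda>k x. if k = i then f x else 1"]) (use that mom(1) in auto)
    then show ?thesis by (simp add: prod.delta del: vector_minus_component)
  qed
  show "has_bochner_integral \<mu> (\<lambda>\<omega>. tilt a h (\<omega> t - \<omega> s) * (\<omega> t - \<omega> s) $ i) (- (a$i * h))"
    by (rule single[OF mom(2)]) simp
  show "has_bochner_integral \<mu> (\<lambda>\<omega>. tilt a h (\<omega> t - \<omega> s) * (\<omega> t - \<omega> s) $ i ^ 4)
           (3 * h\<^sup>2 + 6 * h * (a$i * h)\<^sup>2 + (a$i * h)^4)"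
    by (rule single[OF mom(4)]) simp
  show "has_bochner_integral \<mu> (\<lambda>\<omega>. tilt a h (\<omega> t - \<omega> s) * ((\<omega> t - \<omega> s) $ i * (\<omega> t - \<omega> s) $ j))
           ((if i = j then h else 0) + a$i * a$j * h\<^sup>2)"
  proof (cases "i = j")
    case True
    have "has_bochner_integral \<mu> (\<lambda>\<omega>. tilt a h (\<omega> t - \<omega> s) * (\<omega> t - \<omega> s) $ i ^ 2) (h + (a$i * h)\<^sup>2)"
      by (rule single[OF mom(3)]) simp
    then show ?thesis using True by (simp add: power2_eq_square mult_ac)
  next
    case False
    have *: "(\<Prod>k\<in>UNIV. if k = i then f k else if k = j then f k else 1) = f i * f j" for f :: "3 \<Rightarrow> real"
    proof -
      have "(\<Prod>k\<in>UNIV. if k = i then f k else if k = j then f k else 1)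
          = (\<Prod>k\<in>UNIV. (if k = i then f k else 1) * (if k = j then f k else 1))"
        using False by (intro prod.cong) auto
      then show ?thesis by (simp add: prod.distrib prod.delta)
    qed
    have "has_bochner_integral \<mu> (\<lambda>\<omega>. tilt a h (\<omega> t - \<omega> s) *
        (\<Prod>k\<in>UNIV. if k = i then (\<omega> t - \<omega> s) $ k else if k = j then (\<omega> t - \<omega> s) $ k else 1))
        (\<Prod>k\<in>UNIV. if k = i then - (a$k * h) else if k = j then - (a$k * h) else 1)"
      by (rule P[of a "\<lambda>k x. if k = i then x else if k = j then x else 1"])
        (use mom(1,2) in auto)
    then show ?thesis unfolding * using False
      by (simp add: power2_eq_square mult_ac del: vector_minus_component)
  qed
qed

text \<open>Under the tilted law the increment has mean \<open>- h a\<close> and second moments \<open>h\<close> times the identity up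
  to order \<open>h\<^sup>2\<close>, so that to first order in \<open>h\<close> only \<open>c\<close>, \<open>a \<bullet> g\<close> and the trace of \<open>Q\<close> are left. The
  fourth power in the hypothesis takes care of large increments: it costs order \<open>h\<^sup>2\<close>.\<close>

lemma tilted_quadratic_estimate:
  fixes \<phi> :: "real ^ 3 \<Rightarrow> real"
  assumes st: "0 \<le> s" "s < t" "t \<le> 1" and h: "h = t - s"
    and \<phi>[measurable]: "\<phi> \<in> borel_measurable borel"
    and a: "norm a \<le> M" and Q: "\<And>i j. \<bar>Q i j\<bar> \<le> K" and e: "0 \<le> e" and C: "0 \<le> C"
    and approx: "\<And>y. \<bar>\<phi> y - (h * c + g \<bullet> y + (\<Sum>i\<in>UNIV. \<Sum>j\<in>UNIV. Q i j * (y$i * y$j)) / 2)\<bar>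
                     \<le> e * (h + (norm y)\<^sup>2) + C * norm y ^ 4"
  shows "integrable \<mu> (\<lambda>\<omega>. tilt a h (\<omega> t - \<omega> s) * \<phi> (\<omega> t - \<omega> s))"
    and "\<bar>(\<integral>\<omega>. tilt a h (\<omega> t - \<omega> s) * \<phi> (\<omega> t - \<omega> s) \<partial>\<mu>) - h * (c - a \<bullet> g + (\<Sum>i\<in>UNIV. Q i i) / 2)\<bar>
      \<le> e * (4 + M\<^sup>2) * h + (9 / 2 * K * M\<^sup>2 + 9 * C * (3 + 6 * M\<^sup>2 + M^4)) * h\<^sup>2"
proof -
  have h01: "0 < h" "h \<le> 1" using st h by auto
  have M0: "0 \<le> M" using a norm_ge_zero order_trans by blast
  have K0: "0 \<le> K" using Q[of 1 1] by linarith
  have ai: "\<bar>a$i\<bar> \<le> M" for i using component_le_norm_cart[of a i] a by linarith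
  have ai2: "(a$i)\<^sup>2 \<le> M\<^sup>2" for i using ai[of i] M0 by (simp add: abs_le_square_iff[symmetric])
  have ai4: "(a$i)^4 \<le> M^4" for i using power_mono[OF ai2[of i] zero_le_power2, of 2] by simp
  define T where "T = (\<lambda>\<omega>. tilt a h (\<omega> t - \<omega> s))"
  define Y where "Y = (\<lambda>\<omega>::path. \<omega> t - \<omega> s)"
  note m = tilted_moments[OF st h, of a]
  have m0: "has_bochner_integral \<mu> T 1" using m(1) by (simp only: T_def)
  have m1: "has_bochner_integral \<mu> (\<lambda>\<omega>. T \<omega> * Y \<omega> $ i) (- (a$i * h))" for i
    using m(2)[of i] by (simp only: Y_def T_def)
  have m2: "has_bochner_integral \<mu> (\<lambda>\<omega>. T \<omega> * (Y \<omega> $ i * Y \<omega> $ j)) ((if i = j then h else 0) + a$i * a$j * h\<^sup>2)" for i j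
    using m(3)[of i j] by (simp only: Y_def T_def)
  have m4: "has_bochner_integral \<mu> (\<lambda>\<omega>. T \<omega> * Y \<omega> $ i ^ 4) (3 * h\<^sup>2 + 6 * h * (a$i * h)\<^sup>2 + (a$i * h)^4)" for i
    using m(4)[of i] by (simp only: Y_def T_def)
  have [measurable]: "Y \<in> borel_measurable \<mu>" "T \<in> borel_measurable \<mu>"
    unfolding Y_def T_def using st by (auto intro!: increment_measurable tilt_measurable)
  have T0: "T \<omega> \<ge> 0" for \<omega> by (simp add: T_def)
  \<comment> \<open>the quadratic part, whose tilted mean is computed exactly\<close>
  define q where "q y = h * c + g \<bullet> y + (\<Sum>i\<in>UNIV. \<Sum>j\<in>UNIV. Q i j * (y$i * y$j)) / 2" for y :: "real^3"
  have "has_bochner_integral \<mu> (\<lambda>\<omega>. (h * c) * T \<omega> + ((\<Sum>i\<in>UNIV. g$i * (T \<omega> * Y \<omega> $ i))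
       + (\<Sum>i\<in>UNIV. \<Sum>j\<in>UNIV. Q i j / 2 * (T \<omega> * (Y \<omega> $ i * Y \<omega> $ j)))))
     (h * c * 1 + ((\<Sum>i\<in>UNIV. g$i * (- (a$i * h)))
       + (\<Sum>i\<in>UNIV. \<Sum>j\<in>UNIV. Q i j / 2 * ((if i = j then h else 0) + a$i * a$j * h\<^sup>2))))"
    by (intro has_bochner_integral_add has_bochner_integral_sum has_bochner_integral_mult_right m0 m1 m2)
  moreover have "(h * c) * T \<omega> + ((\<Sum>i\<in>UNIV. g$i * (T \<omega> * Y \<omega> $ i))
       + (\<Sum>i\<in>UNIV. \<Sum>j\<in>UNIV. Q i j / 2 * (T \<omega> * (Y \<omega> $ i * Y \<omega> $ j)))) = T \<omega> * q (Y \<omega>)" for \<omega>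
    by (simp add: q_def sum_3 inner_vec_def algebra_simps add_divide_distrib)
  moreover have "h * c * 1 + ((\<Sum>i\<in>UNIV. g$i * (- (a$i * h)))
       + (\<Sum>i\<in>UNIV. \<Sum>j\<in>UNIV. Q i j / 2 * ((if i = j then h else 0) + a$i * a$j * h\<^sup>2)))
     = h * (c - a \<bullet> g + (\<Sum>i\<in>UNIV. Q i i) / 2) + h\<^sup>2 / 2 * (\<Sum>i\<in>UNIV. \<Sum>j\<in>UNIV. Q i j * (a$i * a$j))"
    by (simp add: sum_3 inner_vec_def algebra_simps add_divide_distrib)
  ultimately have mq: "has_bochner_integral \<mu> (\<lambda>\<omega>. T \<omega> * q (Y \<omega>))
     (h * (c - a \<bullet> g + (\<Sum>i\<in>UNIV. Q i i) / 2) + h\<^sup>2 / 2 * (\<Sum>i\<in>UNIV. \<Sum>j\<in>UNIV. Q i j * (a$i * a$j)))"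
    by simp
  \<comment> \<open>a bound of the remainder by monomials\<close>
  define r where "r y = e * (h + ((y$1)\<^sup>2 + (y$2)\<^sup>2 + (y$3)\<^sup>2)) + C * (3 * ((y$1)^4 + (y$2)^4 + (y$3)^4))" for y :: "real^3"
  define S4 where "S4 = (\<lambda>i. 3 * h\<^sup>2 + 6 * h * (a$i * h)\<^sup>2 + (a$i * h)^4)"
  have "has_bochner_integral \<mu> (\<lambda>\<omega>. (e * h) * T \<omega> + (e * (T \<omega> * (Y \<omega> $ 1 * Y \<omega> $ 1) + (T \<omega> * (Y \<omega> $ 2 * Y \<omega> $ 2) + T \<omega> * (Y \<omega> $ 3 * Y \<omega> $ 3)))
        + (3 * C) * (T \<omega> * Y \<omega> $ 1 ^ 4 + (T \<omega> * Y \<omega> $ 2 ^ 4 + T \<omega> * Y \<omega> $ 3 ^ 4))))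
     (e * h * 1 + (e * (((if (1::3) = 1 then h else 0) + a$1 * a$1 * h\<^sup>2) + (((if (2::3) = 2 then h else 0) + a$2 * a$2 * h\<^sup>2) + ((if (3::3) = 3 then h else 0) + a$3 * a$3 * h\<^sup>2)))
        + 3 * C * (S4 1 + (S4 2 + S4 3))))"
    unfolding S4_def
    by (intro has_bochner_integral_add has_bochner_integral_mult_right m0 m2 m4)
  moreover have "(e * h) * T \<omega> + (e * (T \<omega> * (Y \<omega> $ 1 * Y \<omega> $ 1) + (T \<omega> * (Y \<omega> $ 2 * Y \<omega> $ 2) + T \<omega> * (Y \<omega> $ 3 * Y \<omega> $ 3)))
        + (3 * C) * (T \<omega> * Y \<omega> $ 1 ^ 4 + (T \<omega> * Y \<omega> $ 2 ^ 4 + T \<omega> * Y \<omega> $ 3 ^ 4))) = T \<omega> * r (Y \<omega>)" for \<omega>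
    by (simp add: r_def algebra_simps power2_eq_square)
  ultimately have mr: "has_bochner_integral \<mu> (\<lambda>\<omega>. T \<omega> * r (Y \<omega>))
     (e * h + (e * ((h + (a$1)\<^sup>2 * h\<^sup>2) + ((h + (a$2)\<^sup>2 * h\<^sup>2) + (h + (a$3)\<^sup>2 * h\<^sup>2)))
        + 3 * C * (S4 1 + (S4 2 + S4 3))))"
    by (simp add: power2_eq_square)
  have diff: "\<bar>\<phi> y - q y\<bar> \<le> r y" for y
  proof -
    have "\<bar>\<phi> y - q y\<bar> \<le> e * (h + (norm y)\<^sup>2) + C * norm y ^ 4" using approx[of y] by (simp add: q_def)
    also have "\<dots> \<le> r y" unfolding r_def norm_sq_real3[symmetric]
      by (intro add_left_mono mult_left_mono norm_4_real3_le C)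
    finally show ?thesis .
  qed
  have id: "integrable \<mu> (\<lambda>\<omega>. T \<omega> * (\<phi> (Y \<omega>) - q (Y \<omega>)))"
  proof (rule Bochner_Integration.integrable_bound)
    show "integrable \<mu> (\<lambda>\<omega>. T \<omega> * r (Y \<omega>))" using mr by (simp add: has_bochner_integral_iff)
    show "(\<lambda>\<omega>. T \<omega> * (\<phi> (Y \<omega>) - q (Y \<omega>))) \<in> borel_measurable \<mu>" unfolding q_def by measurable
    show "AE \<omega> in \<mu>. norm (T \<omega> * (\<phi> (Y \<omega>) - q (Y \<omega>))) \<le> norm (T \<omega> * r (Y \<omega>))"
      using diff T0 by (intro AE_I2) (auto simp: abs_mult intro!: mult_left_mono order_trans[OF diff])
  qed
  have iq: "integrable \<mu> (\<lambda>\<omega>. T \<omega> * q (Y \<omega>))" using mq by (simp add: has_bochner_integral_iff)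
  have "integrable \<mu> (\<lambda>\<omega>. T \<omega> * q (Y \<omega>) + T \<omega> * (\<phi> (Y \<omega>) - q (Y \<omega>)))"
    by (intro Bochner_Integration.integrable_add iq id)
  then show int: "integrable \<mu> (\<lambda>\<omega>. tilt a h (\<omega> t - \<omega> s) * \<phi> (\<omega> t - \<omega> s))"
    by (simp add: algebra_simps T_def Y_def)
  have "(\<integral>\<omega>. tilt a h (\<omega> t - \<omega> s) * \<phi> (\<omega> t - \<omega> s) \<partial>\<mu>) = (\<integral>\<omega>. T \<omega> * q (Y \<omega>) + T \<omega> * (\<phi> (Y \<omega>) - q (Y \<omega>)) \<partial>\<mu>)"
    by (simp add: algebra_simps T_def Y_def)
  also have "\<dots> = (\<integral>\<omega>. T \<omega> * q (Y \<omega>) \<partial>\<mu>) + (\<integral>\<omega>. T \<omega> * (\<phi> (Y \<omega>) - q (Y \<omega>)) \<partial>\<mu>)"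
    by (intro Bochner_Integration.integral_add iq id)
  finally have split: "(\<integral>\<omega>. tilt a h (\<omega> t - \<omega> s) * \<phi> (\<omega> t - \<omega> s) \<partial>\<mu>) - h * (c - a \<bullet> g + (\<Sum>i\<in>UNIV. Q i i) / 2)
     = h\<^sup>2 / 2 * (\<Sum>i\<in>UNIV. \<Sum>j\<in>UNIV. Q i j * (a$i * a$j)) + (\<integral>\<omega>. T \<omega> * (\<phi> (Y \<omega>) - q (Y \<omega>)) \<partial>\<mu>)"
    using mq by (simp add: has_bochner_integral_iff)
  have b1: "\<bar>h\<^sup>2 / 2 * (\<Sum>i\<in>UNIV. \<Sum>j\<in>UNIV. Q i j * (a$i * a$j))\<bar> \<le> h\<^sup>2 / 2 * (9 * (K * M\<^sup>2))"
  proof -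
    have "\<bar>Q i j * (a$i * a$j)\<bar> \<le> K * M\<^sup>2" for i j
      unfolding abs_mult power2_eq_square using Q ai M0 K0 by (intro mult_mono) auto
    then have "\<bar>\<Sum>i\<in>UNIV. \<Sum>j\<in>UNIV. Q i j * (a$i * a$j)\<bar> \<le> (\<Sum>i\<in>(UNIV::3 set). \<Sum>j\<in>(UNIV::3 set). K * M\<^sup>2)"
      by (intro order_trans[OF sum_abs] sum_mono)
    then have "\<bar>\<Sum>i\<in>UNIV. \<Sum>j\<in>UNIV. Q i j * (a$i * a$j)\<bar> \<le> 9 * (K * M\<^sup>2)" by (simp add: sum_3)
    then show ?thesis by (simp add: abs_mult mult_left_mono)
  qed
  have S4: "S4 i \<le> (3 + 6 * M\<^sup>2 + M^4) * h\<^sup>2" for i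
  proof -
    have hp: "h * h\<^sup>2 \<le> 1 * h\<^sup>2" "h^4 \<le> h\<^sup>2"
      using h01 by (auto intro!: mult_right_mono power_decreasing)
    have "6 * h * (a$i * h)\<^sup>2 = 6 * ((a$i)\<^sup>2 * (h * h\<^sup>2))" by (simp add: power_mult_distrib)
    also have "\<dots> \<le> 6 * (M\<^sup>2 * h\<^sup>2)" using hp(1) ai2[of i] h01 by (intro mult_left_mono mult_mono) auto
    finally have 1: "6 * h * (a$i * h)\<^sup>2 \<le> 6 * (M\<^sup>2 * h\<^sup>2)" .
    have "(a$i * h)^4 = (a$i)^4 * h^4" by (simp add: power_mult_distrib)
    also have "\<dots> \<le> M^4 * h\<^sup>2" using hp(2) ai4[of i] M0 by (intro mult_mono) auto
    finally show ?thesis using 1 unfolding S4_def by (simp add: algebra_simps)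
  qed
  have "\<bar>\<integral>\<omega>. T \<omega> * (\<phi> (Y \<omega>) - q (Y \<omega>)) \<partial>\<mu>\<bar> \<le> (\<integral>\<omega>. T \<omega> * r (Y \<omega>) \<partial>\<mu>)"
    using T0 diff
    by (intro order_trans[OF integral_abs_bound] integral_mono integrable_abs id)
      (use mr in \<open>auto simp: has_bochner_integral_iff abs_mult intro!: mult_left_mono\<close>)
  also have "\<dots> = e * h + (e * (3 * h + (norm a)\<^sup>2 * h\<^sup>2) + 3 * C * (S4 1 + (S4 2 + S4 3)))"
    using mr by (simp add: has_bochner_integral_iff norm_sq_real3 algebra_simps)
  also have "\<dots> \<le> e * h + (e * (3 * h + M\<^sup>2 * h) + 3 * C * (3 * ((3 + 6 * M\<^sup>2 + M^4) * h\<^sup>2)))"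
  proof -
    have "(norm a)\<^sup>2 * h\<^sup>2 \<le> M\<^sup>2 * h"
      using a h01 by (intro mult_mono power_mono) (auto simp: power2_eq_square mult_left_le)
    moreover have "S4 1 + (S4 2 + S4 3) \<le> 3 * ((3 + 6 * M\<^sup>2 + M^4) * h\<^sup>2)"
      using S4[of 1] S4[of 2] S4[of 3] by linarith
    ultimately show ?thesis using e C by (intro add_mono mult_left_mono) auto
  qed
  finally have b2: "\<bar>\<integral>\<omega>. T \<omega> * (\<phi> (Y \<omega>) - q (Y \<omega>)) \<partial>\<mu>\<bar> \<le> e * (4 + M\<^sup>2) * h + 9 * C * (3 + 6 * M\<^sup>2 + M^4) * h\<^sup>2"
    by (simp add: algebra_simps)
  show "\<bar>(\<integral>\<omega>. tilt a h (\<omega> t - \<omega> s) * \<phi> (\<omega> t - \<omega> s) \<partial>\<mu>) - h * (c - a \<bullet> g + (\<Sum>i\<in>UNIV. Q i i) / 2)\<bar>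
      \<le> e * (4 + M\<^sup>2) * h + (9 / 2 * K * M\<^sup>2 + 9 * C * (3 + 6 * M\<^sup>2 + M^4)) * h\<^sup>2"
    unfolding split using b1 b2 by (simp add: algebra_simps)
qed

end


section \<open>Limits of expectations and covariances of increments\<close>

lemma square_dominates: "\<bar>x\<bar> \<le> 1 + x\<^sup>2" for x :: real
  using zero_le_power2[of "\<bar>x\<bar> - 1"] by (simp add: power2_eq_square algebra_simps)

lemma clip_error:
  fixes x K :: real
  assumes K: "K > 0"
  shows "\<bar>x - max (- K) (min K x)\<bar> \<le> x\<^sup>2 / K"
proof (cases "\<bar>x\<bar> \<le> K")
  case True
  then have "max (- K) (min K x) = x" by auto
  then show ?thesis using K by simp
next
  case False
  have "\<bar>x - max (- K) (min K x)\<bar> \<le> \<bar>x\<bar>" using K by auto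
  also have "\<bar>x\<bar> * K \<le> \<bar>x\<bar> * \<bar>x\<bar>" using False by (intro mult_left_mono) auto
  then have "\<bar>x\<bar> \<le> x\<^sup>2 / K" using K by (simp add: pos_le_divide_eq power2_eq_square)
  finally show ?thesis .
qed

context prob_space
begin

lemma L2_bounded_imp_integrable:
  assumes [measurable]: "Z \<in> borel_measurable M" and C: "0 \<le> C"
    and bd: "(\<integral>\<^sup>+x. ennreal ((Z x)\<^sup>2) \<partial>M) \<le> ennreal C"
  shows "integrable M (\<lambda>x. (Z x)\<^sup>2)" "(\<integral>x. (Z x)\<^sup>2 \<partial>M) \<le> C" "integrable M Z"
proof -
  show 1: "integrable M (\<lambda>x. (Z x)\<^sup>2)"
    using bd by (intro integrableI_nonneg) (auto intro: le_less_trans)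
  have "ennreal (\<integral>x. (Z x)\<^sup>2 \<partial>M) \<le> ennreal C"
    using bd by (subst nn_integral_eq_integral[OF 1, symmetric]) auto
  then show "(\<integral>x. (Z x)\<^sup>2 \<partial>M) \<le> C" using C by (simp add: ennreal_le_iff)
  show "integrable M Z"
  proof (rule Bochner_Integration.integrable_bound)
    show "integrable M (\<lambda>x. 1 + (Z x)\<^sup>2)" using 1 by simp
    show "AE x in M. norm (Z x) \<le> norm (1 + (Z x)\<^sup>2)"
      using square_dominates by (auto intro!: AE_I2 intro: order_trans)
  qed simp
qed

text \<open>The bound in \<open>L\<^sup>2\<close> gives uniform integrability: cutting all variables off at height \<open>K\<close> changes the
  expectations by at most \<open>C / K\<close>, and the variables cut off converge boundedly.\<close>

lemma L2_bounded_convergence: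
  fixes X :: "nat \<Rightarrow> 'a \<Rightarrow> real"
  assumes [measurable]: "\<And>n. X n \<in> borel_measurable M" "Y \<in> borel_measurable M"
    and lim: "AE x in M. (\<lambda>n. X n x) \<longlonglongrightarrow> Y x"
    and bd: "\<And>n. (\<integral>\<^sup>+x. ennreal ((X n x)\<^sup>2) \<partial>M) \<le> ennreal C"
    and C: "0 \<le> C"
  shows "integrable M Y" "(\<lambda>n. \<integral>x. X n x \<partial>M) \<longlonglongrightarrow> (\<integral>x. Y x \<partial>M)"
proof -
  have "(\<integral>\<^sup>+x. ennreal ((Y x)\<^sup>2) \<partial>M) = (\<integral>\<^sup>+x. liminf (\<lambda>n. ennreal ((X n x)\<^sup>2)) \<partial>M)"
  proof (rule nn_integral_cong_AE)
    show "AE x in M. ennreal ((Y x)\<^sup>2) = liminf (\<lambda>n. ennreal ((X n x)\<^sup>2))"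
      using lim
    proof eventually_elim
      case (elim x)
      then have "(\<lambda>n. ennreal ((X n x)\<^sup>2)) \<longlonglongrightarrow> ennreal ((Y x)\<^sup>2)"
        by (intro tendsto_intros tendsto_ennrealI)
      from lim_imp_Liminf[OF sequentially_bot this] show ?case by (rule sym)
    qed
  qed
  also have "\<dots> \<le> liminf (\<lambda>n. \<integral>\<^sup>+x. ennreal ((X n x)\<^sup>2) \<partial>M)"
    by (rule nn_integral_liminf) measurable
  also have "\<dots> \<le> liminf (\<lambda>n. ennreal C)"
    using bd by (intro Liminf_mono always_eventually allI)
  finally have bdY: "(\<integral>\<^sup>+x. ennreal ((Y x)\<^sup>2) \<partial>M) \<le> ennreal C" by (simp add: Liminf_const)
  note iX = L2_bounded_imp_integrable[OF assms(1) C bd]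
  note iY = L2_bounded_imp_integrable[OF assms(2) C bdY]
  show "integrable M Y" by (rule iY)
  define clip where "clip K x = max (- K) (min K x)" for K x :: real
  have clip_meas[measurable]: "(\<lambda>x. clip K (Z x)) \<in> borel_measurable M"
    if [measurable]: "Z \<in> borel_measurable M" for K Z unfolding clip_def by measurable
  have clip_bd: "\<bar>clip K x\<bar> \<le> K" if "K > 0" for K x using that by (auto simp: clip_def)
  have clip_int: "integrable M (\<lambda>x. clip K (Z x))" if "K > 0" "Z \<in> borel_measurable M" for K Z
    using that clip_bd by (intro integrable_const_bound[of _ K]) auto
  have err: "\<bar>(\<integral>x. Z x \<partial>M) - (\<integral>x. clip K (Z x) \<partial>M)\<bar> \<le> C / K"
    if K: "K > 0" and Z[measurable]: "Z \<in> borel_measurable M"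
      and i1: "integrable M (\<lambda>x. (Z x)\<^sup>2)" and b: "(\<integral>x. (Z x)\<^sup>2 \<partial>M) \<le> C" and i2: "integrable M Z" for K Z
  proof -
    have "\<bar>(\<integral>x. Z x \<partial>M) - (\<integral>x. clip K (Z x) \<partial>M)\<bar> = \<bar>\<integral>x. Z x - clip K (Z x) \<partial>M\<bar>"
      using i2 clip_int[OF K Z] by simp
    also have "\<dots> \<le> (\<integral>x. \<bar>Z x - clip K (Z x)\<bar> \<partial>M)" by (rule integral_abs_bound)
    also have "\<dots> \<le> (\<integral>x. (Z x)\<^sup>2 / K \<partial>M)"
      using i1 i2 clip_int[OF K Z] clip_error[OF K] by (intro integral_mono) (auto simp: clip_def)
    also have "\<dots> \<le> C / K" using b K by (simp add: divide_right_mono)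
    finally show ?thesis .
  qed
  show "(\<lambda>n. \<integral>x. X n x \<partial>M) \<longlonglongrightarrow> (\<integral>x. Y x \<partial>M)"
  proof (rule LIMSEQ_I)
    fix e :: real assume e: "e > 0"
    define K where "K = 4 * (C + 1) / e"
    have K: "K > 0" using C e by (simp add: K_def)
    have CK: "C / K \<le> e / 4" using C e by (simp add: K_def field_simps)
    have "(\<lambda>n. \<integral>x. clip K (X n x) \<partial>M) \<longlonglongrightarrow> (\<integral>x. clip K (Y x) \<partial>M)"
    proof (rule integral_dominated_convergence[where w = "\<lambda>_. K"])
      show "AE x in M. (\<lambda>n. clip K (X n x)) \<longlonglongrightarrow> clip K (Y x)"
        using lim unfolding clip_def by eventually_elim (intro tendsto_intros)
    qed (use clip_bd[OF K] in auto)
    from LIMSEQ_D[OF this, of "e / 4"] e obtain N where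
      N: "\<And>n. n \<ge> N \<Longrightarrow> \<bar>(\<integral>x. clip K (X n x) \<partial>M) - (\<integral>x. clip K (Y x) \<partial>M)\<bar> < e / 4" by auto
    show "\<exists>N. \<forall>n\<ge>N. norm ((\<integral>x. X n x \<partial>M) - (\<integral>x. Y x \<partial>M)) < e"
    proof (intro exI allI impI)
      fix n assume n: "n \<ge> N"
      show "norm ((\<integral>x. X n x \<partial>M) - (\<integral>x. Y x \<partial>M)) < e"
        using N[OF n] err[OF K assms(1) iX, of n] err[OF K assms(2) iY] CK e
        unfolding real_norm_def by linarith
    qed
  qed
qed

end

context brownian_paths
begin

lemma past_times_increment:
  fixes G :: "path \<Rightarrow> real" and \<phi> :: "real ^ 3 \<Rightarrow> real"
  assumes st: "0 \<le> s" "s < t" "t \<le> 1"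
    and G: "G \<in> borel_measurable (natural_filtration s)" "integrable \<mu> G"
    and \<phi>[measurable]: "\<phi> \<in> borel_measurable borel" and i\<phi>: "integrable \<mu> (\<lambda>\<omega>. \<phi> (\<omega> t - \<omega> s))"
  shows "integrable \<mu> (\<lambda>\<omega>. G \<omega> * \<phi> (\<omega> t - \<omega> s))"
    and "(\<integral>\<omega>. G \<omega> * \<phi> (\<omega> t - \<omega> s) \<partial>\<mu>) = (\<integral>\<omega>. G \<omega> \<partial>\<mu>) * (\<integral>\<omega>. \<phi> (\<omega> t - \<omega> s) \<partial>\<mu>)"
proof -
  note [measurable] = G(1)
  have [measurable]: "G \<in> borel_measurable \<mu>" by (rule filtration_measurable[OF G(1)])
  have [measurable]: "(\<lambda>\<omega>. \<omega> t - \<omega> s) \<in> borel_measurable \<mu>" using st by (intro increment_measurable) auto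
  have "(\<integral>\<^sup>+\<omega>. ennreal \<bar>G \<omega>\<bar> * ennreal \<bar>\<phi> (\<omega> t - \<omega> s)\<bar> \<partial>\<mu>)
      = (\<integral>\<^sup>+\<omega>. \<integral>\<^sup>+\<omega>'. ennreal \<bar>G \<omega>\<bar> * ennreal \<bar>\<phi> (\<omega>' t - \<omega>' s)\<bar> \<partial>\<mu> \<partial>\<mu>)"
    using decoupling_nn_integral[OF st, of "\<lambda>z. ennreal \<bar>G (fst z)\<bar> * ennreal \<bar>\<phi> (snd z)\<bar>"] by simp
  also have "\<dots> = (\<integral>\<^sup>+\<omega>. ennreal \<bar>G \<omega>\<bar> * (\<integral>\<^sup>+\<omega>'. ennreal \<bar>\<phi> (\<omega>' t - \<omega>' s)\<bar> \<partial>\<mu>) \<partial>\<mu>)"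
    by (intro nn_integral_cong nn_integral_cmult) measurable
  also have "\<dots> = (\<integral>\<^sup>+\<omega>. ennreal \<bar>G \<omega>\<bar> \<partial>\<mu>) * (\<integral>\<^sup>+\<omega>'. ennreal \<bar>\<phi> (\<omega>' t - \<omega>' s)\<bar> \<partial>\<mu>)"
    by (rule nn_integral_multc) measurable
  also have "\<dots> < \<infinity>"
    using G(2) i\<phi> unfolding integrable_iff_bounded by (simp add: ennreal_mult_less_top)
  finally show i: "integrable \<mu> (\<lambda>\<omega>. G \<omega> * \<phi> (\<omega> t - \<omega> s))"
    by (intro integrableI_bounded) (auto simp: abs_mult ennreal_mult)
  have "(\<integral>\<omega>. G \<omega> * \<phi> (\<omega> t - \<omega> s) \<partial>\<mu>) = (\<integral>\<omega>. \<integral>\<omega>'. G \<omega> * \<phi> (\<omega>' t - \<omega>' s) \<partial>\<mu> \<partial>\<mu>)"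
    using decoupling_integral[OF st, of "\<lambda>z. G (fst z) * \<phi> (snd z)"] i by simp
  then show "(\<integral>\<omega>. G \<omega> * \<phi> (\<omega> t - \<omega> s) \<partial>\<mu>) = (\<integral>\<omega>. G \<omega> \<partial>\<mu>) * (\<integral>\<omega>. \<phi> (\<omega> t - \<omega> s) \<partial>\<mu>)"
    by simp
qed

lemma tilt_zero [simp]: "tilt 0 h y = 1"
  by (simp add: tilt_def)

lemma increment_moments:
  assumes "0 \<le> s" "s < t" "t \<le> 1"
  shows "integrable \<mu> (\<lambda>\<omega>. (\<omega> t - \<omega> s) $ i)" "(\<integral>\<omega>. (\<omega> t - \<omega> s) $ i \<partial>\<mu>) = 0"
    "integrable \<mu> (\<lambda>\<omega>. (\<omega> t - \<omega> s) $ i * (\<omega> t - \<omega> s) $ j)"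
    "(\<integral>\<omega>. (\<omega> t - \<omega> s) $ i * (\<omega> t - \<omega> s) $ j \<partial>\<mu>) = (if i = j then t - s else 0)"
  using tilted_moments(2,3)[OF assms refl, of 0]
  by (simp_all add: has_bochner_integral_iff del: vector_minus_component)

lemma past_increment_zero:
  assumes st: "0 \<le> s" "s \<le> t" "t \<le> 1"
    and G: "G \<in> borel_measurable (natural_filtration s)" "integrable \<mu> G"
  shows "integrable \<mu> (\<lambda>\<omega>. G \<omega> * (\<omega> t - \<omega> s) $ i)" "(\<integral>\<omega>. G \<omega> * (\<omega> t - \<omega> s) $ i \<partial>\<mu>) = 0"
proof -
  have "integrable \<mu> (\<lambda>\<omega>. G \<omega> * (\<omega> t - \<omega> s) $ i) \<and> (\<integral>\<omega>. G \<omega> * (\<omega> t - \<omega> s) $ i \<partial>\<mu>) = 0"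
  proof (cases "s = t")
    case False
    then have lt: "s < t" using st by simp
    show ?thesis
      using past_times_increment[OF st(1) lt st(3) G, of "\<lambda>y. y $ i"] increment_moments[OF st(1) lt st(3), of i]
      by (simp del: vector_minus_component)
  qed simp
  then show "integrable \<mu> (\<lambda>\<omega>. G \<omega> * (\<omega> t - \<omega> s) $ i)" "(\<integral>\<omega>. G \<omega> * (\<omega> t - \<omega> s) $ i \<partial>\<mu>) = 0" by auto
qed

lemma filtration_increment_measurable:
  assumes "r \<in> {0..1}" "s \<in> {0..1}" "r \<le> t" "s \<le> t"
  shows "(\<lambda>\<omega>. (\<omega> r - \<omega> s) $ i) \<in> borel_measurable (natural_filtration t)"
  using assms by (intro borel_measurable_vec_nth borel_measurable_diff measurable_evaluation_filtration)

lemma bounded_past_integrable: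
  assumes G: "(G :: path \<Rightarrow> real) \<in> borel_measurable (natural_filtration s)"
    and B: "\<And>\<omega>. \<omega> \<in> paths \<Longrightarrow> \<bar>G \<omega>\<bar> \<le> B"
  shows "integrable \<mu> G"
  using filtration_measurable[OF G] B by (intro integrable_const_bound[of _ B]) (auto intro!: AE_I2)

text \<open>Split the longer increment at \<open>b\<close>: what comes after \<open>b\<close> has mean zero given the rest.\<close>

lemma increment_covariance:
  assumes c: "0 \<le> c" "c \<le> b" "b \<le> d" "d \<le> 1"
    and G: "G \<in> borel_measurable (natural_filtration c)" and B: "\<And>\<omega>. \<omega> \<in> paths \<Longrightarrow> \<bar>G \<omega>\<bar> \<le> B"
  shows "integrable \<mu> (\<lambda>\<omega>. G \<omega> * ((\<omega> b - \<omega> c) $ i * (\<omega> d - \<omega> c) $ j))"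
    and "(\<integral>\<omega>. G \<omega> * ((\<omega> b - \<omega> c) $ i * (\<omega> d - \<omega> c) $ j) \<partial>\<mu>)
           = (\<integral>\<omega>. G \<omega> \<partial>\<mu>) * (if i = j then b - c else 0)"
proof -
  have iG: "integrable \<mu> G" by (rule bounded_past_integrable[OF G B])
  have P: "integrable \<mu> (\<lambda>\<omega>. G \<omega> * ((\<omega> b - \<omega> c) $ i * (\<omega> d - \<omega> c) $ j)) \<and>
    (\<integral>\<omega>. G \<omega> * ((\<omega> b - \<omega> c) $ i * (\<omega> d - \<omega> c) $ j) \<partial>\<mu>) = (\<integral>\<omega>. G \<omega> \<partial>\<mu>) * (if i = j then b - c else 0)"
  proof (cases "b = c")
    case False
    then have cb: "c < b" and b1: "b \<le> 1" using c by auto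
    have 1: "integrable \<mu> (\<lambda>\<omega>. G \<omega> * ((\<omega> b - \<omega> c) $ i * (\<omega> b - \<omega> c) $ j))"
        "(\<integral>\<omega>. G \<omega> * ((\<omega> b - \<omega> c) $ i * (\<omega> b - \<omega> c) $ j) \<partial>\<mu>) = (\<integral>\<omega>. G \<omega> \<partial>\<mu>) * (if i = j then b - c else 0)"
      using past_times_increment[OF c(1) cb b1 G iG, of "\<lambda>y. y $ i * y $ j"] increment_moments(3,4)[OF c(1) cb b1, of i j]
      by (simp_all del: vector_minus_component)
    have 2: "integrable \<mu> (\<lambda>\<omega>. G \<omega> * (\<omega> b - \<omega> c) $ i)"
      by (rule past_increment_zero[OF c(1,2) b1 G iG])
    have 3: "(\<lambda>\<omega>. G \<omega> * (\<omega> b - \<omega> c) $ i) \<in> borel_measurable (natural_filtration b)"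
      using c by (intro borel_measurable_times measurable_natural_filtration_mono[OF G] filtration_increment_measurable) auto
    note z = past_increment_zero[OF _ c(3,4) 3 2, of j]
    have b0: "0 \<le> b" using c by simp
    have eq: "(\<lambda>\<omega>. G \<omega> * ((\<omega> b - \<omega> c) $ i * (\<omega> d - \<omega> c) $ j)) =
        (\<lambda>\<omega>. G \<omega> * ((\<omega> b - \<omega> c) $ i * (\<omega> b - \<omega> c) $ j) + G \<omega> * (\<omega> b - \<omega> c) $ i * (\<omega> d - \<omega> b) $ j)"
      by (simp add: algebra_simps)
    show ?thesis unfolding eq
      using Bochner_Integration.integrable_add[OF 1(1) z(1)[OF b0]]
        Bochner_Integration.integral_add[OF 1(1) z(1)[OF b0]] 1(2) z(2)[OF b0] by simp
  qed simp
  then show "integrable \<mu> (\<lambda>\<omega>. G \<omega> * ((\<omega> b - \<omega> c) $ i * (\<omega> d - \<omega> c) $ j))"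
    and "(\<integral>\<omega>. G \<omega> * ((\<omega> b - \<omega> c) $ i * (\<omega> d - \<omega> c) $ j) \<partial>\<mu>)
           = (\<integral>\<omega>. G \<omega> \<partial>\<mu>) * (if i = j then b - c else 0)" by auto
qed

definition overlap :: "real \<Rightarrow> real \<Rightarrow> real \<Rightarrow> real \<Rightarrow> real" where
  "overlap a b c d = max 0 (min b d - max a c)"

text \<open>By bilinearity the isometry reduces to two elementary integrands on arbitrary intervals, which avoids
  a common refinement of two partitions. Cut the earlier interval at the beginning \<open>c\<close> of the
  later one: the increment before \<open>c\<close> belongs to the past of the later interval and contributes
  zero, and the increment after \<open>c\<close> falls under \<open>increment_covariance\<close>.\<close>

lemma ito_pair_ordered:
  assumes ac: "0 \<le> a" "a \<le> b" "a \<le> c" "c \<le> d" "b \<le> 1" "d \<le> 1"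
    and G: "G \<in> borel_measurable (natural_filtration a)" "\<And>\<omega>. \<omega> \<in> paths \<Longrightarrow> \<bar>G \<omega>\<bar> \<le> B"
    and H: "H \<in> borel_measurable (natural_filtration c)" "\<And>\<omega>. \<omega> \<in> paths \<Longrightarrow> \<bar>H \<omega>\<bar> \<le> B'"
  shows "integrable \<mu> (\<lambda>\<omega>. (G \<omega> * (\<omega> b - \<omega> a) $ i) * (H \<omega> * (\<omega> d - \<omega> c) $ j)) \<and>
    (\<integral>\<omega>. (G \<omega> * (\<omega> b - \<omega> a) $ i) * (H \<omega> * (\<omega> d - \<omega> c) $ j) \<partial>\<mu>)
      = (\<integral>\<omega>. G \<omega> * H \<omega> \<partial>\<mu>) * (if i = j then overlap a b c d else 0)"
proof -
  have c0: "0 \<le> c" using ac by simp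
  have Gc: "G \<in> borel_measurable (natural_filtration c)" by (rule measurable_natural_filtration_mono[OF G(1) ac(3)])
  have GH: "(\<lambda>\<omega>. G \<omega> * H \<omega>) \<in> borel_measurable (natural_filtration c)"
    using Gc H(1) by (rule borel_measurable_times)
  have GHb: "\<bar>G \<omega> * H \<omega>\<bar> \<le> B * B'" if "\<omega> \<in> paths" for \<omega>
    unfolding abs_mult using G(2)[OF that] H(2)[OF that] by (intro mult_mono) auto
  have early: "integrable \<mu> (\<lambda>\<omega>. (G \<omega> * H \<omega> * (\<omega> e - \<omega> a) $ i) * (\<omega> d - \<omega> c) $ j) \<and>
      (\<integral>\<omega>. (G \<omega> * H \<omega> * (\<omega> e - \<omega> a) $ i) * (\<omega> d - \<omega> c) $ j \<partial>\<mu>) = 0" if e: "a \<le> e" "e \<le> c" for e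
  proof -
    have e1: "e \<le> 1" using e ac by simp
    have "integrable \<mu> (\<lambda>\<omega>. G \<omega> * (\<omega> e - \<omega> a) $ i)"
      by (rule past_increment_zero[OF ac(1) e(1) e1 G(1) bounded_past_integrable[OF G]])
    then have 1: "integrable \<mu> (\<lambda>\<omega>. G \<omega> * H \<omega> * (\<omega> e - \<omega> a) $ i)"
    proof (rule Bochner_Integration.integrable_bound[OF integrable_mult_right[of B']])
      show "(\<lambda>\<omega>. G \<omega> * H \<omega> * (\<omega> e - \<omega> a) $ i) \<in> borel_measurable \<mu>"
        by (rule filtration_measurable[of _ c])
          (use e ac in \<open>auto intro!: borel_measurable_times[OF GH] filtration_increment_measurable simp del: vector_minus_component\<close>)
      show "AE \<omega> in \<mu>. norm (G \<omega> * H \<omega> * (\<omega> e - \<omega> a) $ i) \<le> norm (B' * (G \<omega> * (\<omega> e - \<omega> a) $ i))"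
      proof (rule AE_I2)
        fix \<omega> assume "\<omega> \<in> space \<mu>"
        then have "\<bar>H \<omega>\<bar> \<le> \<bar>B'\<bar>" using H(2)[of \<omega>] by auto
        then have "\<bar>H \<omega>\<bar> * \<bar>G \<omega> * (\<omega> e - \<omega> a) $ i\<bar> \<le> \<bar>B'\<bar> * \<bar>G \<omega> * (\<omega> e - \<omega> a) $ i\<bar>"
          by (intro mult_right_mono) auto
        then show "norm (G \<omega> * H \<omega> * (\<omega> e - \<omega> a) $ i) \<le> norm (B' * (G \<omega> * (\<omega> e - \<omega> a) $ i))"
          by (simp add: abs_mult mult_ac del: vector_minus_component)
      qed
    qed
    have 2: "(\<lambda>\<omega>. G \<omega> * H \<omega> * (\<omega> e - \<omega> a) $ i) \<in> borel_measurable (natural_filtration c)"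
      using e ac by (intro borel_measurable_times[OF GH] filtration_increment_measurable) auto
    show ?thesis using past_increment_zero[OF c0 ac(4,6) 2 1, of j] by simp
  qed
  show ?thesis
  proof (cases "b \<le> c")
    case True
    then have "overlap a b c d = 0" by (auto simp: overlap_def)
    then show ?thesis using early[OF ac(2) True] by (simp add: mult_ac)
  next
    case False
    then have cb: "c \<le> b" by simp
    have late: "integrable \<mu> (\<lambda>\<omega>. G \<omega> * H \<omega> * ((\<omega> b - \<omega> c) $ i * (\<omega> d - \<omega> c) $ j)) \<and>
      (\<integral>\<omega>. G \<omega> * H \<omega> * ((\<omega> b - \<omega> c) $ i * (\<omega> d - \<omega> c) $ j) \<partial>\<mu>)
        = (\<integral>\<omega>. G \<omega> * H \<omega> \<partial>\<mu>) * (if i = j then overlap a b c d else 0)"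
    proof (cases "b \<le> d")
      case True
      have "overlap a b c d = b - c" using True cb ac by (auto simp: overlap_def)
      then show ?thesis using increment_covariance[OF c0 cb True ac(6) GH GHb, of i j] by simp
    next
      case False
      then have db: "d \<le> b" by simp
      have "overlap a b c d = d - c" using db ac by (auto simp: overlap_def)
      then show ?thesis using increment_covariance[OF c0 ac(4) db ac(5) GH GHb, of j i]
        by (auto simp: mult_ac)
    qed
    have eq: "(\<lambda>\<omega>. (G \<omega> * (\<omega> b - \<omega> a) $ i) * (H \<omega> * (\<omega> d - \<omega> c) $ j)) =
      (\<lambda>\<omega>. (G \<omega> * H \<omega> * (\<omega> c - \<omega> a) $ i) * (\<omega> d - \<omega> c) $ j + G \<omega> * H \<omega> * ((\<omega> b - \<omega> c) $ i * (\<omega> d - \<omega> c) $ j))"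
      by (simp add: algebra_simps)
    note E = early[OF ac(3) order_refl]
    show ?thesis unfolding eq
      using Bochner_Integration.integrable_add[of \<mu>, OF conjunct1[OF E] conjunct1[OF late]]
        Bochner_Integration.integral_add[of \<mu>, OF conjunct1[OF E] conjunct1[OF late]]
        conjunct2[OF E] conjunct2[OF late] by simp
  qed
qed

lemma ito_pair:
  assumes ab: "0 \<le> a" "a \<le> b" "b \<le> 1" and cd: "0 \<le> c" "c \<le> d" "d \<le> 1"
    and G: "G \<in> borel_measurable (natural_filtration a)" "\<And>\<omega>. \<omega> \<in> paths \<Longrightarrow> \<bar>G \<omega>\<bar> \<le> B"
    and H: "H \<in> borel_measurable (natural_filtration c)" "\<And>\<omega>. \<omega> \<in> paths \<Longrightarrow> \<bar>H \<omega>\<bar> \<le> B'"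
  shows "has_bochner_integral \<mu> (\<lambda>\<omega>. (G \<omega> * (\<omega> b - \<omega> a) $ i) * (H \<omega> * (\<omega> d - \<omega> c) $ j))
      ((\<integral>\<omega>. G \<omega> * H \<omega> \<partial>\<mu>) * (if i = j then overlap a b c d else 0))"
proof (cases "a \<le> c")
  case True
  show ?thesis
    using ito_pair_ordered[OF ab(1,2) True cd(2) ab(3) cd(3) G H, of i j] unfolding has_bochner_integral_iff .
next
  case False
  then have ca: "c \<le> a" by simp
  show ?thesis
    using ito_pair_ordered[OF cd(1,2) ca ab(2) cd(3) ab(3) H G, of j i] unfolding has_bochner_integral_iff
    by (auto simp: mult_ac overlap_def min.commute max.commute)
qed

end


section \<open>The Ito isometry\<close>

lemma indicator_overlap_integral:
  assumes "a \<le> b" "c \<le> d"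
  shows "has_bochner_integral lborel (\<lambda>t. indicat_real {a<..b} t * indicat_real {c<..d} t) (max 0 (min b d - max a c))"
proof -
  have eq: "{a<..b} \<inter> {c<..d} = {max a c<..min b d}" by auto
  have "has_bochner_integral lborel (indicat_real {max a c<..min b d}) (measure lborel {max a c<..min b d})"
    by (rule has_bochner_integral_real_indicator) (auto intro!: emeasure_bounded_finite bounded_subset[OF bounded_closed_interval[of "max a c" "min b d"]] simp del: infinity_ennreal_def)
  moreover have "measure lborel {max a c<..min b d} = max 0 (min b d - max a c)"
    by (cases "max a c \<le> min b d") auto
  ultimately show ?thesis by (simp only: indicator_inter_arith[symmetric] eq)
qed

lemma norm_diff_square_le:
  fixes x y z :: "'a::real_normed_vector"
  shows "(norm (x - y))\<^sup>2 \<le> 2 * (norm (z - x))\<^sup>2 + 2 * (norm (z - y))\<^sup>2"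
proof -
  have "norm (x - y) \<le> norm (z - x) + norm (z - y)"
    using norm_triangle_ineq4[of "z - y" "z - x"] by (simp add: norm_minus_commute)
  then have "(norm (x - y))\<^sup>2 \<le> (norm (z - x) + norm (z - y))\<^sup>2" by (intro power_mono) auto
  also have "\<dots> \<le> 2 * (norm (z - x))\<^sup>2 + 2 * (norm (z - y))\<^sup>2"
    using zero_le_power2[of "norm (z - x) - norm (z - y)"] by (simp add: power2_eq_square algebra_simps)
  finally show ?thesis .
qed

context brownian_paths
begin

text \<open>The intervals may overlap in any way; for the difference of two simple integrals the index set is
  the disjoint union of the two partitions.\<close>

lemma ito_isometry:
  fixes a b :: "'i \<Rightarrow> real" and \<xi> :: "'i \<Rightarrow> path \<Rightarrow> real ^ 3"
  assumes J: "finite J"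
    and ab: "\<And>i. i \<in> J \<Longrightarrow> 0 \<le> a i \<and> a i \<le> b i \<and> b i \<le> 1"
    and \<xi>: "\<And>i. i \<in> J \<Longrightarrow> \<xi> i \<in> borel_measurable (natural_filtration (a i))"
    and bd: "\<And>i. i \<in> J \<Longrightarrow> bounded (\<xi> i ` paths)"
  shows "(\<integral>\<^sup>+\<omega>. ennreal ((\<Sum>i\<in>J. \<xi> i \<omega> \<bullet> (\<omega> (b i) - \<omega> (a i)))\<^sup>2) \<partial>\<mu>)
    = (\<integral>\<^sup>+\<omega>. (\<integral>\<^sup>+t\<in>{0..1}. ennreal ((norm (\<Sum>i\<in>J. indicat_real {a i<..b i} t *\<^sub>R \<xi> i \<omega>))\<^sup>2) \<partial>lborel) \<partial>\<mu>)"
proof -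
  have "\<forall>i\<in>J. \<exists>B. \<forall>\<omega>\<in>paths. norm (\<xi> i \<omega>) \<le> B"
    using bd unfolding bounded_iff by blast
  then obtain B where B: "\<And>i \<omega>. i \<in> J \<Longrightarrow> \<omega> \<in> paths \<Longrightarrow> norm (\<xi> i \<omega>) \<le> B i" by metis
  have comp: "(\<lambda>\<omega>. \<xi> i \<omega> $ k) \<in> borel_measurable (natural_filtration (a i))"
    "\<And>\<omega>. \<omega> \<in> paths \<Longrightarrow> \<bar>\<xi> i \<omega> $ k\<bar> \<le> B i" if "i \<in> J" for i k
    using \<xi>[OF that] B[OF that] by (auto intro: order_trans[OF component_le_norm_cart])
  define ov where "ov i j = overlap (a i) (b i) (a j) (b j)" for i j
  define L where "L \<omega> = (\<Sum>i\<in>J. \<xi> i \<omega> \<bullet> (\<omega> (b i) - \<omega> (a i)))" for \<omega>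
  define R where "R \<omega> = (\<Sum>i\<in>J. \<Sum>j\<in>J. \<xi> i \<omega> \<bullet> \<xi> j \<omega> * ov i j)" for \<omega>
  have "has_bochner_integral \<mu> (\<lambda>\<omega>. \<Sum>i\<in>J. \<Sum>j\<in>J. \<Sum>k\<in>UNIV. \<Sum>l\<in>UNIV.
      (\<xi> i \<omega> $ k * (\<omega> (b i) - \<omega> (a i)) $ k) * (\<xi> j \<omega> $ l * (\<omega> (b j) - \<omega> (a j)) $ l))
    (\<Sum>i\<in>J. \<Sum>j\<in>J. \<Sum>k\<in>UNIV. \<Sum>l\<in>UNIV. (\<integral>\<omega>. \<xi> i \<omega> $ k * \<xi> j \<omega> $ l \<partial>\<mu>) * (if k = l then ov i j else 0))"
  proof (intro has_bochner_integral_sum)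
    fix i j k l assume i: "i \<in> J" and j: "j \<in> J"
    show "has_bochner_integral \<mu> (\<lambda>\<omega>. (\<xi> i \<omega> $ k * (\<omega> (b i) - \<omega> (a i)) $ k) * (\<xi> j \<omega> $ l * (\<omega> (b j) - \<omega> (a j)) $ l))
        ((\<integral>\<omega>. \<xi> i \<omega> $ k * \<xi> j \<omega> $ l \<partial>\<mu>) * (if k = l then ov i j else 0))"
      unfolding ov_def
      by (rule ito_pair[OF _ _ _ _ _ _ comp[OF i] comp[OF j]]) (use ab[OF i] ab[OF j] in auto)
  qed
  moreover have "(\<Sum>i\<in>J. \<Sum>j\<in>J. \<Sum>k\<in>UNIV. \<Sum>l\<in>UNIV.
      (\<xi> i \<omega> $ k * (\<omega> (b i) - \<omega> (a i)) $ k) * (\<xi> j \<omega> $ l * (\<omega> (b j) - \<omega> (a j)) $ l)) = (L \<omega>)\<^sup>2" for \<omega>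
    by (simp add: L_def power2_eq_square sum_product inner_vec_def)
  moreover have "(\<Sum>i\<in>J. \<Sum>j\<in>J. \<Sum>k\<in>UNIV. \<Sum>l\<in>UNIV. (\<integral>\<omega>. \<xi> i \<omega> $ k * \<xi> j \<omega> $ l \<partial>\<mu>) * (if k = l then ov i j else 0))
      = (\<Sum>i\<in>J. \<Sum>j\<in>J. \<Sum>k\<in>UNIV. (\<integral>\<omega>. \<xi> i \<omega> $ k * \<xi> j \<omega> $ k \<partial>\<mu>) * ov i j)"
    by (intro sum.cong refl) (simp add: if_distrib cong: if_cong)
  ultimately have iL: "has_bochner_integral \<mu> (\<lambda>\<omega>. (L \<omega>)\<^sup>2)
      (\<Sum>i\<in>J. \<Sum>j\<in>J. \<Sum>k\<in>UNIV. (\<integral>\<omega>. \<xi> i \<omega> $ k * \<xi> j \<omega> $ k \<partial>\<mu>) * ov i j)" by simp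
  have prod_int: "integrable \<mu> (\<lambda>\<omega>. \<xi> i \<omega> $ k * \<xi> j \<omega> $ k)" if "i \<in> J" "j \<in> J" for i j k
  proof (rule integrable_const_bound[of _ "B i * B j"])
    show "(\<lambda>\<omega>. \<xi> i \<omega> $ k * \<xi> j \<omega> $ k) \<in> borel_measurable \<mu>"
      using comp(1)[OF that(1)] comp(1)[OF that(2)] by (intro borel_measurable_times filtration_measurable)
    show "AE \<omega> in \<mu>. norm (\<xi> i \<omega> $ k * \<xi> j \<omega> $ k) \<le> B i * B j"
    proof (rule AE_I2)
      fix \<omega> assume "\<omega> \<in> space \<mu>"
      then have "\<bar>\<xi> i \<omega> $ k\<bar> * \<bar>\<xi> j \<omega> $ k\<bar> \<le> B i * B j"
        using comp(2)[OF that(1), of \<omega> k] comp(2)[OF that(2), of \<omega> k] by (intro mult_mono) auto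
      then show "norm (\<xi> i \<omega> $ k * \<xi> j \<omega> $ k) \<le> B i * B j" by (simp add: abs_mult)
    qed
  qed
  have "has_bochner_integral \<mu> (\<lambda>\<omega>. \<Sum>i\<in>J. \<Sum>j\<in>J. \<Sum>k\<in>UNIV. (\<xi> i \<omega> $ k * \<xi> j \<omega> $ k) * ov i j)
      (\<Sum>i\<in>J. \<Sum>j\<in>J. \<Sum>k\<in>UNIV. (\<integral>\<omega>. \<xi> i \<omega> $ k * \<xi> j \<omega> $ k \<partial>\<mu>) * ov i j)"
    by (intro has_bochner_integral_sum has_bochner_integral_mult_left has_bochner_integral_integrable prod_int)
  then have iR: "has_bochner_integral \<mu> R
      (\<Sum>i\<in>J. \<Sum>j\<in>J. \<Sum>k\<in>UNIV. (\<integral>\<omega>. \<xi> i \<omega> $ k * \<xi> j \<omega> $ k \<partial>\<mu>) * ov i j)"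
    unfolding R_def by (simp add: inner_vec_def sum_distrib_right)
  have inner: "has_bochner_integral lborel (\<lambda>t. (norm (\<Sum>i\<in>J. indicat_real {a i<..b i} t *\<^sub>R \<xi> i \<omega>))\<^sup>2) (R \<omega>)" for \<omega>
  proof -
    have "has_bochner_integral lborel (\<lambda>t. \<Sum>i\<in>J. \<Sum>j\<in>J. (\<xi> i \<omega> \<bullet> \<xi> j \<omega>) * (indicat_real {a i<..b i} t * indicat_real {a j<..b j} t))
       (\<Sum>i\<in>J. \<Sum>j\<in>J. (\<xi> i \<omega> \<bullet> \<xi> j \<omega>) * ov i j)"
      unfolding ov_def overlap_def
      by (intro has_bochner_integral_sum has_bochner_integral_mult_right indicator_overlap_integral) (use ab in auto)
    moreover have "(\<Sum>i\<in>J. \<Sum>j\<in>J. (\<xi> i \<omega> \<bullet> \<xi> j \<omega>) * (indicat_real {a i<..b i} t * indicat_real {a j<..b j} t))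
       = (norm (\<Sum>i\<in>J. indicat_real {a i<..b i} t *\<^sub>R \<xi> i \<omega>))\<^sup>2" for t
      unfolding power2_norm_eq_inner inner_sum_left inner_sum_right
      by (simp add: mult_ac inner_commute)
    ultimately show ?thesis by (simp add: R_def)
  qed
  have R0: "0 \<le> R \<omega>" for \<omega>
    unfolding has_bochner_integral_integral_eq[OF inner[of \<omega>], symmetric] by simp
  have "(\<integral>\<^sup>+\<omega>. ennreal ((L \<omega>)\<^sup>2) \<partial>\<mu>) = ennreal (\<integral>\<omega>. (L \<omega>)\<^sup>2 \<partial>\<mu>)"
    using iL by (intro nn_integral_eq_integral) (auto simp: has_bochner_integral_iff)
  also have "(\<integral>\<omega>. (L \<omega>)\<^sup>2 \<partial>\<mu>) = (\<integral>\<omega>. R \<omega> \<partial>\<mu>)" using iL iR by (simp add: has_bochner_integral_iff)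
  also have "ennreal \<dots> = (\<integral>\<^sup>+\<omega>. ennreal (R \<omega>) \<partial>\<mu>)"
    using iR R0 by (intro nn_integral_eq_integral[symmetric]) (auto simp: has_bochner_integral_iff)
  also have "\<dots> = (\<integral>\<^sup>+\<omega>. (\<integral>\<^sup>+t\<in>{0..1}. ennreal ((norm (\<Sum>i\<in>J. indicat_real {a i<..b i} t *\<^sub>R \<xi> i \<omega>))\<^sup>2) \<partial>lborel) \<partial>\<mu>)"
  proof (rule nn_integral_cong)
    fix \<omega>
    have z: "(\<Sum>i\<in>J. indicat_real {a i<..b i} t *\<^sub>R \<xi> i \<omega>) = 0" if "t \<notin> {0..1}" for t
    proof (rule sum.neutral, rule ballI)
      fix i assume "i \<in> J"
      then have "t \<notin> {a i<..b i}" using ab[of i] that by auto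
      then show "indicat_real {a i<..b i} t *\<^sub>R \<xi> i \<omega> = 0" by simp
    qed
    have "(\<integral>\<^sup>+t\<in>{0..1}. ennreal ((norm (\<Sum>i\<in>J. indicat_real {a i<..b i} t *\<^sub>R \<xi> i \<omega>))\<^sup>2) \<partial>lborel)
        = (\<integral>\<^sup>+t. ennreal ((norm (\<Sum>i\<in>J. indicat_real {a i<..b i} t *\<^sub>R \<xi> i \<omega>))\<^sup>2) \<partial>lborel)"
    proof (rule nn_integral_cong)
      fix t :: real
      show "ennreal ((norm (\<Sum>i\<in>J. indicat_real {a i<..b i} t *\<^sub>R \<xi> i \<omega>))\<^sup>2) * indicator {0..1} t
        = ennreal ((norm (\<Sum>i\<in>J. indicat_real {a i<..b i} t *\<^sub>R \<xi> i \<omega>))\<^sup>2)"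
        using z[of t] by (cases "t \<in> {0..1}") (simp_all del: sum_indicator_scaleR)
    qed
    also have "\<dots> = ennreal (R \<omega>)"
      using inner[of \<omega>] by (subst nn_integral_eq_integral) (auto simp: has_bochner_integral_iff)
    finally show "ennreal (R \<omega>) = (\<integral>\<^sup>+t\<in>{0..1}. ennreal ((norm (\<Sum>i\<in>J. indicat_real {a i<..b i} t *\<^sub>R \<xi> i \<omega>))\<^sup>2) \<partial>lborel)"
      by simp
  qed
  finally show ?thesis unfolding L_def .
qed

lemma simple_integral_difference_isometry:
  assumes S: "simple_integrand m \<tau> \<xi>" and S': "simple_integrand m' \<tau>' \<xi>'"
  shows "(\<integral>\<^sup>+\<omega>. ennreal ((simple_integral m \<tau> \<xi> \<omega> - simple_integral m' \<tau>' \<xi>' \<omega>)\<^sup>2) \<partial>\<mu>)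
    = (\<integral>\<^sup>+\<omega>. (\<integral>\<^sup>+t\<in>{0..1}. ennreal ((norm (simple_process m \<tau> \<xi> t \<omega> - simple_process m' \<tau>' \<xi>' t \<omega>))\<^sup>2) \<partial>lborel) \<partial>\<mu>)"
proof -
  let ?J = "{..<m} <+> {..<m'}"
  let ?a = "case_sum \<tau> \<tau>'" and ?b = "case_sum (\<lambda>k. \<tau> (Suc k)) (\<lambda>k. \<tau>' (Suc k))"
  let ?x = "case_sum \<xi> (\<lambda>k \<omega>. - \<xi>' k \<omega>)"
  have "(\<integral>\<^sup>+\<omega>. ennreal ((\<Sum>i\<in>?J. ?x i \<omega> \<bullet> (\<omega> (?b i) - \<omega> (?a i)))\<^sup>2) \<partial>\<mu>)
    = (\<integral>\<^sup>+\<omega>. (\<integral>\<^sup>+t\<in>{0..1}. ennreal ((norm (\<Sum>i\<in>?J. indicat_real {?a i<..?b i} t *\<^sub>R ?x i \<omega>))\<^sup>2) \<partial>lborel) \<partial>\<mu>)"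
  proof (rule ito_isometry)
    fix i assume i: "i \<in> ?J"
    show "0 \<le> ?a i \<and> ?a i \<le> ?b i \<and> ?b i \<le> 1"
      using i S S' by (auto simp: simple_integrand_def)
    show "?x i \<in> borel_measurable (natural_filtration (?a i))"
      using i S S' by (auto simp: simple_integrand_def intro!: borel_measurable_uminus)
    show "bounded (?x i ` paths)"
      using i S S' by (auto simp: simple_integrand_def bounded_iff)
  qed simp
  moreover have "(\<Sum>i\<in>?J. ?x i \<omega> \<bullet> (\<omega> (?b i) - \<omega> (?a i))) = simple_integral m \<tau> \<xi> \<omega> - simple_integral m' \<tau>' \<xi>' \<omega>" for \<omega>
    by (simp add: sum.Plus simple_integral_def sum_negf)
  moreover have "(\<Sum>i\<in>?J. indicat_real {?a i<..?b i} t *\<^sub>R ?x i \<omega>) = simple_process m \<tau> \<xi> t \<omega> - simple_process m' \<tau>' \<xi>' t \<omega>" for t \<omega>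
    unfolding simple_process_def
    by (subst sum.Plus) (simp_all add: o_def sum_negf del: real_scaleR_def sum_indicator_scaleR)
  ultimately show ?thesis by simp
qed

lemma simple_process_measurable:
  assumes S: "simple_integrand m \<tau> \<xi>"
  shows "(\<lambda>z. simple_process m \<tau> \<xi> (snd z) (fst z)) \<in> borel_measurable (\<mu> \<Otimes>\<^sub>M lborel)"
  unfolding simple_process_def
proof (rule borel_measurable_sum)
  fix k assume "k \<in> {..<m}"
  then have "\<xi> k \<in> borel_measurable (natural_filtration (\<tau> k))" using S by (auto simp: simple_integrand_def)
  then have [measurable]: "\<xi> k \<in> borel_measurable \<mu>" by (rule filtration_measurable)
  show "(\<lambda>z. indicat_real {\<tau> k<..\<tau> (Suc k)} (snd z) *\<^sub>R \<xi> k (fst z)) \<in> borel_measurable (\<mu> \<Otimes>\<^sub>M lborel)"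
    by measurable
qed

lemma simple_integral_measurable:
  assumes S: "simple_integrand m \<tau> \<xi>"
  shows "simple_integral m \<tau> \<xi> \<in> borel_measurable \<mu>"
  unfolding simple_integral_def
proof (rule borel_measurable_sum)
  fix k assume k: "k \<in> {..<m}"
  then have "\<xi> k \<in> borel_measurable (natural_filtration (\<tau> k))" using S by (auto simp: simple_integrand_def)
  then have 1: "\<xi> k \<in> borel_measurable \<mu>" by (rule filtration_measurable)
  have 2: "(\<lambda>\<omega>. \<omega> (\<tau> (Suc k)) - \<omega> (\<tau> k)) \<in> borel_measurable \<mu>"
    using k S by (intro increment_measurable) (auto simp: simple_integrand_def)
  show "(\<lambda>\<omega>. \<xi> k \<omega> \<bullet> (\<omega> (\<tau> (Suc k)) - \<omega> (\<tau> k))) \<in> borel_measurable \<mu>"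
    using 1 2 by (rule borel_measurable_inner)
qed

text \<open>Compare with the simple processes that define the integral: the isometry holds for the difference
  of two simple processes, and two applications of \<open>(a + b)\<^sup>2 \<le> 2 a\<^sup>2 + 2 b\<^sup>2\<close> produce the factor 4.\<close>

lemma ito_integral_distance:
  assumes Hm: "(\<lambda>z. indicat_real {0..1} (snd z) *\<^sub>R H (snd z) (fst z)) \<in> borel_measurable (\<mu> \<Otimes>\<^sub>M lborel)"
    and I: "ito_integral \<mu> H I" and S: "simple_integrand m \<tau> \<xi>"
  shows "(\<integral>\<^sup>+\<omega>. ennreal ((I \<omega> - simple_integral m \<tau> \<xi> \<omega>)\<^sup>2) \<partial>\<mu>)
    \<le> 4 * (\<integral>\<^sup>+\<omega>. (\<integral>\<^sup>+t\<in>{0..1}. ennreal ((norm (H t \<omega> - simple_process m \<tau> \<xi> t \<omega>))\<^sup>2) \<partial>lborel) \<partial>\<mu>)"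
proof -
  obtain N T X where
    Im[measurable]: "I \<in> borel_measurable \<mu>" and SX: "\<And>n. simple_integrand (N n) (T n) (X n)"
    and b: "(\<lambda>n. \<integral>\<^sup>+\<omega>. (\<integral>\<^sup>+t\<in>{0..1}. ennreal ((norm (H t \<omega> - simple_process (N n) (T n) (X n) t \<omega>))\<^sup>2) \<partial>lborel) \<partial>\<mu>) \<longlonglongrightarrow> 0"
    and c: "(\<lambda>n. \<integral>\<^sup>+\<omega>. ennreal ((I \<omega> - simple_integral (N n) (T n) (X n) \<omega>)\<^sup>2) \<partial>\<mu>) \<longlonglongrightarrow> 0"
    using I unfolding ito_integral_def by blast
  \<comment> \<open>values of \<open>H\<close> outside \<open>[0,1]\<close> need not be measurable\<close>
  define H' where "H' t \<omega> = indicat_real {0..1} t *\<^sub>R H t \<omega>" for t \<omega>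
  have H'[measurable]: "(\<lambda>z. H' (snd z) (fst z)) \<in> borel_measurable (\<mu> \<Otimes>\<^sub>M lborel)"
    using Hm by (simp add: H'_def)
  define D where "D Y = (\<integral>\<^sup>+\<omega>. (\<integral>\<^sup>+t\<in>{0..1}. ennreal ((norm (H t \<omega> - Y t \<omega>))\<^sup>2) \<partial>lborel) \<partial>\<mu>)" for Y
  have D': "D Y = (\<integral>\<^sup>+\<omega>. (\<integral>\<^sup>+t\<in>{0..1}. ennreal ((norm (H' t \<omega> - Y t \<omega>))\<^sup>2) \<partial>lborel) \<partial>\<mu>)" for Y
    unfolding D_def H'_def by (intro nn_integral_cong) (simp split: split_indicator)
  have tri: "(\<integral>\<^sup>+\<omega>. (\<integral>\<^sup>+t\<in>{0..1}. ennreal ((norm (Y t \<omega> - Z t \<omega>))\<^sup>2) \<partial>lborel) \<partial>\<mu>) \<le> 2 * D Y + 2 * D Z"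
    if Y[measurable]: "(\<lambda>z. Y (snd z) (fst z)) \<in> borel_measurable (\<mu> \<Otimes>\<^sub>M lborel)"
      and Z[measurable]: "(\<lambda>z. Z (snd z) (fst z)) \<in> borel_measurable (\<mu> \<Otimes>\<^sub>M lborel)" for Y Z :: "real \<Rightarrow> path \<Rightarrow> real ^ 3"
  proof -
    have mm: "(\<lambda>z. f (fst z) (snd z)) \<in> borel_measurable (\<mu> \<Otimes>\<^sub>M lborel) \<Longrightarrow>
         (\<lambda>\<omega>. \<integral>\<^sup>+t. f \<omega> t \<partial>lborel) \<in> borel_measurable \<mu>" for f :: "path \<Rightarrow> real \<Rightarrow> ennreal"
      using lborel.borel_measurable_nn_integral_fst[of "\<lambda>z. f (fst z) (snd z)" \<mu>] by simp
    have sec: "(\<lambda>t. Y t \<omega>) \<in> borel_measurable lborel" "(\<lambda>t. Z t \<omega>) \<in> borel_measurable lborel"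
        "(\<lambda>t. H' t \<omega>) \<in> borel_measurable lborel" if "\<omega> \<in> space \<mu>" for \<omega>
      using measurable_compose[OF measurable_Pair1'[OF that] Y]
        measurable_compose[OF measurable_Pair1'[OF that] Z]
        measurable_compose[OF measurable_Pair1'[OF that] H'] by simp_all
    have "(\<integral>\<^sup>+\<omega>. (\<integral>\<^sup>+t\<in>{0..1}. ennreal ((norm (Y t \<omega> - Z t \<omega>))\<^sup>2) \<partial>lborel) \<partial>\<mu>)
       \<le> (\<integral>\<^sup>+\<omega>. (\<integral>\<^sup>+t. 2 * (ennreal ((norm (H' t \<omega> - Y t \<omega>))\<^sup>2) * indicator {0..1} t)
           + 2 * (ennreal ((norm (H' t \<omega> - Z t \<omega>))\<^sup>2) * indicator {0..1} t) \<partial>lborel) \<partial>\<mu>)"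
    proof (intro nn_integral_mono)
      fix \<omega> t
      have "ennreal ((norm (Y t \<omega> - Z t \<omega>))\<^sup>2) \<le> ennreal (2 * (norm (H' t \<omega> - Y t \<omega>))\<^sup>2 + 2 * (norm (H' t \<omega> - Z t \<omega>))\<^sup>2)"
        using norm_diff_square_le by (rule ennreal_leI)
      also have "\<dots> = 2 * ennreal ((norm (H' t \<omega> - Y t \<omega>))\<^sup>2) + 2 * ennreal ((norm (H' t \<omega> - Z t \<omega>))\<^sup>2)"
        by (simp add: ennreal_plus ennreal_mult)
      finally show "ennreal ((norm (Y t \<omega> - Z t \<omega>))\<^sup>2) * indicator {0..1} t
        \<le> 2 * (ennreal ((norm (H' t \<omega> - Y t \<omega>))\<^sup>2) * indicator {0..1} t)
           + 2 * (ennreal ((norm (H' t \<omega> - Z t \<omega>))\<^sup>2) * indicator {0..1} t)"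
        by (simp split: split_indicator)
    qed
    also have "\<dots> = (\<integral>\<^sup>+\<omega>. 2 * (\<integral>\<^sup>+t\<in>{0..1}. ennreal ((norm (H' t \<omega> - Y t \<omega>))\<^sup>2) \<partial>lborel)
        + 2 * (\<integral>\<^sup>+t\<in>{0..1}. ennreal ((norm (H' t \<omega> - Z t \<omega>))\<^sup>2) \<partial>lborel) \<partial>\<mu>)"
    proof (rule nn_integral_cong)
      fix \<omega> assume w: "\<omega> \<in> space \<mu>"
      note [measurable] = sec[OF w]
      show "(\<integral>\<^sup>+t. 2 * (ennreal ((norm (H' t \<omega> - Y t \<omega>))\<^sup>2) * indicator {0..1} t)
           + 2 * (ennreal ((norm (H' t \<omega> - Z t \<omega>))\<^sup>2) * indicator {0..1} t) \<partial>lborel)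
         = 2 * (\<integral>\<^sup>+t\<in>{0..1}. ennreal ((norm (H' t \<omega> - Y t \<omega>))\<^sup>2) \<partial>lborel)
        + 2 * (\<integral>\<^sup>+t\<in>{0..1}. ennreal ((norm (H' t \<omega> - Z t \<omega>))\<^sup>2) \<partial>lborel)"
        by (subst nn_integral_add) (auto simp: nn_integral_cmult)
    qed
    also have "\<dots> = 2 * D Y + 2 * D Z"
    proof -
      have [measurable]: "(\<lambda>\<omega>. \<integral>\<^sup>+t\<in>{0..1}. ennreal ((norm (H' t \<omega> - Y t \<omega>))\<^sup>2) \<partial>lborel) \<in> borel_measurable \<mu>"
          "(\<lambda>\<omega>. \<integral>\<^sup>+t\<in>{0..1}. ennreal ((norm (H' t \<omega> - Z t \<omega>))\<^sup>2) \<partial>lborel) \<in> borel_measurable \<mu>"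
        by (rule mm, measurable)+
      show ?thesis unfolding D' by (subst nn_integral_add) (auto simp: nn_integral_cmult)
    qed
    finally show ?thesis .
  qed
  have bound: "(\<integral>\<^sup>+\<omega>. ennreal ((I \<omega> - simple_integral m \<tau> \<xi> \<omega>)\<^sup>2) \<partial>\<mu>) \<le>
      2 * (\<integral>\<^sup>+\<omega>. ennreal ((I \<omega> - simple_integral (N n) (T n) (X n) \<omega>)\<^sup>2) \<partial>\<mu>)
      + 2 * (2 * D (simple_process (N n) (T n) (X n)) + 2 * D (simple_process m \<tau> \<xi>))" for n
  proof -
    note [measurable] = simple_integral_measurable[OF S] simple_integral_measurable[OF SX[of n]]
    have "(\<integral>\<^sup>+\<omega>. ennreal ((I \<omega> - simple_integral m \<tau> \<xi> \<omega>)\<^sup>2) \<partial>\<mu>)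
      \<le> (\<integral>\<^sup>+\<omega>. 2 * ennreal ((I \<omega> - simple_integral (N n) (T n) (X n) \<omega>)\<^sup>2)
         + 2 * ennreal ((simple_integral (N n) (T n) (X n) \<omega> - simple_integral m \<tau> \<xi> \<omega>)\<^sup>2) \<partial>\<mu>)"
    proof (rule nn_integral_mono)
      fix \<omega>
      have "(I \<omega> - simple_integral m \<tau> \<xi> \<omega>)\<^sup>2 \<le> 2 * (I \<omega> - simple_integral (N n) (T n) (X n) \<omega>)\<^sup>2
          + 2 * (simple_integral (N n) (T n) (X n) \<omega> - simple_integral m \<tau> \<xi> \<omega>)\<^sup>2"
        using norm_diff_square_le[of "I \<omega>" "simple_integral m \<tau> \<xi> \<omega>" "simple_integral (N n) (T n) (X n) \<omega>"]
        by (simp add: power2_commute)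
      then have "ennreal ((I \<omega> - simple_integral m \<tau> \<xi> \<omega>)\<^sup>2) \<le> ennreal (2 * (I \<omega> - simple_integral (N n) (T n) (X n) \<omega>)\<^sup>2
          + 2 * (simple_integral (N n) (T n) (X n) \<omega> - simple_integral m \<tau> \<xi> \<omega>)\<^sup>2)" by (rule ennreal_leI)
      then show "ennreal ((I \<omega> - simple_integral m \<tau> \<xi> \<omega>)\<^sup>2) \<le> 2 * ennreal ((I \<omega> - simple_integral (N n) (T n) (X n) \<omega>)\<^sup>2)
         + 2 * ennreal ((simple_integral (N n) (T n) (X n) \<omega> - simple_integral m \<tau> \<xi> \<omega>)\<^sup>2)"
        by (simp add: ennreal_plus ennreal_mult)
    qed
    also have "\<dots> = 2 * (\<integral>\<^sup>+\<omega>. ennreal ((I \<omega> - simple_integral (N n) (T n) (X n) \<omega>)\<^sup>2) \<partial>\<mu>)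
        + 2 * (\<integral>\<^sup>+\<omega>. ennreal ((simple_integral (N n) (T n) (X n) \<omega> - simple_integral m \<tau> \<xi> \<omega>)\<^sup>2) \<partial>\<mu>)"
      by (subst nn_integral_add) (auto simp: nn_integral_cmult)
    also have "\<dots> \<le> 2 * (\<integral>\<^sup>+\<omega>. ennreal ((I \<omega> - simple_integral (N n) (T n) (X n) \<omega>)\<^sup>2) \<partial>\<mu>)
      + 2 * (2 * D (simple_process (N n) (T n) (X n)) + 2 * D (simple_process m \<tau> \<xi>))"
      unfolding simple_integral_difference_isometry[OF SX S]
      by (intro add_left_mono mult_left_mono tri simple_process_measurable[OF S] simple_process_measurable[OF SX]) simp
    finally show ?thesis .
  qed
  have "(\<lambda>n. 2 * (\<integral>\<^sup>+\<omega>. ennreal ((I \<omega> - simple_integral (N n) (T n) (X n) \<omega>)\<^sup>2) \<partial>\<mu>)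
      + 2 * (2 * D (simple_process (N n) (T n) (X n)) + 2 * D (simple_process m \<tau> \<xi>)))
     \<longlonglongrightarrow> 2 * 0 + 2 * (2 * 0 + 2 * D (simple_process m \<tau> \<xi>))"
    unfolding D_def
    by (intro tendsto_add ennreal_tendsto_cmult b c tendsto_const) auto
  from LIMSEQ_le_const[OF this] bound
  have "(\<integral>\<^sup>+\<omega>. ennreal ((I \<omega> - simple_integral m \<tau> \<xi> \<omega>)\<^sup>2) \<partial>\<mu>) \<le> 2 * 0 + 2 * (2 * 0 + 2 * D (simple_process m \<tau> \<xi>))" by blast
  also have "\<dots> = 4 * D (simple_process m \<tau> \<xi>)" by (simp add: mult.assoc[symmetric])
  finally show ?thesis unfolding D_def .
qed

end


section \<open>The Girsanov density as a limit of Euler weights\<close>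

text \<open>The field \<open>v\<close> is the velocity in reversed time, \<open>v t = u (1 - t)\<close>: the drift of the path will
  be \<open>- v\<close>.\<close>

locale drifted_paths = brownian_paths +
  fixes v :: "real \<Rightarrow> real ^ 3 \<Rightarrow> real ^ 3" and M :: real
  assumes v_cont: "cont_strip v"
    and v_bound: "t \<in> {0..1} \<Longrightarrow> norm (v t x) \<le> M"
begin

lemma emeasure_paths [simp]: "emeasure \<mu> paths = 1"
  using emeasure_space_1 by simp

lemma M_nonneg: "0 \<le> M"
  using order_trans[OF norm_ge_zero v_bound[of 0 0]] by simp

lemma v_measurable: "t \<in> {0..1} \<Longrightarrow> v t \<in> borel_measurable borel"
  by (rule borel_measurable_continuous_onI[OF cont_strip_slice[OF v_cont]])

definition grid_drift :: "nat \<Rightarrow> nat \<Rightarrow> path \<Rightarrow> real ^ 3" where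
  "grid_drift n k \<omega> = v (real k / real n) (\<omega> (real k / real n))"

definition grid_step :: "nat \<Rightarrow> nat \<Rightarrow> path \<Rightarrow> real ^ 3" where
  "grid_step n k \<omega> = \<omega> (real (Suc k) / real n) - \<omega> (real k / real n)"

definition grid_integral :: "nat \<Rightarrow> path \<Rightarrow> real" where
  "grid_integral n \<omega> = (\<Sum>k<n. grid_drift n k \<omega> \<bullet> grid_step n k \<omega>)"

definition grid_energy :: "nat \<Rightarrow> path \<Rightarrow> real" where
  "grid_energy n \<omega> = (\<Sum>k<n. (norm (grid_drift n k \<omega>))\<^sup>2 / real n)"

lemma grid_drift_measurable:
  assumes "k \<le> n" "real k / real n \<le> t"
  shows "grid_drift n k \<in> borel_measurable (natural_filtration t)"
proof -
  have "(\<lambda>\<omega>. \<omega> (real k / real n)) \<in> borel_measurable (natural_filtration t)"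
    using assms grid_time by (intro measurable_evaluation_filtration) auto
  from measurable_compose[OF this v_measurable[OF grid_time[OF assms(1)]]]
  show ?thesis unfolding grid_drift_def[abs_def] .
qed

lemma grid_step_measurable:
  assumes "k < n" "real (Suc k) / real n \<le> t"
  shows "grid_step n k \<in> borel_measurable (natural_filtration t)"
  unfolding grid_step_def
  using assms grid_time[of k n] grid_time[of "Suc k" n] order_trans[OF grid_time_mono[of k "Suc k" n] assms(2)]
  by (intro borel_measurable_diff measurable_evaluation_filtration) auto

lemma grid_drift_bound: "k \<le> n \<Longrightarrow> norm (grid_drift n k \<omega>) \<le> M"
  unfolding grid_drift_def by (rule v_bound[OF grid_time])

lemma grid_simple_integrand: "simple_integrand n (\<lambda>k. real k / real n) (grid_drift n)"
  unfolding simple_integrand_def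
proof (intro conjI allI impI)
  show "real k / real n \<in> {0..1}" if "k \<le> n" for k using grid_time[OF that] .
  show "real k / real n \<le> real (Suc k) / real n" if "k < n" for k by (rule grid_time_mono) simp
  show "grid_drift n k \<in> borel_measurable (natural_filtration (real k / real n))" if "k < n" for k
    using that by (intro grid_drift_measurable) auto
  show "bounded (grid_drift n k ` paths)" if "k < n" for k
    using grid_drift_bound[of k n] that by (auto simp: bounded_iff intro!: exI[of _ M])
qed

lemma grid_integral_simple: "simple_integral n (\<lambda>k. real k / real n) (grid_drift n) \<omega> = grid_integral n \<omega>"
  by (simp add: simple_integral_def grid_integral_def grid_step_def)

lemma grid_integral_measurable: "grid_integral n \<in> borel_measurable \<mu>"
  using simple_integral_measurable[OF grid_simple_integrand[of n]]
  by (simp add: grid_integral_simple[abs_def])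

abbreviation grid_process :: "nat \<Rightarrow> real \<Rightarrow> path \<Rightarrow> real ^ 3" where
  "grid_process n \<equiv> simple_process n (\<lambda>k. real k / real n) (grid_drift n)"

text \<open>At time \<open>t\<close> the process has the value of \<open>v\<close> along the path at the left end of the grid cell
  \<open>(k / n, (k + 1) / n]\<close> that contains \<open>t\<close>.\<close>

lemma grid_process_value:
  assumes t: "0 < t" "t \<le> 1" and n: "n > 0"
  obtains s where "s \<in> {0..1}" "\<bar>s - t\<bar> \<le> 1 / real n" "\<And>\<omega>. grid_process n t \<omega> = v s (\<omega> s)"
proof -
  define k where "k = nat (\<lceil>t * real n\<rceil> - 1)"
  have c: "\<lceil>t * real n\<rceil> \<ge> 1" using t n by simp
  then have rk: "real k = real_of_int \<lceil>t * real n\<rceil> - 1" by (simp add: k_def)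
  have lo: "real k < t * real n" and hi: "t * real n \<le> real (Suc k)" unfolding rk of_nat_Suc by linarith+
  have kn: "k < n"
  proof -
    have "real k < 1 * real n" using lo t n by (meson less_le_trans mult_right_mono of_nat_0_le_iff)
    then show ?thesis by simp
  qed
  have iff: "t \<in> {real j / real n<..real (Suc j) / real n} \<longleftrightarrow> j = k" for j
  proof
    assume "t \<in> {real j / real n<..real (Suc j) / real n}"
    then have "real j < t * real n" "t * real n \<le> real (Suc j)" using n by (auto simp: field_simps)
    then have "real j < real (Suc k)" "real k < real (Suc j)" using lo hi by linarith+
    then show "j = k" by simp
  next
    assume "j = k"
    then show "t \<in> {real j / real n<..real (Suc j) / real n}" using lo hi n by (auto simp: field_simps)
  qed
  have "grid_process n t \<omega> = v (real k / real n) (\<omega> (real k / real n))" for \<omega>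
  proof -
    have "grid_process n t \<omega> = (\<Sum>j<n. if j = k then grid_drift n j \<omega> else 0)"
      unfolding simple_process_def indicator_def iff by (intro sum.cong) auto
    also have "\<dots> = grid_drift n k \<omega>" using kn by simp
    finally show ?thesis by (simp add: grid_drift_def)
  qed
  moreover have "\<bar>real k / real n - t\<bar> \<le> 1 / real n"
  proof -
    have "real k / real n - t = (real k - t * real n) / real n" using n by (simp add: diff_divide_distrib)
    moreover have "\<bar>real k - t * real n\<bar> \<le> 1" using lo hi by simp
    ultimately show ?thesis by (simp add: abs_divide divide_right_mono)
  qed
  ultimately show ?thesis using grid_time[of k n] kn by (intro that) auto
qed

lemma grid_process_tendsto:
  assumes w: "\<omega> \<in> paths" and t: "0 < t" "t \<le> 1"
  shows "(\<lambda>n. grid_process n t \<omega>) \<longlonglongrightarrow> v t (\<omega> t)"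
proof -
  have "\<exists>s. s \<in> {0..1} \<and> \<bar>s - t\<bar> \<le> 1 / real (Suc n) \<and> grid_process (Suc n) t \<omega> = v s (\<omega> s)" for n
    using grid_process_value[OF t, of "Suc n"] by (metis zero_less_Suc)
  then obtain s where s: "\<And>n. s n \<in> {0..1}" "\<And>n. \<bar>s n - t\<bar> \<le> 1 / real (Suc n)"
    "\<And>n. grid_process (Suc n) t \<omega> = v (s n) (\<omega> (s n))" by metis
  have "(\<lambda>n. s n - t) \<longlonglongrightarrow> 0"
    by (rule Lim_null_comparison[OF _ LIMSEQ_inverse_real_of_nat]) (use s(2) in \<open>auto simp: inverse_eq_divide\<close>)
  then have st: "s \<longlonglongrightarrow> t" by (simp add: LIM_zero_cancel)
  have "(\<lambda>n. v (s n) (\<omega> (s n))) \<longlonglongrightarrow> v t (\<omega> t)"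
    by (rule continuous_on_tendsto_compose[OF cont_strip_path[OF v_cont w] st]) (use t s(1) in auto)
  then have "(\<lambda>n. grid_process (Suc n) t \<omega>) \<longlonglongrightarrow> v t (\<omega> t)" by (simp only: s(3))
  then show ?thesis by (rule LIMSEQ_imp_Suc)
qed

lemma grid_process_bound: "t \<in> {0..1} \<Longrightarrow> norm (grid_process n t \<omega>) \<le> M"
proof (cases "0 < t \<and> n > 0")
  case True
  assume "t \<in> {0..1}"
  with True obtain s where "s \<in> {0..1}" "grid_process n t \<omega> = v s (\<omega> s)"
    using grid_process_value[of t n] by (metis atLeastAtMost_iff)
  then show ?thesis using v_bound by simp
next
  case False
  assume t: "t \<in> {0..1}"
  have "grid_process n t \<omega> = 0"
    unfolding simple_process_def using False t
    by (intro sum.neutral) (auto simp: indicator_def divide_simps)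
  then show ?thesis using M_nonneg by simp
qed

text \<open>On \<open>(0, 1]\<close> the drift is a pointwise limit of simple processes. These vanish at time 0, which is
  therefore treated separately.\<close>

lemma drift_jointly_measurable:
  "(\<lambda>z. indicat_real {0..1} (snd z) *\<^sub>R v (snd z) (fst z (snd z))) \<in> borel_measurable (\<mu> \<Otimes>\<^sub>M lborel)"
proof -
  note [measurable] = simple_process_measurable[OF grid_simple_integrand]
  have A: "(\<lambda>z. indicat_real {0<..1} (snd z) *\<^sub>R v (snd z) (fst z (snd z))) \<in> borel_measurable (\<mu> \<Otimes>\<^sub>M lborel)"
  proof (rule borel_measurable_LIMSEQ_metric)
    show "(\<lambda>z. indicat_real {0<..1} (snd z :: real) *\<^sub>R grid_process n (snd z) (fst z)) \<in> borel_measurable (\<mu> \<Otimes>\<^sub>M lborel)" for n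
      by measurable
    fix z :: "path \<times> real" assume "z \<in> space (\<mu> \<Otimes>\<^sub>M lborel)"
    then have "fst z \<in> paths" by (auto simp: space_pair_measure)
    then show "(\<lambda>n. indicat_real {0<..1} (snd z) *\<^sub>R grid_process n (snd z) (fst z))
        \<longlonglongrightarrow> indicat_real {0<..1} (snd z) *\<^sub>R v (snd z) (fst z (snd z))"
      using grid_process_tendsto[of "fst z" "snd z"] by (cases "snd z \<in> {0<..1}") auto
  qed
  have [measurable]: "(\<lambda>\<omega>. v 0 (\<omega> 0)) \<in> borel_measurable \<mu>"
    using measurable_compose[OF evaluation[of 0] v_measurable[of 0]] by simp
  have B: "(\<lambda>z. indicat_real {0} (snd z) *\<^sub>R v 0 (fst z 0)) \<in> borel_measurable (\<mu> \<Otimes>\<^sub>M lborel)"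
    by measurable
  have "(\<lambda>z. indicat_real {0..1} (snd z) *\<^sub>R v (snd z) (fst z (snd z)))
    = (\<lambda>z. indicat_real {0<..1} (snd z) *\<^sub>R v (snd z) (fst z (snd z)) + indicat_real {0} (snd z) *\<^sub>R v 0 (fst z 0))"
    by (auto simp: fun_eq_iff indicator_def)
  then show ?thesis using borel_measurable_add[OF A B] by simp
qed

lemma grid_process_L2_tendsto:
  "(\<lambda>n. \<integral>\<^sup>+\<omega>. (\<integral>\<^sup>+t\<in>{0..1}. ennreal ((norm (v t (\<omega> t) - grid_process n t \<omega>))\<^sup>2) \<partial>lborel) \<partial>\<mu>) \<longlonglongrightarrow> 0"
proof -
  define \<Delta> where "\<Delta> n \<omega> t = ennreal ((norm (v t (\<omega> t) - grid_process n t \<omega>))\<^sup>2) * indicator {0..1} t" for n \<omega> t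
  have \<Delta>_eq: "\<Delta> n \<omega> t = ennreal ((norm (indicat_real {0..1} t *\<^sub>R v t (\<omega> t) - grid_process n t \<omega>))\<^sup>2) * indicator {0..1} t" for n \<omega> t
    by (simp add: \<Delta>_def split: split_indicator)
  have joint[measurable]: "(\<lambda>z. \<Delta> n (fst z) (snd z)) \<in> borel_measurable (\<mu> \<Otimes>\<^sub>M lborel)" for n
  proof -
    note [measurable] = drift_jointly_measurable simple_process_measurable[OF grid_simple_integrand]
    show ?thesis unfolding \<Delta>_eq by measurable
  qed
  have sec: "\<Delta> n \<omega> \<in> borel_measurable lborel" if "\<omega> \<in> space \<mu>" for n \<omega>
    using measurable_compose[OF measurable_Pair1'[OF that] joint] by simp
  have outer: "(\<lambda>\<omega>. \<integral>\<^sup>+t. \<Delta> n \<omega> t \<partial>lborel) \<in> borel_measurable \<mu>" for n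
    using lborel.borel_measurable_nn_integral_fst[OF joint[of n]] by simp
  have bd: "\<Delta> n \<omega> t \<le> ennreal ((2 * M)\<^sup>2) * indicator {0..1} t" for n \<omega> t
  proof (cases "t \<in> {0..1}")
    case True
    have "norm (v t (\<omega> t) - grid_process n t \<omega>) \<le> 2 * M"
      using norm_triangle_ineq4[of "v t (\<omega> t)" "grid_process n t \<omega>"] v_bound[OF True, of "\<omega> t"] grid_process_bound[OF True, of n \<omega>]
      by linarith
    then have "(norm (v t (\<omega> t) - grid_process n t \<omega>))\<^sup>2 \<le> (2 * M)\<^sup>2" by (intro power_mono) auto
    then show ?thesis using True by (simp add: \<Delta>_def ennreal_leI)
  qed (simp add: \<Delta>_def)
  have fin: "(\<integral>\<^sup>+t. ennreal ((2 * M)\<^sup>2) * indicator {0..1::real} t \<partial>lborel) = ennreal ((2 * M)\<^sup>2)"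
    by (subst nn_integral_cmult_indicator) auto
  have inner: "(\<lambda>n. \<integral>\<^sup>+t. \<Delta> n \<omega> t \<partial>lborel) \<longlonglongrightarrow> 0" if w: "\<omega> \<in> space \<mu>" for \<omega>
  proof -
    have "(\<lambda>n. \<integral>\<^sup>+t. \<Delta> n \<omega> t \<partial>lborel) \<longlonglongrightarrow> (\<integral>\<^sup>+(t::real). 0 \<partial>lborel)"
    proof (rule nn_integral_dominated_convergence[where w = "\<lambda>t. ennreal ((2 * M)\<^sup>2) * indicator {0..1} t"])
      show "AE t in lborel. (\<lambda>n. \<Delta> n \<omega> t) \<longlonglongrightarrow> 0"
        using AE_lborel_singleton[of 0]
      proof eventually_elim
        fix t :: real assume t0: "t \<noteq> 0"
        show "(\<lambda>n. \<Delta> n \<omega> t) \<longlonglongrightarrow> 0"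
        proof (cases "t \<in> {0..1}")
          case True
          then have "(\<lambda>n. grid_process n t \<omega>) \<longlonglongrightarrow> v t (\<omega> t)" using t0 w by (intro grid_process_tendsto) auto
          then have "(\<lambda>n. (norm (v t (\<omega> t) - grid_process n t \<omega>))\<^sup>2) \<longlonglongrightarrow> (norm (v t (\<omega> t) - v t (\<omega> t)))\<^sup>2"
            by (intro tendsto_intros)
          then have "(\<lambda>n. ennreal ((norm (v t (\<omega> t) - grid_process n t \<omega>))\<^sup>2)) \<longlonglongrightarrow> ennreal 0"
            by (intro tendsto_ennrealI) simp
          then show ?thesis using True by (simp add: \<Delta>_def)
        qed (simp add: \<Delta>_def)
      qed
      show "(\<integral>\<^sup>+t. ennreal ((2 * M)\<^sup>2) * indicator {0..1::real} t \<partial>lborel) < \<infinity>" unfolding fin by simp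
      show "AE t in lborel. \<Delta> n \<omega> t \<le> ennreal ((2 * M)\<^sup>2) * indicator {0..1} t" for n
        by (intro AE_I2 bd)
      show "(\<lambda>t. \<Delta> n \<omega> t) \<in> borel_measurable lborel" for n by (rule sec[OF w])
      show "(\<lambda>t. ennreal ((2 * M)\<^sup>2) * indicator {0..1::real} t) \<in> borel_measurable lborel" by simp
    qed simp
    then show ?thesis by simp
  qed
  have "(\<lambda>n. \<integral>\<^sup>+\<omega>. (\<integral>\<^sup>+t. \<Delta> n \<omega> t \<partial>lborel) \<partial>\<mu>) \<longlonglongrightarrow> (\<integral>\<^sup>+\<omega>. 0 \<partial>\<mu>)"
  proof (rule nn_integral_dominated_convergence[where w = "\<lambda>_. ennreal ((2 * M)\<^sup>2)"])
    show "AE \<omega> in \<mu>. (\<integral>\<^sup>+t. \<Delta> n \<omega> t \<partial>lborel) \<le> ennreal ((2 * M)\<^sup>2)" for n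
      by (intro AE_I2 order_trans[OF nn_integral_mono[OF bd] eq_refl[OF fin]])
    show "(\<integral>\<^sup>+\<omega>. ennreal ((2 * M)\<^sup>2) \<partial>\<mu>) < \<infinity>" by (simp add: emeasure_space_1)
    show "AE \<omega> in \<mu>. (\<lambda>n. \<integral>\<^sup>+t. \<Delta> n \<omega> t \<partial>lborel) \<longlonglongrightarrow> 0" by (intro AE_I2 inner)
    show "(\<lambda>\<omega>. \<integral>\<^sup>+t. \<Delta> n \<omega> t \<partial>lborel) \<in> borel_measurable \<mu>" for n by (rule outer)
  qed simp_all
  then show ?thesis unfolding \<Delta>_def by simp
qed

lemma grid_integral_L2_tendsto:
  assumes "ito_integral \<mu> (\<lambda>t \<omega>. v t (\<omega> t)) I"
  shows "(\<lambda>n. \<integral>\<^sup>+\<omega>. ennreal ((I \<omega> - grid_integral n \<omega>)\<^sup>2) \<partial>\<mu>) \<longlonglongrightarrow> 0"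
proof -
  have "(\<lambda>n. 4 * (\<integral>\<^sup>+\<omega>. (\<integral>\<^sup>+t\<in>{0..1}. ennreal ((norm (v t (\<omega> t) - grid_process n t \<omega>))\<^sup>2) \<partial>lborel) \<partial>\<mu>)) \<longlonglongrightarrow> 4 * 0"
    by (intro ennreal_tendsto_cmult grid_process_L2_tendsto) auto
  then have lim: "(\<lambda>n. 4 * (\<integral>\<^sup>+\<omega>. (\<integral>\<^sup>+t\<in>{0..1}. ennreal ((norm (v t (\<omega> t) - grid_process n t \<omega>))\<^sup>2) \<partial>lborel) \<partial>\<mu>)) \<longlonglongrightarrow> 0"
    by simp
  have le: "(\<integral>\<^sup>+\<omega>. ennreal ((I \<omega> - grid_integral n \<omega>)\<^sup>2) \<partial>\<mu>)
     \<le> 4 * (\<integral>\<^sup>+\<omega>. (\<integral>\<^sup>+t\<in>{0..1}. ennreal ((norm (v t (\<omega> t) - grid_process n t \<omega>))\<^sup>2) \<partial>lborel) \<partial>\<mu>)" for n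
    using ito_integral_distance[OF drift_jointly_measurable assms grid_simple_integrand[of n]]
    by (simp add: grid_integral_simple)
  show ?thesis
    by (rule tendsto_sandwich[OF _ _ tendsto_const lim]) (use le in auto)
qed

lemma grid_integral_subsequence:
  assumes I: "ito_integral \<mu> (\<lambda>t \<omega>. v t (\<omega> t)) I"
  obtains r where "strict_mono r" "AE \<omega> in \<mu>. (\<lambda>n. grid_integral (r n) \<omega>) \<longlonglongrightarrow> I \<omega>"
proof -
  note [measurable] = grid_integral_measurable
  have [measurable]: "I \<in> borel_measurable \<mu>" using I by (simp add: ito_integral_def)
  note lim = grid_integral_L2_tendsto[OF I]
  from order_tendstoD(2)[OF lim, of "1"]
  obtain N where N: "\<And>n. n \<ge> N \<Longrightarrow> (\<integral>\<^sup>+\<omega>. ennreal ((I \<omega> - grid_integral n \<omega>)\<^sup>2) \<partial>\<mu>) < 1"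
    by (auto simp: eventually_sequentially)
  define U where "U n \<omega> = (I \<omega> - grid_integral (n + N) \<omega>)\<^sup>2" for n \<omega>
  have iU: "integrable \<mu> (U n)" for n
    unfolding U_def using N[of "n + N"] by (intro integrableI_nonneg) (auto intro: less_trans)
  have "(\<lambda>n. ennreal (\<integral>\<omega>. norm (U n \<omega>) \<partial>\<mu>)) \<longlonglongrightarrow> 0"
  proof -
    have "ennreal (\<integral>\<omega>. norm (U n \<omega>) \<partial>\<mu>) = (\<integral>\<^sup>+\<omega>. ennreal ((I \<omega> - grid_integral (n + N) \<omega>)\<^sup>2) \<partial>\<mu>)" for n
      using nn_integral_eq_integral[OF iU[of n]] unfolding U_def[abs_def] by simp
    then show ?thesis using LIMSEQ_ignore_initial_segment[OF lim, of N] by simp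
  qed
  then have "(\<lambda>n. \<integral>\<omega>. norm (U n \<omega>) \<partial>\<mu>) \<longlonglongrightarrow> 0"
    by (simp add: ennreal_0[symmetric] tendsto_ennreal_iff del: ennreal_0)
  from tendsto_L1_AE_subseq[OF iU this] obtain q where
    q: "strict_mono q" "AE \<omega> in \<mu>. (\<lambda>n. U (q n) \<omega>) \<longlonglongrightarrow> 0" by blast
  show ?thesis
  proof (rule that[of "\<lambda>n. q n + N"])
    show "strict_mono (\<lambda>n. q n + N)" using q(1) by (simp add: strict_mono_def)
    show "AE \<omega> in \<mu>. (\<lambda>n. grid_integral (q n + N) \<omega>) \<longlonglongrightarrow> I \<omega>"
      using q(2)
    proof eventually_elim
      case (elim \<omega>)
      from tendsto_real_sqrt[OF elim] have "(\<lambda>n. \<bar>I \<omega> - grid_integral (q n + N) \<omega>\<bar>) \<longlonglongrightarrow> 0"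
        by (simp add: U_def)
      then have "(\<lambda>n. grid_integral (q n + N) \<omega> - I \<omega>) \<longlonglongrightarrow> 0"
        by (subst (asm) abs_minus_commute) (rule tendsto_rabs_zero_cancel)
      then show ?case by (rule LIM_zero_cancel)
    qed
  qed
qed

lemma grid_energy_tendsto:
  assumes w: "\<omega> \<in> paths"
  shows "(\<lambda>n. grid_energy n \<omega>) \<longlonglongrightarrow> (LINT t:{0..1}|lborel. (norm (v t (\<omega> t)))\<^sup>2)"
  unfolding grid_energy_def grid_drift_def
proof (rule riemann_sum_tendsto)
  show "continuous_on {0..1} (\<lambda>t. (norm (v t (\<omega> t)))\<^sup>2)"
    by (intro continuous_intros cont_strip_path[OF v_cont w])
  show "(\<lambda>n. real n / real n) \<longlonglongrightarrow> 1"
    by (rule tendsto_eventually) (auto simp: eventually_sequentially intro!: exI[of _ 1])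
qed simp

text \<open>The discrete Girsanov weight of the steps \<open>j, \<dots>, m - 1\<close> for the drift \<open>- c v\<close>. Besides \<open>c = 1\<close>, the
  case \<open>c = 2\<close> is needed to bound the square of the weight.\<close>

definition euler_weight :: "real \<Rightarrow> nat \<Rightarrow> nat \<Rightarrow> nat \<Rightarrow> path \<Rightarrow> real" where
  "euler_weight c n j m \<omega> = (\<Prod>k\<in>{j..<m}. tilt (c *\<^sub>R grid_drift n k \<omega>) (1 / real n) (grid_step n k \<omega>))"

lemma euler_weight_nonneg: "0 \<le> euler_weight c n j m \<omega>"
  unfolding euler_weight_def by (rule prod_nonneg) simp

lemma euler_weight_measurable:
  assumes "m \<le> n" "real m / real n \<le> t"
  shows "euler_weight c n j m \<in> borel_measurable (natural_filtration t)"
  unfolding euler_weight_def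
proof (rule borel_measurable_prod)
  fix k assume k: "k \<in> {j..<m}"
  have 1: "real (Suc k) / real n \<le> t"
    using grid_time_mono[of "Suc k" m n] k assms by auto
  then have 2: "real k / real n \<le> t" using grid_time_mono[of k "Suc k" n] by auto
  have "grid_drift n k \<in> borel_measurable (natural_filtration t)" "grid_step n k \<in> borel_measurable (natural_filtration t)"
    using k assms 1 2 by (auto intro!: grid_drift_measurable grid_step_measurable)
  then show "(\<lambda>\<omega>. tilt (c *\<^sub>R grid_drift n k \<omega>) (1 / real n) (grid_step n k \<omega>)) \<in> borel_measurable (natural_filtration t)"
    by (intro tilt_measurable borel_measurable_scaleR borel_measurable_const)
qed

lemma euler_weight_Suc:
  "j \<le> m \<Longrightarrow> euler_weight c n j (Suc m) \<omega> = euler_weight c n j m \<omega> * tilt (c *\<^sub>R grid_drift n m \<omega>) (1 / real n) (grid_step n m \<omega>)"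
  by (simp add: euler_weight_def prod.atLeastLessThan_Suc)

lemma euler_weight_split:
  "j \<le> k \<Longrightarrow> k \<le> m \<Longrightarrow> euler_weight c n j m \<omega> = euler_weight c n j k \<omega> * euler_weight c n k m \<omega>"
  unfolding euler_weight_def by (rule prod.atLeastLessThan_concat[symmetric])

lemma grid_lt: "k < n \<Longrightarrow> 0 \<le> real k / real n \<and> real k / real n < real (Suc k) / real n \<and> real (Suc k) / real n \<le> 1
    \<and> 1 / real n = real (Suc k) / real n - real k / real n"
  by (auto simp: divide_simps)

text \<open>Later factors may be dropped one by one, starting with the last: each has mean one given the past.\<close>

lemma euler_weight_nn_integral:
  assumes jm: "j \<le> m" "m \<le> n" and G: "G \<in> borel_measurable (natural_filtration (real j / real n))"
  shows "(\<integral>\<^sup>+\<omega>. G \<omega> * ennreal (euler_weight c n j m \<omega>) \<partial>\<mu>) = (\<integral>\<^sup>+\<omega>. G \<omega> \<partial>\<mu>)"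
  using jm
proof (induction m rule: dec_induct)
  case base
  then show ?case by (simp add: euler_weight_def)
next
  case (step m)
  then have mn: "m < n" by simp
  define s t where "s = real m / real n" and "t = real (Suc m) / real n"
  have st: "0 \<le> s" "s < t" "t \<le> 1" "1 / real n = t - s" using grid_lt[OF mn] by (auto simp: s_def t_def)
  have [measurable]: "G \<in> borel_measurable (natural_filtration s)"
    by (rule measurable_natural_filtration_mono[OF G]) (use step grid_time_mono in \<open>auto simp: s_def\<close>)
  have [measurable]: "euler_weight c n j m \<in> borel_measurable (natural_filtration s)"
    "grid_drift n m \<in> borel_measurable (natural_filtration s)"
    using mn by (auto intro!: euler_weight_measurable grid_drift_measurable simp: s_def)
  let ?F = "\<lambda>z. G (fst z) * ennreal (euler_weight c n j m (fst z)) * ennreal (tilt (c *\<^sub>R grid_drift n m (fst z)) (1 / real n) (snd z))"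
  have one: "(\<integral>\<^sup>+\<omega>'. ennreal (tilt a (1 / real n) (\<omega>' t - \<omega>' s)) \<partial>\<mu>) = 1" for a
    using tilted_moments(1)[OF st, of a]
    by (subst nn_integral_eq_integral) (auto simp: has_bochner_integral_iff)
  have "(\<integral>\<^sup>+\<omega>. G \<omega> * ennreal (euler_weight c n j (Suc m) \<omega>) \<partial>\<mu>) = (\<integral>\<^sup>+\<omega>. ?F (\<omega>, \<omega> t - \<omega> s) \<partial>\<mu>)"
    using step(1) by (intro nn_integral_cong)
      (simp add: euler_weight_Suc ennreal_mult euler_weight_nonneg grid_step_def s_def t_def mult.assoc)
  also have "\<dots> = (\<integral>\<^sup>+\<omega>. \<integral>\<^sup>+\<omega>'. ?F (\<omega>, \<omega>' t - \<omega>' s) \<partial>\<mu> \<partial>\<mu>)"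
    by (rule decoupling_nn_integral[OF st(1-3)]) measurable
  also have "\<dots> = (\<integral>\<^sup>+\<omega>. G \<omega> * ennreal (euler_weight c n j m \<omega>) \<partial>\<mu>)"
  proof (rule nn_integral_cong)
    fix \<omega>
    have [measurable]: "(\<lambda>\<omega>'. \<omega>' t - \<omega>' s) \<in> borel_measurable \<mu>" using st by (intro increment_measurable) auto
    have "(\<integral>\<^sup>+\<omega>'. ?F (\<omega>, \<omega>' t - \<omega>' s) \<partial>\<mu>) = G \<omega> * ennreal (euler_weight c n j m \<omega>) *
        (\<integral>\<^sup>+\<omega>'. ennreal (tilt (c *\<^sub>R grid_drift n m \<omega>) (1 / real n) (\<omega>' t - \<omega>' s)) \<partial>\<mu>)"
      unfolding fst_conv snd_conv by (rule nn_integral_cmult) measurable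
    then show "(\<integral>\<^sup>+\<omega>'. ?F (\<omega>, \<omega>' t - \<omega>' s) \<partial>\<mu>) = G \<omega> * ennreal (euler_weight c n j m \<omega>)"
      unfolding one by simp
  qed
  also have "\<dots> = (\<integral>\<^sup>+\<omega>. G \<omega> \<partial>\<mu>)" using step by simp
  finally show ?case .
qed

lemma euler_weight_integral:
  fixes G :: "path \<Rightarrow> real"
  assumes jm: "j \<le> m" "m \<le> n" and G: "G \<in> borel_measurable (natural_filtration (real j / real n))" "integrable \<mu> G"
  shows "integrable \<mu> (\<lambda>\<omega>. G \<omega> * euler_weight c n j m \<omega>)"
    and "(\<integral>\<omega>. G \<omega> * euler_weight c n j m \<omega> \<partial>\<mu>) = (\<integral>\<omega>. G \<omega> \<partial>\<mu>)"
proof -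
  note [measurable] = G(1)
  have [measurable]: "G \<in> borel_measurable \<mu>" by (rule filtration_measurable[OF G(1)])
  have [measurable]: "euler_weight c n j m \<in> borel_measurable \<mu>"
    by (rule filtration_measurable[OF euler_weight_measurable[OF jm(2) order_refl]])
  have nn: "(\<integral>\<^sup>+\<omega>. ennreal (F \<omega> * euler_weight c n j m \<omega>) \<partial>\<mu>) = (\<integral>\<^sup>+\<omega>. ennreal (F \<omega>) \<partial>\<mu>)"
    if [measurable]: "F \<in> borel_measurable (natural_filtration (real j / real n))" for F
  proof -
    have "(\<lambda>\<omega>. ennreal (F \<omega>)) \<in> borel_measurable (natural_filtration (real j / real n))" by measurable
    from euler_weight_nn_integral[OF jm this, of c] show ?thesis
      by (simp add: ennreal_mult'' euler_weight_nonneg)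
  qed
  have "(\<integral>\<^sup>+\<omega>. ennreal (norm (G \<omega> * euler_weight c n j m \<omega>)) \<partial>\<mu>) = (\<integral>\<^sup>+\<omega>. ennreal \<bar>G \<omega>\<bar> \<partial>\<mu>)"
    using nn[of "\<lambda>\<omega>. \<bar>G \<omega>\<bar>"] by (simp add: abs_mult euler_weight_nonneg)
  also have "\<dots> < \<infinity>" using G(2) by (simp add: integrable_iff_bounded)
  finally show i: "integrable \<mu> (\<lambda>\<omega>. G \<omega> * euler_weight c n j m \<omega>)" by (intro integrableI_bounded) auto
  show "(\<integral>\<omega>. G \<omega> * euler_weight c n j m \<omega> \<partial>\<mu>) = (\<integral>\<omega>. G \<omega> \<partial>\<mu>)"
    unfolding real_lebesgue_integral_def[OF i] real_lebesgue_integral_def[OF G(2)]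
    using nn[OF G(1)] nn[of "\<lambda>\<omega>. - G \<omega>"] by simp
qed

lemma euler_weight_mean:
  assumes m: "m \<le> n"
  shows "integrable \<mu> (euler_weight c n 0 m)" "(\<integral>\<omega>. euler_weight c n 0 m \<omega> \<partial>\<mu>) = 1"
proof -
  have "integrable \<mu> (\<lambda>\<omega>. 1 * euler_weight c n 0 m \<omega>)"
    by (rule euler_weight_integral(1)[OF _ m]) simp_all
  then show "integrable \<mu> (euler_weight c n 0 m)" by simp
  have "(\<integral>\<omega>. 1 * euler_weight c n 0 m \<omega> \<partial>\<mu>) = (\<integral>\<omega>. 1 \<partial>\<mu>)"
    by (rule euler_weight_integral(2)[OF _ m]) simp_all
  then show "(\<integral>\<omega>. euler_weight c n 0 m \<omega> \<partial>\<mu>) = 1" using prob_space by simp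
qed

lemma euler_weight_exp:
  "euler_weight 1 n 0 n \<omega> = exp (- grid_integral n \<omega> - grid_energy n \<omega> / 2)"
proof -
  have "euler_weight 1 n 0 n \<omega> = exp (\<Sum>k<n. - (grid_drift n k \<omega> \<bullet> grid_step n k \<omega>) - (norm (grid_drift n k \<omega>))\<^sup>2 * (1 / real n) / 2)"
    by (simp add: euler_weight_def tilt_def exp_sum atLeast0LessThan)
  also have "(\<Sum>k<n. - (grid_drift n k \<omega> \<bullet> grid_step n k \<omega>) - (norm (grid_drift n k \<omega>))\<^sup>2 * (1 / real n) / 2)
      = - grid_integral n \<omega> - grid_energy n \<omega> / 2"
    by (simp add: sum_subtractf sum_negf grid_integral_def grid_energy_def sum_divide_distrib)
  finally show ?thesis .
qed

text \<open>The square of the tilt by \<open>a\<close> is the tilt by \<open>2 a\<close> times \<open>exp (|a|\<^sup>2 h)\<close>, and the product of the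
  latter factors is bounded because \<open>v\<close> is.\<close>

lemma euler_weight_square_bound:
  "(\<integral>\<^sup>+\<omega>. ennreal ((euler_weight 1 n 0 n \<omega>)\<^sup>2) \<partial>\<mu>) \<le> ennreal (exp (M\<^sup>2))"
proof -
  have tilt2: "(tilt a h y)\<^sup>2 = tilt (2 *\<^sub>R a) h y * exp ((norm a)\<^sup>2 * h)" for a y :: "real^3" and h
  proof -
    have n2: "(norm (2 *\<^sub>R a))\<^sup>2 = 4 * (norm a)\<^sup>2" by (simp add: power_mult_distrib)
    have "2 * (- (a \<bullet> y) - (norm a)\<^sup>2 * h / 2) = - (2 *\<^sub>R a \<bullet> y) - (norm (2 *\<^sub>R a))\<^sup>2 * h / 2 + (norm a)\<^sup>2 * h"
      unfolding n2 inner_scaleR_left by (simp add: field_simps)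
    then show ?thesis
      unfolding tilt_def exp_double[symmetric] mult_exp_exp by (rule arg_cong)
  qed
  have "(euler_weight 1 n 0 n \<omega>)\<^sup>2 \<le> exp (M\<^sup>2) * euler_weight 2 n 0 n \<omega>" for \<omega>
  proof -
    have "(euler_weight 1 n 0 n \<omega>)\<^sup>2 = euler_weight 2 n 0 n \<omega> * (\<Prod>k\<in>{0..<n}. exp ((norm (grid_drift n k \<omega>))\<^sup>2 * (1 / real n)))"
      unfolding euler_weight_def prod_power_distrib scaleR_one tilt2 prod.distrib ..
    also have "(\<Prod>k\<in>{0..<n}. exp ((norm (grid_drift n k \<omega>))\<^sup>2 * (1 / real n))) = exp (\<Sum>k\<in>{0..<n}. (norm (grid_drift n k \<omega>))\<^sup>2 * (1 / real n))"
      by (rule exp_sum[symmetric]) simp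
    also have "euler_weight 2 n 0 n \<omega> * \<dots> \<le> euler_weight 2 n 0 n \<omega> * exp (M\<^sup>2)"
    proof -
      have "(\<Sum>k\<in>{0..<n}. (norm (grid_drift n k \<omega>))\<^sup>2 * (1 / real n)) \<le> (\<Sum>k\<in>{0..<n}. M\<^sup>2 * (1 / real n))"
        by (intro sum_mono mult_right_mono power_mono grid_drift_bound) simp_all
      also have "\<dots> \<le> M\<^sup>2" by (cases "n = 0") simp_all
      finally show ?thesis by (intro mult_left_mono euler_weight_nonneg) simp
    qed
    finally show ?thesis by (simp only: mult.commute)
  qed
  then have "(\<integral>\<^sup>+\<omega>. ennreal ((euler_weight 1 n 0 n \<omega>)\<^sup>2) \<partial>\<mu>) \<le> (\<integral>\<^sup>+\<omega>. ennreal (exp (M\<^sup>2)) * ennreal (euler_weight 2 n 0 n \<omega>) \<partial>\<mu>)"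
    unfolding ennreal_mult'[OF exp_ge_zero, symmetric] by (intro nn_integral_mono ennreal_leI)
  also have "\<dots> = (\<integral>\<^sup>+\<omega>. ennreal (exp (M\<^sup>2)) \<partial>\<mu>)"
    by (rule euler_weight_nn_integral) auto
  finally show ?thesis by (simp add: emeasure_space_1)
qed

definition girsanov_density :: "(path \<Rightarrow> real) \<Rightarrow> path \<Rightarrow> real" where
  "girsanov_density I \<omega> = exp (- I \<omega> - 1 / 2 * (LINT t:{0..1}|lborel. (norm (v t (\<omega> t)))\<^sup>2))"

lemma girsanov_density_measurable:
  assumes [measurable]: "I \<in> borel_measurable \<mu>"
  shows "girsanov_density I \<in> borel_measurable \<mu>"
proof -
  have "(\<lambda>\<omega>. LINT t:{0..1}|lborel. (norm (v t (\<omega> t)))\<^sup>2) \<in> borel_measurable \<mu>"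
  proof (rule borel_measurable_LIMSEQ_metric)
    show "grid_energy n \<in> borel_measurable \<mu>" for n
      unfolding grid_energy_def
    proof (rule borel_measurable_sum)
      fix k assume "k \<in> {..<n}"
      then have [measurable]: "grid_drift n k \<in> borel_measurable \<mu>"
        by (intro filtration_measurable[OF grid_drift_measurable[OF _ order_refl]]) auto
      show "(\<lambda>\<omega>. (norm (grid_drift n k \<omega>))\<^sup>2 / real n) \<in> borel_measurable \<mu>" by measurable
    qed
  qed (use grid_energy_tendsto in simp)
  then show ?thesis unfolding girsanov_density_def by measurable
qed

text \<open>Convergence of the stochastic sums in \<open>L\<^sup>2\<close> gives almost sure convergence along a subsequence, which
  suffices: the limits below only have to be identified along some sequence of grids.\<close>

lemma euler_weight_tendsto_girsanov:
  assumes I: "ito_integral \<mu> (\<lambda>t \<omega>. v t (\<omega> t)) I"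
  obtains r where "strict_mono r" "AE \<omega> in \<mu>. (\<lambda>n. euler_weight 1 (r n) 0 (r n) \<omega>) \<longlonglongrightarrow> girsanov_density I \<omega>"
proof -
  obtain r where r: "strict_mono r" "AE \<omega> in \<mu>. (\<lambda>n. grid_integral (r n) \<omega>) \<longlonglongrightarrow> I \<omega>"
    by (rule grid_integral_subsequence[OF I])
  have "AE \<omega> in \<mu>. (\<lambda>n. euler_weight 1 (r n) 0 (r n) \<omega>) \<longlonglongrightarrow> girsanov_density I \<omega>"
    using r(2) AE_space
  proof eventually_elim
    case (elim \<omega>)
    then have "(\<lambda>n. grid_energy n \<omega>) \<longlonglongrightarrow> (LINT t:{0..1}|lborel. (norm (v t (\<omega> t)))\<^sup>2)"
      by (intro grid_energy_tendsto) simp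
    from LIMSEQ_subseq_LIMSEQ[OF this r(1)]
    have "(\<lambda>n. exp (- grid_integral (r n) \<omega> - grid_energy (r n) \<omega> / 2)) \<longlonglongrightarrow>
        exp (- I \<omega> - (LINT t:{0..1}|lborel. (norm (v t (\<omega> t)))\<^sup>2) / 2)"
      by (intro tendsto_intros elim(1)) (simp_all add: o_def)
    then show ?case unfolding euler_weight_exp girsanov_density_def by simp
  qed
  with r(1) show ?thesis by (rule that)
qed

lemma girsanov_limit:
  fixes Q :: "nat \<Rightarrow> path \<Rightarrow> real"
  assumes I: "ito_integral \<mu> (\<lambda>t \<omega>. v t (\<omega> t)) I"
    and r: "AE \<omega> in \<mu>. (\<lambda>n. euler_weight 1 (r n) 0 (r n) \<omega>) \<longlonglongrightarrow> girsanov_density I \<omega>"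
    and Qm: "\<And>n. Q n \<in> borel_measurable \<mu>" "Q' \<in> borel_measurable \<mu>"
    and Qb: "\<And>n \<omega>. \<omega> \<in> paths \<Longrightarrow> \<bar>Q n \<omega>\<bar> \<le> C"
    and Q: "AE \<omega> in \<mu>. (\<lambda>n. Q n \<omega>) \<longlonglongrightarrow> Q' \<omega>"
  shows "integrable \<mu> (\<lambda>\<omega>. girsanov_density I \<omega> * Q' \<omega>)"
    and "(\<lambda>n. \<integral>\<omega>. euler_weight 1 (r n) 0 (r n) \<omega> * Q n \<omega> \<partial>\<mu>) \<longlonglongrightarrow> (\<integral>\<omega>. girsanov_density I \<omega> * Q' \<omega> \<partial>\<mu>)"
proof -
  note [measurable] = Qm
  have [measurable]: "girsanov_density I \<in> borel_measurable \<mu>"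
    using I by (intro girsanov_density_measurable) (simp add: ito_integral_def)
  have [measurable]: "euler_weight 1 n 0 n \<in> borel_measurable \<mu>" for n
    by (rule filtration_measurable[OF euler_weight_measurable[OF order_refl order_refl]])
  have 1: "AE \<omega> in \<mu>. (\<lambda>n. euler_weight 1 (r n) 0 (r n) \<omega> * Q n \<omega>) \<longlonglongrightarrow> girsanov_density I \<omega> * Q' \<omega>"
    using r Q by eventually_elim (rule tendsto_mult)
  have 2: "(\<integral>\<^sup>+\<omega>. ennreal ((euler_weight 1 (r n) 0 (r n) \<omega> * Q n \<omega>)\<^sup>2) \<partial>\<mu>) \<le> ennreal (exp (M\<^sup>2) * C\<^sup>2)" for n
  proof -
    have "(\<integral>\<^sup>+\<omega>. ennreal ((euler_weight 1 (r n) 0 (r n) \<omega> * Q n \<omega>)\<^sup>2) \<partial>\<mu>)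
      \<le> (\<integral>\<^sup>+\<omega>. ennreal ((euler_weight 1 (r n) 0 (r n) \<omega>)\<^sup>2) * ennreal (C\<^sup>2) \<partial>\<mu>)"
    proof (rule nn_integral_mono)
      fix \<omega> assume "\<omega> \<in> space \<mu>"
      then have "(Q n \<omega>)\<^sup>2 \<le> C\<^sup>2" using power_mono[OF Qb[of \<omega> n], of 2] by simp
      then show "ennreal ((euler_weight 1 (r n) 0 (r n) \<omega> * Q n \<omega>)\<^sup>2)
          \<le> ennreal ((euler_weight 1 (r n) 0 (r n) \<omega>)\<^sup>2) * ennreal (C\<^sup>2)"
        unfolding ennreal_mult'[OF zero_le_power2, symmetric] power_mult_distrib
        by (intro ennreal_leI mult_left_mono) auto
    qed
    also have "\<dots> = (\<integral>\<^sup>+\<omega>. ennreal ((euler_weight 1 (r n) 0 (r n) \<omega>)\<^sup>2) \<partial>\<mu>) * ennreal (C\<^sup>2)"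
      by (rule nn_integral_multc) measurable
    also have "\<dots> \<le> ennreal (exp (M\<^sup>2)) * ennreal (C\<^sup>2)"
      by (intro mult_right_mono euler_weight_square_bound) simp
    finally show ?thesis by (simp add: ennreal_mult)
  qed
  note L = L2_bounded_convergence[OF _ _ 1 2]
  show "integrable \<mu> (\<lambda>\<omega>. girsanov_density I \<omega> * Q' \<omega>)" by (rule L(1)) auto
  show "(\<lambda>n. \<integral>\<omega>. euler_weight 1 (r n) 0 (r n) \<omega> * Q n \<omega> \<partial>\<mu>) \<longlonglongrightarrow> (\<integral>\<omega>. girsanov_density I \<omega> * Q' \<omega> \<partial>\<mu>)"
    by (rule L(2)) auto
qed

lemma girsanov_density_integral:
  assumes I: "ito_integral \<mu> (\<lambda>t \<omega>. v t (\<omega> t)) I"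
  shows "integrable \<mu> (girsanov_density I)" "(\<integral>\<omega>. girsanov_density I \<omega> \<partial>\<mu>) = 1"
proof -
  obtain r where r: "strict_mono r" "AE \<omega> in \<mu>. (\<lambda>n. euler_weight 1 (r n) 0 (r n) \<omega>) \<longlonglongrightarrow> girsanov_density I \<omega>"
    by (rule euler_weight_tendsto_girsanov[OF I])
  note L = girsanov_limit[OF I r(2), where Q = "\<lambda>_ _. 1" and Q' = "\<lambda>_. 1" and C = 1, simplified]
  show "integrable \<mu> (girsanov_density I)" by (rule L(1))
  have "(\<lambda>n::nat. 1) \<longlonglongrightarrow> (\<integral>\<omega>. girsanov_density I \<omega> \<partial>\<mu>)"
    using L(2) unfolding euler_weight_mean(2)[OF order_refl] .
  from LIMSEQ_unique[OF this tendsto_const] show "(\<integral>\<omega>. girsanov_density I \<omega> \<partial>\<mu>) = 1" .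
qed

end


section \<open>Second-order Taylor expansion\<close>

text \<open>A function of class \<open>C\<^sup>1\<^sup>,\<^sup>2\<close> with its derivatives as parameters, so that they can be given by
  explicit formulas; \<open>DD i j\<close> is the derivative of \<open>D i\<close> in direction \<open>j\<close>.\<close>

locale test_function =
  fixes f ft :: "real \<Rightarrow> real ^ 3 \<Rightarrow> real" and D :: "3 \<Rightarrow> real \<Rightarrow> real ^ 3 \<Rightarrow> real"
    and DD :: "3 \<Rightarrow> 3 \<Rightarrow> real \<Rightarrow> real ^ 3 \<Rightarrow> real"
  assumes f_time: "t \<in> {0..1} \<Longrightarrow> ((\<lambda>s. f s x) has_real_derivative ft t x) (at t within {0..1})"
    and f_space: "t \<in> {0..1} \<Longrightarrow> (f t has_derivative (\<lambda>y. \<Sum>i\<in>UNIV. D i t x * y $ i)) (at x)"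
    and D_space: "t \<in> {0..1} \<Longrightarrow> (D i t has_derivative (\<lambda>y. \<Sum>j\<in>UNIV. DD i j t x * y $ j)) (at x)"
    and f_cont: "cont_strip f" and ft_cont: "cont_strip ft" and D_cont: "cont_strip (D i)"
    and DD_cont: "cont_strip (DD i j)"
begin

definition second_order :: "real \<Rightarrow> real ^ 3 \<Rightarrow> real \<Rightarrow> real ^ 3 \<Rightarrow> real" where
  "second_order t x h y = h * ft t x + (\<chi> i. D i t x) \<bullet> y + (\<Sum>i\<in>UNIV. \<Sum>j\<in>UNIV. DD i j t x * (y $ i * y $ j)) / 2"

lemma strip_uniformly_continuous:
  assumes "cont_strip (g :: real \<Rightarrow> real ^ 3 \<Rightarrow> real)" and e: "e > 0"
  shows "\<exists>d>0. \<forall>t\<in>{0..1}. \<forall>t'\<in>{0..1}. \<forall>x\<in>cball 0 r. \<forall>x'\<in>cball 0 r.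
     \<bar>t' - t\<bar> + norm (x' - x) < d \<longrightarrow> \<bar>g t' x' - g t x\<bar> < e"
proof -
  let ?K = "{0..1::real} \<times> cball (0 :: real ^ 3) r"
  have "uniformly_continuous_on ?K (\<lambda>(t, x). g t x)"
    using assms(1) unfolding cont_strip_def
    by (intro compact_uniformly_continuous compact_Times) (auto elim: continuous_on_subset)
  then obtain d where d: "d > 0" "\<And>z z'. z \<in> ?K \<Longrightarrow> z' \<in> ?K \<Longrightarrow> dist z' z < d \<Longrightarrow>
      dist (case z' of (t, x) \<Rightarrow> g t x) (case z of (t, x) \<Rightarrow> g t x) < e"
    using e unfolding uniformly_continuous_on_def by blast
  show ?thesis
  proof (intro exI[of _ d] conjI ballI impI d(1))
    fix t t' :: real and x x' :: "real ^ 3"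
    assume *: "t \<in> {0..1}" "t' \<in> {0..1}" "x \<in> cball 0 r" "x' \<in> cball 0 r" "\<bar>t' - t\<bar> + norm (x' - x) < d"
    have "dist (t', x') (t, x) \<le> dist t' t + dist x' x"
      unfolding dist_Pair_Pair by (rule sqrt_sum_squares_le_sum) auto
    also have "\<dots> < d" using *(5) by (simp add: dist_norm)
    finally show "\<bar>g t' x' - g t x\<bar> < e"
      using d(2)[of "(t, x)" "(t', x')"] * by (simp add: dist_real_def)
  qed
qed

lemma strip_bounded:
  assumes "cont_strip (g :: real \<Rightarrow> real ^ 3 \<Rightarrow> real)"
  shows "\<exists>B. \<forall>t\<in>{0..1}. \<forall>x\<in>cball 0 r. \<bar>g t x\<bar> \<le> B"
proof -
  let ?K = "{0..1::real} \<times> cball (0 :: real ^ 3) r"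
  have "compact ((\<lambda>(t, x). g t x) ` ?K)"
    using assms unfolding cont_strip_def
    by (intro compact_continuous_image compact_Times) (auto elim: continuous_on_subset)
  from compact_imp_bounded[OF this] show ?thesis
    unfolding bounded_iff by fastforce
qed

lemma second_derivative_along_segment:
  assumes t: "t \<in> {0..1}"
  shows "\<exists>\<theta>\<in>{0<..<1}. f t (x + y) = f t x + (\<Sum>i\<in>UNIV. D i t x * y $ i)
    + (\<Sum>i\<in>UNIV. \<Sum>j\<in>UNIV. DD i j t (x + \<theta> *\<^sub>R y) * (y $ i * y $ j)) / 2"
proof -
  define g where "g r = f t (x + r *\<^sub>R y)" for r :: real
  define g1 where "g1 r = (\<Sum>i\<in>UNIV. D i t (x + r *\<^sub>R y) * y $ i)" for r :: real
  define g2 where "g2 r = (\<Sum>i\<in>UNIV. \<Sum>j\<in>UNIV. DD i j t (x + r *\<^sub>R y) * (y $ i * y $ j))" for r :: real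
  have line: "((\<lambda>r. x + r *\<^sub>R y) has_derivative (\<lambda>s. s *\<^sub>R y)) (at r)" for r :: real
    by (auto intro!: derivative_eq_intros)
  have d0: "(g has_real_derivative g1 r) (at r)" for r
  proof -
    have "(g has_derivative (\<lambda>s. \<Sum>i\<in>UNIV. D i t (x + r *\<^sub>R y) * (s *\<^sub>R y) $ i)) (at r)"
      unfolding g_def using has_derivative_compose[OF line f_space[OF t]] .
    moreover have "(\<lambda>s. \<Sum>i\<in>UNIV. D i t (x + r *\<^sub>R y) * (s *\<^sub>R y) $ i) = (*) (g1 r)"
      by (simp add: fun_eq_iff g1_def sum_distrib_right sum_distrib_left mult_ac)
    ultimately show ?thesis by (simp add: has_field_derivative_def)
  qed
  have d1: "(g1 has_real_derivative g2 r) (at r)" for r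
  proof -
    have "((\<lambda>r. D i t (x + r *\<^sub>R y)) has_derivative (\<lambda>s. \<Sum>j\<in>UNIV. DD i j t (x + r *\<^sub>R y) * (s *\<^sub>R y) $ j)) (at r)" for i
      using has_derivative_compose[OF line D_space[OF t]] .
    then have "(g1 has_derivative (\<lambda>s. \<Sum>i\<in>UNIV. (\<Sum>j\<in>UNIV. DD i j t (x + r *\<^sub>R y) * (s *\<^sub>R y) $ j) * y $ i)) (at r)"
      unfolding g1_def by (intro has_derivative_sum has_derivative_mult_left)
    moreover have "(\<lambda>s. \<Sum>i\<in>UNIV. (\<Sum>j\<in>UNIV. DD i j t (x + r *\<^sub>R y) * (s *\<^sub>R y) $ j) * y $ i) = (*) (g2 r)"
      by (simp add: fun_eq_iff g2_def sum_distrib_right sum_distrib_left mult_ac)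
    ultimately show ?thesis by (simp add: has_field_derivative_def)
  qed
  define diff where "diff m = (if m = 0 then g else if m = 1 then g1 else g2)" for m :: nat
  have "\<exists>\<theta>>0. \<theta> < 1 \<and> g 1 = (\<Sum>m<2. diff m 0 / fact m * 1 ^ m) + diff 2 \<theta> / fact 2 * 1 ^ 2"
  proof (rule Maclaurin)
    show "\<forall>m r. m < 2 \<and> 0 \<le> r \<and> r \<le> 1 \<longrightarrow> (diff m has_real_derivative diff (Suc m) r) (at r)"
      using d0 d1 by (auto simp: diff_def less_2_cases_iff)
  qed (auto simp: diff_def)
  then obtain \<theta> where "0 < \<theta>" "\<theta> < 1" "g 1 = g 0 + g1 0 + g2 \<theta> / 2"
    by (auto simp: diff_def numeral_2_eq_2)
  then show ?thesis unfolding g_def g1_def g2_def by (intro bexI[of _ \<theta>]) auto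
qed

text \<open>The remainder is controlled by the moduli of continuity of \<open>ft\<close> and \<open>DD\<close> on the ball of radius
  \<open>r + 1\<close>, which contains \<open>x + y\<close> for short increments \<open>y\<close>.\<close>

lemma taylor_estimate:
  assumes r: "0 \<le> r" and e: "e > 0"
  shows "\<exists>d>0. d \<le> 1 \<and> (\<forall>t h x y. t \<in> {0..1} \<longrightarrow> t + h \<in> {0..1} \<longrightarrow> 0 \<le> h \<longrightarrow> h < d \<longrightarrow> norm x \<le> r \<longrightarrow> norm y < d \<longrightarrow>
     \<bar>f (t + h) (x + y) - f t x - second_order t x h y\<bar> \<le> e * (h + (norm y)\<^sup>2))"
proof -
  obtain d0 where d0: "d0 > 0" "\<And>t t' x x'. t \<in> {0..1} \<Longrightarrow> t' \<in> {0..1} \<Longrightarrow> x \<in> cball 0 (r + 1) \<Longrightarrow> x' \<in> cball 0 (r + 1) \<Longrightarrow>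
     \<bar>t' - t\<bar> + norm (x' - x) < d0 \<Longrightarrow> \<bar>ft t' x' - ft t x\<bar> < e"
    using strip_uniformly_continuous[OF ft_cont e, of "r + 1"] by blast
  have "\<exists>d>0. \<forall>t\<in>{0..1}. \<forall>t'\<in>{0..1}. \<forall>x\<in>cball 0 (r + 1). \<forall>x'\<in>cball 0 (r + 1).
     \<bar>t' - t\<bar> + norm (x' - x) < d \<longrightarrow> \<bar>DD i j t' x' - DD i j t x\<bar> < e / 9" for i j
    by (rule strip_uniformly_continuous[OF DD_cont]) (use e in simp)
  then obtain dd where dd: "\<And>i j. dd i j > 0" "\<And>i j t t' x x'. t \<in> {0..1} \<Longrightarrow> t' \<in> {0..1} \<Longrightarrow> x \<in> cball 0 (r + 1) \<Longrightarrow> x' \<in> cball 0 (r + 1) \<Longrightarrow>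
     \<bar>t' - t\<bar> + norm (x' - x) < dd i j \<Longrightarrow> \<bar>DD i j t' x' - DD i j t x\<bar> < e / 9"
    by metis
  define d1 where "d1 = Min (range (\<lambda>(i, j). dd i j))"
  have d1: "d1 > 0" "\<And>i j. d1 \<le> dd i j"
    unfolding d1_def using dd(1) by (auto intro!: Min_le)
  define d where "d = min 1 (min (d0 / 2) d1)"
  show ?thesis
  proof (intro exI[of _ d] conjI allI impI)
    show "d > 0" "d \<le> 1" using d0(1) d1(1) by (auto simp: d_def)
    fix t h :: real and x y :: "real ^ 3"
    assume t: "t \<in> {0..1}" and th: "t + h \<in> {0..1}" and h: "0 \<le> h" "h < d" and x: "norm x \<le> r" and y: "norm y < d"
    have xy: "x + \<theta> *\<^sub>R y \<in> cball 0 (r + 1)" if "0 \<le> \<theta>" "\<theta> \<le> 1" for \<theta>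
    proof -
      have "norm (\<theta> *\<^sub>R y) \<le> norm y" using that by (simp add: mult_left_le_one_le)
      then show ?thesis using norm_triangle_ineq[of x "\<theta> *\<^sub>R y"] x y by (simp add: d_def)
    qed
    have xy1: "x + y \<in> cball 0 (r + 1)" and x0: "x \<in> cball 0 (r + 1)" using xy[of 1] xy[of 0] by auto
    have "\<exists>s\<in>{t..t+h}. f (t + h) (x + y) - f t (x + y) = ft s (x + y) * (t + h - t)"
    proof (rule mvt_very_simple)
      fix s assume s: "t \<le> s" "s \<le> t + h"
      have "((\<lambda>s. f s (x + y)) has_real_derivative ft s (x + y)) (at s within {t..t+h})"
        by (rule DERIV_subset[OF f_time]) (use s t th in auto)
      then show "((\<lambda>s. f s (x + y)) has_derivative (*) (ft s (x + y))) (at s within {t..t+h})"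
        by (simp add: has_field_derivative_def)
    qed (use h in simp)
    then obtain s where s: "s \<in> {t..t+h}" "f (t + h) (x + y) - f t (x + y) = ft s (x + y) * h" by auto
    have "\<bar>ft s (x + y) - ft t x\<bar> < e"
    proof (rule d0(2))
      show "\<bar>s - t\<bar> + norm (x + y - x) < d0" using s(1) h y by (simp add: d_def)
    qed (use t th s(1) xy1 x0 in auto)
    then have "\<bar>(ft s (x + y) - ft t x) * h\<bar> \<le> e * h"
      unfolding abs_mult using h by (intro mult_mono) auto
    then have A: "\<bar>f (t + h) (x + y) - f t (x + y) - h * ft t x\<bar> \<le> e * h"
      unfolding s(2) by (simp add: algebra_simps)
    obtain \<theta> where \<theta>: "0 < \<theta>" "\<theta> < 1" "f t (x + y) = f t x + (\<Sum>i\<in>UNIV. D i t x * y $ i)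
        + (\<Sum>i\<in>UNIV. \<Sum>j\<in>UNIV. DD i j t (x + \<theta> *\<^sub>R y) * (y $ i * y $ j)) / 2"
      using second_derivative_along_segment[OF t, of x y] by auto
    have "\<bar>(DD i j t (x + \<theta> *\<^sub>R y) - DD i j t x) * (y $ i * y $ j)\<bar> \<le> e / 9 * (norm y)\<^sup>2" for i j
    proof -
      have "norm (\<theta> *\<^sub>R y) \<le> norm y" using \<theta> by (simp add: mult_left_le_one_le)
      then have "\<bar>DD i j t (x + \<theta> *\<^sub>R y) - DD i j t x\<bar> < e / 9"
        using xy[of \<theta>] x0 t \<theta> y d1(2)[of i j] by (intro dd(2)) (auto simp: d_def)
      moreover have "\<bar>y $ i * y $ j\<bar> \<le> (norm y)\<^sup>2"
        unfolding abs_mult power2_eq_square using component_le_norm_cart by (intro mult_mono) auto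
      ultimately show ?thesis
        unfolding abs_mult[of "_ - _"] using e by (intro mult_mono) auto
    qed
    then have "\<bar>\<Sum>i\<in>UNIV. \<Sum>j\<in>UNIV. (DD i j t (x + \<theta> *\<^sub>R y) - DD i j t x) * (y $ i * y $ j)\<bar>
        \<le> (\<Sum>i\<in>(UNIV :: 3 set). \<Sum>j\<in>(UNIV :: 3 set). e / 9 * (norm y)\<^sup>2)"
      by (intro order_trans[OF sum_abs] sum_mono)
    also have "\<dots> = e * (norm y)\<^sup>2" by simp
    finally have B: "\<bar>\<Sum>i\<in>UNIV. \<Sum>j\<in>UNIV. (DD i j t (x + \<theta> *\<^sub>R y) - DD i j t x) * (y $ i * y $ j)\<bar> \<le> e * (norm y)\<^sup>2" .
    have "f (t + h) (x + y) - f t x - second_order t x h y =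
        (f (t + h) (x + y) - f t (x + y) - h * ft t x)
        + (\<Sum>i\<in>UNIV. \<Sum>j\<in>UNIV. (DD i j t (x + \<theta> *\<^sub>R y) - DD i j t x) * (y $ i * y $ j)) / 2"
      unfolding \<theta>(3) second_order_def
      by (simp add: inner_vec_def left_diff_distrib sum_subtractf diff_divide_distrib)
    then show "\<bar>f (t + h) (x + y) - f t x - second_order t x h y\<bar> \<le> e * (h + (norm y)\<^sup>2)"
      using A B e zero_le_power2[of "norm y"] by (simp add: distrib_left)
  qed
qed

text \<open>The function \<open>f\<close> may be unbounded. The cut-off leaves it unchanged in a neighbourhood of the ball of
  radius \<open>r\<close>, where short increments stay and the expansion is used, and makes the effect of large
  increments bounded.\<close>

definition truncated :: "real \<Rightarrow> real \<Rightarrow> real ^ 3 \<Rightarrow> real" where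
  "truncated r t x = f t x * indicat_real (cball 0 (r + 1)) x"

lemma truncated_eq: "norm x \<le> r + 1 \<Longrightarrow> truncated r t x = f t x"
  by (simp add: truncated_def)

text \<open>For increments of length at least \<open>d\<close> every term is bounded by a multiple of \<open>(|y| / d)\<^sup>4\<close>.\<close>

lemma truncated_estimate:
  assumes r: "0 \<le> r" and e: "e > 0"
  obtains d C where "d > 0" "C \<ge> 0"
    "\<And>t h x y. t \<in> {0..1} \<Longrightarrow> t + h \<in> {0..1} \<Longrightarrow> 0 \<le> h \<Longrightarrow> h < d \<Longrightarrow> norm x \<le> r \<Longrightarrow>
     \<bar>truncated r (t + h) (x + y) - f t x - second_order t x h y\<bar> \<le> e * (h + (norm y)\<^sup>2) + C * norm y ^ 4"
proof -
  obtain d where d: "d > 0" "d \<le> 1" "\<And>t h x y. t \<in> {0..1} \<Longrightarrow> t + h \<in> {0..1} \<Longrightarrow> 0 \<le> h \<Longrightarrow> h < d \<Longrightarrow> norm x \<le> r \<Longrightarrow> norm y < d \<Longrightarrow>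
     \<bar>f (t + h) (x + y) - f t x - second_order t x h y\<bar> \<le> e * (h + (norm y)\<^sup>2)"
    using taylor_estimate[OF r e] by blast
  obtain B0 where B0: "\<And>t x. t \<in> {0..1} \<Longrightarrow> x \<in> cball 0 (r + 1) \<Longrightarrow> \<bar>f t x\<bar> \<le> B0"
    using strip_bounded[OF f_cont, of "r + 1"] by blast
  obtain B1 where B1: "\<And>t x. t \<in> {0..1} \<Longrightarrow> x \<in> cball 0 (r + 1) \<Longrightarrow> \<bar>ft t x\<bar> \<le> B1"
    using strip_bounded[OF ft_cont, of "r + 1"] by blast
  obtain B2 where B2: "\<And>i t x. t \<in> {0..1} \<Longrightarrow> x \<in> cball 0 (r + 1) \<Longrightarrow> \<bar>D i t x\<bar> \<le> B2 i"
    using strip_bounded[OF D_cont, of "r + 1"] by metis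
  obtain B3 where B3: "\<And>i j t x. t \<in> {0..1} \<Longrightarrow> x \<in> cball 0 (r + 1) \<Longrightarrow> \<bar>DD i j t x\<bar> \<le> B3 i j"
    using strip_bounded[OF DD_cont, of "r + 1"] by metis
  define S where "S = 2 * B0 + B1 + (\<Sum>i\<in>UNIV. B2 i) + (\<Sum>i\<in>UNIV. \<Sum>j\<in>UNIV. B3 i j) / 2"
  have pos: "0 \<le> B0" "0 \<le> B1" "\<And>i. 0 \<le> B2 i" "\<And>i j. 0 \<le> B3 i j"
    using order_trans[OF abs_ge_zero B0[of 0 0]] order_trans[OF abs_ge_zero B1[of 0 0]]
      order_trans[OF abs_ge_zero B2[of 0 0]] order_trans[OF abs_ge_zero B3[of 0 0]] r by simp_all
  have S0: "0 \<le> S" unfolding S_def using pos by (intro add_nonneg_nonneg divide_nonneg_nonneg sum_nonneg mult_nonneg_nonneg) auto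
  show ?thesis
  proof (rule that[of d "S / d ^ 4"])
    show "d > 0" "S / d ^ 4 \<ge> 0" using d(1) S0 by auto
    fix t h :: real and x y :: "real ^ 3"
    assume t: "t \<in> {0..1}" and th: "t + h \<in> {0..1}" and h: "0 \<le> h" "h < d" and x: "norm x \<le> r"
    have x1: "x \<in> cball 0 (r + 1)" using x by simp
    show "\<bar>truncated r (t + h) (x + y) - f t x - second_order t x h y\<bar> \<le> e * (h + (norm y)\<^sup>2) + S / d ^ 4 * norm y ^ 4"
    proof (cases "norm y < d")
      case True
      have "norm (x + y) \<le> r + 1" using norm_triangle_ineq[of x y] x True d(2) by linarith
      then have "\<bar>truncated r (t + h) (x + y) - f t x - second_order t x h y\<bar> \<le> e * (h + (norm y)\<^sup>2)"
        using d(3)[OF t th h x True] by (simp add: truncated_eq)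
      moreover have "0 \<le> S / d ^ 4 * norm y ^ 4" using S0 d(1) by simp
      ultimately show ?thesis by linarith
    next
      case False
      define q where "q = norm y / d"
      have q: "1 \<le> q" and y: "norm y = d * q" using False d(1) by (auto simp: q_def)
      have yq: "norm y \<le> q ^ 4" "(norm y)\<^sup>2 \<le> q ^ 4"
      proof -
        have "norm y \<le> 1 * q" unfolding y using d q by (intro mult_right_mono) auto
        also have "1 * q \<le> q ^ 4" using q self_le_power[of q 4] by simp
        finally show "norm y \<le> q ^ 4" .
        have "(norm y)\<^sup>2 \<le> (1 * q)\<^sup>2" unfolding y using d q by (intro power_mono mult_right_mono) auto
        also have "\<dots> \<le> q ^ 4" using q by (simp add: power_increasing)
        finally show "(norm y)\<^sup>2 \<le> q ^ 4" .
      qed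
      have q4: "1 \<le> q ^ 4" using q by simp
      have t1: "\<bar>truncated r (t + h) (x + y)\<bar> \<le> B0 * q ^ 4"
      proof -
        have "\<bar>truncated r (t + h) (x + y)\<bar> \<le> B0"
          using B0[OF th, of "x + y"] pos(1) by (auto simp: truncated_def indicator_def)
        also have "\<dots> \<le> B0 * q ^ 4" using q4 pos(1) by (simp add: mult_le_cancel_left1)
        finally show ?thesis .
      qed
      have t2: "\<bar>f t x\<bar> \<le> B0 * q ^ 4"
        using order_trans[OF B0[OF t x1], of "B0 * q ^ 4"] q4 pos(1) by (simp add: mult_le_cancel_left1)
      have t3: "\<bar>h * ft t x\<bar> \<le> B1 * q ^ 4"
      proof -
        have "\<bar>h * ft t x\<bar> \<le> 1 * B1" unfolding abs_mult using B1[OF t x1] h d(2) by (intro mult_mono) auto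
        also have "\<dots> \<le> B1 * q ^ 4" using q4 pos(2) by (simp add: mult_le_cancel_left1)
        finally show ?thesis .
      qed
      have t4: "\<bar>(\<chi> i. D i t x) \<bullet> y\<bar> \<le> (\<Sum>i\<in>UNIV. B2 i) * q ^ 4"
      proof -
        have "\<bar>D i t x * y $ i\<bar> \<le> B2 i * q ^ 4" for i
          unfolding abs_mult using B2[OF t x1, of i] order_trans[OF component_le_norm_cart yq(1)] pos(3)
          by (intro mult_mono) auto
        then have "\<bar>\<Sum>i\<in>UNIV. D i t x * y $ i\<bar> \<le> (\<Sum>i\<in>UNIV. B2 i * q ^ 4)"
          by (intro order_trans[OF sum_abs] sum_mono)
        then show ?thesis by (simp add: inner_vec_def sum_distrib_right)
      qed
      have t5: "\<bar>\<Sum>i\<in>UNIV. \<Sum>j\<in>UNIV. DD i j t x * (y $ i * y $ j)\<bar> \<le> (\<Sum>i\<in>UNIV. \<Sum>j\<in>UNIV. B3 i j) * q ^ 4"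
      proof -
        have "\<bar>y $ i * y $ j\<bar> \<le> (norm y)\<^sup>2" for i j
          unfolding abs_mult power2_eq_square using component_le_norm_cart by (intro mult_mono) auto
        then have "\<bar>DD i j t x * (y $ i * y $ j)\<bar> \<le> B3 i j * q ^ 4" for i j
          unfolding abs_mult[of "DD i j t x"] using B3[OF t x1, of i j] order_trans[OF _ yq(2)] pos(4)
          by (intro mult_mono) auto
        then have "\<bar>\<Sum>i\<in>UNIV. \<Sum>j\<in>UNIV. DD i j t x * (y $ i * y $ j)\<bar> \<le> (\<Sum>i\<in>UNIV. \<Sum>j\<in>UNIV. B3 i j * q ^ 4)"
          by (intro order_trans[OF sum_abs] sum_mono)
        then show ?thesis by (simp add: sum_distrib_right)
      qed
      have "\<bar>truncated r (t + h) (x + y) - f t x - second_order t x h y\<bar> \<le> S * q ^ 4"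
        unfolding second_order_def S_def distrib_right
        using t1 t2 t3 t4 t5 by (simp add: abs_le_iff)
      also have "S * q ^ 4 = S / d ^ 4 * norm y ^ 4" by (simp add: q_def power_divide)
      finally show ?thesis using e h by (simp add: add_increasing)
    qed
  qed
qed

end


section \<open>Exit times and stopped grid sums\<close>

lemma grid_ceiling:
  assumes t: "t \<in> {0..1}"
  shows "nat \<lceil>t * real n\<rceil> \<le> n" "(\<lambda>n. real (nat \<lceil>t * real n\<rceil>) / real n) \<longlonglongrightarrow> t"
    "n > 0 \<Longrightarrow> t \<le> real (nat \<lceil>t * real n\<rceil>) / real n"
proof -
  have "t * real n \<le> 1 * real n" using t by (intro mult_right_mono) auto
  then show "nat \<lceil>t * real n\<rceil> \<le> n" by (simp add: nat_le_iff ceiling_le_iff)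
  have c: "real (nat \<lceil>t * real n\<rceil>) = real_of_int \<lceil>t * real n\<rceil>" for n using t by simp
  have b: "t \<le> real (nat \<lceil>t * real n\<rceil>) / real n" "real (nat \<lceil>t * real n\<rceil>) / real n \<le> t + 1 / real n" if "n > 0" for n
  proof -
    show "t \<le> real (nat \<lceil>t * real n\<rceil>) / real n"
      unfolding c using that by (simp add: le_divide_eq)
    have "real_of_int \<lceil>t * real n\<rceil> \<le> t * real n + 1" by linarith
    then show "real (nat \<lceil>t * real n\<rceil>) / real n \<le> t + 1 / real n"
      unfolding c using that by (simp add: field_simps)
  qed
  show "n > 0 \<Longrightarrow> t \<le> real (nat \<lceil>t * real n\<rceil>) / real n" by (rule b)
  have "(\<lambda>n. t + 1 / real n) \<longlonglongrightarrow> t + 0" by (intro tendsto_intros lim_1_over_n)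
  then have u: "(\<lambda>n. t + 1 / real n) \<longlonglongrightarrow> t" by simp
  show "(\<lambda>n. real (nat \<lceil>t * real n\<rceil>) / real n) \<longlonglongrightarrow> t"
    by (rule tendsto_sandwich[OF _ _ tendsto_const u]) (use b in \<open>auto simp: eventually_sequentially intro!: exI[of _ 1]\<close>)
qed

lemma grid_floor:
  assumes t: "t \<in> {0..1}"
  shows "nat \<lfloor>t * real n\<rfloor> \<le> n" "(\<lambda>n. real (nat \<lfloor>t * real n\<rfloor>) / real n) \<longlonglongrightarrow> t"
    "real (nat \<lfloor>t * real n\<rfloor>) / real n \<le> t"
proof -
  have "t * real n \<le> 1 * real n" using t by (intro mult_right_mono) auto
  then show "nat \<lfloor>t * real n\<rfloor> \<le> n" by (simp add: nat_le_iff) linarith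
  have c: "real (nat \<lfloor>t * real n\<rfloor>) = real_of_int \<lfloor>t * real n\<rfloor>" for n using t by simp
  have b: "real (nat \<lfloor>t * real n\<rfloor>) / real n \<le> t" "n > 0 \<Longrightarrow> t - 1 / real n \<le> real (nat \<lfloor>t * real n\<rfloor>) / real n" for n
  proof -
    show "real (nat \<lfloor>t * real n\<rfloor>) / real n \<le> t"
      unfolding c using t by (cases "n = 0") (auto simp: divide_le_eq)
    assume "n > 0"
    have "t * real n - 1 \<le> real_of_int \<lfloor>t * real n\<rfloor>" by linarith
    then have "(t * real n - 1) / real n \<le> real_of_int \<lfloor>t * real n\<rfloor> / real n" by (intro divide_right_mono) auto
    then show "t - 1 / real n \<le> real (nat \<lfloor>t * real n\<rfloor>) / real n"
      unfolding c using \<open>n > 0\<close> by (simp add: diff_divide_distrib)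
  qed
  show "real (nat \<lfloor>t * real n\<rfloor>) / real n \<le> t" by (rule b)
  have "(\<lambda>n. t - 1 / real n) \<longlonglongrightarrow> t - 0" by (intro tendsto_intros lim_1_over_n)
  then have u: "(\<lambda>n. t - 1 / real n) \<longlonglongrightarrow> t" by simp
  show "(\<lambda>n. real (nat \<lfloor>t * real n\<rfloor>) / real n) \<longlonglongrightarrow> t"
    by (rule tendsto_sandwich[OF _ _ u tendsto_const]) (use b in \<open>auto simp: eventually_sequentially intro!: exI[of _ 1]\<close>)
qed

text \<open>Exit from the closed ball, that is, entrance into an open set. Only then do the grid exit times
  converge for every path: a path that touches the sphere and returns may be missed by all grids.\<close>

definition exit_time :: "real \<Rightarrow> path \<Rightarrow> real" where
  "exit_time r \<omega> = Inf (insert 1 {t \<in> {0..1}. norm (\<omega> t) > r})"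

definition exit_index :: "real \<Rightarrow> nat \<Rightarrow> path \<Rightarrow> nat" where
  "exit_index r n \<omega> = (LEAST k. k \<ge> n \<or> norm (\<omega> (real k / real n)) > r)"

lemma exit_time_range: "exit_time r \<omega> \<in> {0..1}"
proof -
  have "bdd_below (insert 1 {t \<in> {0..1}. norm (\<omega> t) > r})" by (intro bdd_belowI[of _ 0]) auto
  then have "exit_time r \<omega> \<le> 1" unfolding exit_time_def by (intro cInf_lower) auto
  moreover have "0 \<le> exit_time r \<omega>" unfolding exit_time_def by (intro cInf_greatest) auto
  ultimately show ?thesis by simp
qed

lemma exit_time_le: "t \<in> {0..1} \<Longrightarrow> norm (\<omega> t) > r \<Longrightarrow> exit_time r \<omega> \<le> t"
  unfolding exit_time_def by (rule cInf_lower) (auto intro!: bdd_belowI[of _ 0])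

lemma exit_time_less_iff:
  assumes "t \<le> 1"
  shows "exit_time r \<omega> < t \<longleftrightarrow> (\<exists>s\<in>{0..1}. s < t \<and> norm (\<omega> s) > r)"
proof
  assume "exit_time r \<omega> < t"
  from cInf_lessD[OF _ this[unfolded exit_time_def]] assms
  show "\<exists>s\<in>{0..1}. s < t \<and> norm (\<omega> s) > r" by auto
next
  assume "\<exists>s\<in>{0..1}. s < t \<and> norm (\<omega> s) > r"
  then obtain s where "s \<in> {0..1}" "s < t" "norm (\<omega> s) > r" by blast
  then show "exit_time r \<omega> < t" using exit_time_le[of s r \<omega>] by simp
qed

lemma exit_time_mono:
  assumes "r \<le> r'"
  shows "exit_time r \<omega> \<le> exit_time r' \<omega>"
  unfolding exit_time_def by (rule cInf_superset_mono) (use assms in \<open>auto intro!: bdd_belowI[of _ 0]\<close>)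

lemma exit_time_eq_1:
  assumes "\<And>t. t \<in> {0..1} \<Longrightarrow> norm (\<omega> t) \<le> r"
  shows "exit_time r \<omega> = 1"
proof -
  have "{t \<in> {0..1}. norm (\<omega> t) > r} = {}" using assms by (auto simp: not_less)
  then show ?thesis by (simp only: exit_time_def cInf_singleton)
qed

lemma before_exit: "t \<in> {0..1} \<Longrightarrow> t < exit_time r \<omega> \<Longrightarrow> norm (\<omega> t) \<le> r"
  using exit_time_le[of t r \<omega>] by (meson not_le)

lemma until_exit:
  assumes w: "\<omega> \<in> paths" "norm (\<omega> 0) \<le> r" and t: "t \<in> {0..1}" "t \<le> exit_time r \<omega>"
  shows "norm (\<omega> t) \<le> r"
proof (cases "t = 0")
  case False
  have "continuous_on {0..1} (\<lambda>t. norm (\<omega> t))" using path_continuous[OF w(1)] by (intro continuous_intros)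
  moreover have "(\<lambda>n. t - t / real (Suc n)) \<longlonglongrightarrow> t - t * 0"
    using tendsto_diff[OF tendsto_const tendsto_mult[OF tendsto_const LIMSEQ_inverse_real_of_nat]] by (simp add: divide_inverse)
  then have "(\<lambda>n. t - t / real (Suc n)) \<longlonglongrightarrow> t" by simp
  moreover have r: "t - t / real (Suc n) \<in> {0..1}" "t - t / real (Suc n) < t" for n
  proof -
    have t0: "0 < t" using t(1) False by auto
    then have "t / real (Suc n) \<le> t / 1" by (intro divide_left_mono) auto
    moreover have "0 < t / real (Suc n)" using t0 by simp
    ultimately have "t / real (Suc n) \<le> t" "0 < t / real (Suc n)" by auto
    then show "t - t / real (Suc n) \<in> {0..1}" "t - t / real (Suc n) < t" using t by auto
  qed
  ultimately have "(\<lambda>n. norm (\<omega> (t - t / real (Suc n)))) \<longlonglongrightarrow> norm (\<omega> t)"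
    by (intro continuous_on_tendsto_compose[of "{0..1}" "\<lambda>t. norm (\<omega> t)"]) (use t in auto)
  then show ?thesis
  proof (rule LIMSEQ_le_const2)
    have "norm (\<omega> (t - t / real (Suc n))) \<le> r" for n
      using r[of n] t(2) by (intro before_exit) auto
    then show "\<exists>N. \<forall>n\<ge>N. norm (\<omega> (t - t / real (Suc n))) \<le> r" by blast
  qed
qed (use w in simp)

lemma exit_index_le: "exit_index r n \<omega> \<le> n"
  unfolding exit_index_def by (rule Least_le) simp

lemma exit_index_le': "norm (\<omega> (real k / real n)) > r \<Longrightarrow> exit_index r n \<omega> \<le> k"
  unfolding exit_index_def by (rule Least_le) simp

lemma exit_index_attained: "exit_index r n \<omega> < n \<Longrightarrow> norm (\<omega> (real (exit_index r n \<omega>) / real n)) > r"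
  using LeastI[of "\<lambda>k. k \<ge> n \<or> norm (\<omega> (real k / real n)) > r" n] unfolding exit_index_def by auto

lemma less_exit_index: "k < n \<Longrightarrow> k < exit_index r n \<omega> \<longleftrightarrow> (\<forall>j\<le>k. norm (\<omega> (real j / real n)) \<le> r)"
proof
  assume "k < n" "\<forall>j\<le>k. norm (\<omega> (real j / real n)) \<le> r"
  then show "k < exit_index r n \<omega>"
    using exit_index_attained[of r n \<omega>] by (metis not_le order_trans less_le_trans linorder_not_less)
next
  assume "k < exit_index r n \<omega>"
  then show "\<forall>j\<le>k. norm (\<omega> (real j / real n)) \<le> r"
    using exit_index_le'[of r \<omega> _ n] by (meson leD le_less_trans not_le)
qed

text \<open>The grid cannot detect the exit too early. It does not detect it much later either: a path
  that leaves the closed ball is outside of it at times arbitrarily soon after the exit time, and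
  then also at nearby grid times.\<close>

lemma exit_index_tendsto:
  assumes w: "\<omega> \<in> paths"
  shows "(\<lambda>n. real (exit_index r n \<omega>) / real n) \<longlonglongrightarrow> exit_time r \<omega>"
proof (rule order_tendstoI)
  have lower: "exit_time r \<omega> \<le> real (exit_index r n \<omega>) / real n" if "n > 0" for n
  proof (cases "exit_index r n \<omega> < n")
    case True
    then show ?thesis using exit_index_attained[OF True] that by (intro exit_time_le) auto
  next
    case False
    then have "exit_index r n \<omega> = n" using exit_index_le[of r n \<omega>] by simp
    then show ?thesis using exit_time_range[of r \<omega>] that by simp
  qed
  fix a assume "a < exit_time r \<omega>"
  then show "\<forall>\<^sub>F n in sequentially. a < real (exit_index r n \<omega>) / real n"
    unfolding eventually_sequentially using lower by (intro exI[of _ 1]) (auto intro: less_le_trans)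
next
  fix a assume a: "exit_time r \<omega> < a"
  show "\<forall>\<^sub>F n in sequentially. real (exit_index r n \<omega>) / real n < a"
  proof (cases "1 < a")
    case True
    have "real (exit_index r n \<omega>) / real n \<le> 1" for n
      using exit_index_le[of r n \<omega>] by (cases "n = 0") (simp_all add: divide_le_eq_1)
    then show ?thesis using True by (intro always_eventually) (auto intro: le_less_trans)
  next
    case False
    then obtain s where s: "s \<in> {0..1}" "s < a" "norm (\<omega> s) > r" using a exit_time_less_iff[of a r \<omega>] by auto
    have "continuous_on {0..1} (\<lambda>t. norm (\<omega> t))" using path_continuous[OF w] by (intro continuous_intros)
    from continuous_on_tendsto_compose[OF this grid_ceiling(2)[OF s(1)] s(1)]
    have "(\<lambda>n. norm (\<omega> (real (nat \<lceil>s * real n\<rceil>) / real n))) \<longlonglongrightarrow> norm (\<omega> s)"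
      using grid_time[OF grid_ceiling(1)[OF s(1)]] by (auto intro: always_eventually)
    from order_tendstoD(1)[OF this s(3)] order_tendstoD(2)[OF grid_ceiling(2)[OF s(1)] s(2)]
    show ?thesis
    proof eventually_elim
      case (elim n)
      have "exit_index r n \<omega> \<le> nat \<lceil>s * real n\<rceil>" by (rule exit_index_le') (rule elim(1))
      then have "real (exit_index r n \<omega>) / real n \<le> real (nat \<lceil>s * real n\<rceil>) / real n"
        by (intro divide_right_mono) auto
      then show ?case using elim(2) by simp
    qed
  qed
qed

locale drifted_test = drifted_paths \<mu> v M + test_function f ft D DD
  for \<mu> v M f ft D DD
begin

text \<open>The generator of Brownian motion with drift \<open>- v\<close>, applied to \<open>f\<close>.\<close>

definition generator :: "real \<Rightarrow> real ^ 3 \<Rightarrow> real" where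
  "generator t x = ft t x - (\<Sum>i\<in>UNIV. v t x $ i * D i t x) + (\<Sum>i\<in>UNIV. DD i i t x) / 2"

lemma generator_cont: "cont_strip generator"
  using ft_cont v_cont D_cont DD_cont unfolding cont_strip_def generator_def split_beta
  by (intro continuous_intros ballI) simp_all

definition process :: "real \<Rightarrow> path \<Rightarrow> real" where
  "process t \<omega> = f t (\<omega> t) - (LINT s:{0..t}|lborel. generator s (\<omega> s))"

definition grid_value :: "(real \<Rightarrow> real ^ 3 \<Rightarrow> real) \<Rightarrow> nat \<Rightarrow> nat \<Rightarrow> path \<Rightarrow> real" where
  "grid_value F n m \<omega> = F (real m / real n) (\<omega> (real m / real n))
     - (\<Sum>k<m. generator (real k / real n) (\<omega> (real k / real n)) / real n)"

definition alive :: "real \<Rightarrow> nat \<Rightarrow> nat \<Rightarrow> path \<Rightarrow> real" where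
  "alive r n k \<omega> = (if \<forall>j\<le>k. norm (\<omega> (real j / real n)) \<le> r then 1 else 0)"

text \<open>The new value is taken of a function \<open>F\<close> in place of \<open>f\<close>: the truncation serves for estimates, \<open>f\<close>
  itself for measurability of the limit on all paths.\<close>

definition grid_defect :: "(real \<Rightarrow> real ^ 3 \<Rightarrow> real) \<Rightarrow> nat \<Rightarrow> nat \<Rightarrow> path \<Rightarrow> real" where
  "grid_defect F n k \<omega> = F (real (Suc k) / real n) (\<omega> (real (Suc k) / real n))
     - f (real k / real n) (\<omega> (real k / real n)) - generator (real k / real n) (\<omega> (real k / real n)) / real n"

text \<open>Before the exit index the path is in the ball, where \<open>F\<close> and \<open>f\<close> agree, and the sum telescopes.\<close>

lemma stopped_telescope:
  assumes ab: "a \<le> b" "b \<le> n" and F: "\<And>t x. norm x \<le> r \<Longrightarrow> F t x = f t x"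
  shows "(\<Sum>k\<in>{a..<b}. alive r n k \<omega> * grid_defect F n k \<omega>)
    = grid_value F n (min b (exit_index r n \<omega>)) \<omega> - grid_value F n (min a (exit_index r n \<omega>)) \<omega>"
proof -
  let ?K = "exit_index r n \<omega>"
  have "alive r n k \<omega> * grid_defect F n k \<omega>
      = (if k < ?K then grid_value F n (Suc k) \<omega> - grid_value F n k \<omega> else 0)" if "k < b" for k
  proof -
    have "k < n" using that ab by simp
    note iff = less_exit_index[OF this, of r \<omega>]
    show ?thesis
    proof (cases "k < ?K")
      case True
      then have "norm (\<omega> (real k / real n)) \<le> r" using iff by auto
      then show ?thesis using True iff F[of "\<omega> (real k / real n)"]
        by (simp add: alive_def grid_defect_def grid_value_def)
    next
      case False
      then have "alive r n k \<omega> = 0" using iff by (simp add: alive_def)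
      then show ?thesis using False by simp
    qed
  qed
  then have "(\<Sum>k\<in>{a..<b}. alive r n k \<omega> * grid_defect F n k \<omega>)
      = (\<Sum>k\<in>{a..<b}. if k < ?K then grid_value F n (Suc k) \<omega> - grid_value F n k \<omega> else 0)"
    by (intro sum.cong) auto
  also have "\<dots> = (\<Sum>k\<in>{a..<b} \<inter> {..<?K}. grid_value F n (Suc k) \<omega> - grid_value F n k \<omega>)"
    by (simp add: sum.inter_restrict lessThan_def)
  also have "{a..<b} \<inter> {..<?K} = {min a ?K..<min b ?K}" by auto
  also have "(\<Sum>k\<in>{min a ?K..<min b ?K}. grid_value F n (Suc k) \<omega> - grid_value F n k \<omega>)
      = grid_value F n (min b ?K) \<omega> - grid_value F n (min a ?K) \<omega>"
    by (rule sum_Suc_diff') (use ab in auto)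
  finally show ?thesis .
qed

lemma grid_value_tendsto:
  assumes w: "\<omega> \<in> paths" and m: "\<And>n. m n \<le> n" and r: "(\<lambda>n. real (m n) / real n) \<longlonglongrightarrow> \<rho>"
  shows "(\<lambda>n. grid_value f n (m n) \<omega>) \<longlonglongrightarrow> process \<rho> \<omega>"
    and "norm (\<omega> \<rho>) \<le> r \<Longrightarrow> (\<lambda>n. grid_value (truncated r) n (m n) \<omega>) \<longlonglongrightarrow> process \<rho> \<omega>"
proof -
  have in01: "real (m n) / real n \<in> {0..1}" for n using m[of n] by (auto simp: divide_le_eq_1)
  have \<rho>: "\<rho> \<in> {0..1}" using closed_sequentially[OF closed_real_atLeastAtMost _ r] in01 by blast
  have val: "(\<lambda>n. f (real (m n) / real n) (\<omega> (real (m n) / real n))) \<longlonglongrightarrow> f \<rho> (\<omega> \<rho>)"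
    by (rule continuous_on_tendsto_compose[OF cont_strip_path[OF f_cont w] r \<rho>]) (use in01 in auto)
  have int: "(\<lambda>n. \<Sum>k<m n. generator (real k / real n) (\<omega> (real k / real n)) / real n)
      \<longlonglongrightarrow> (LINT s:{0..\<rho>}|lborel. generator s (\<omega> s))"
    by (rule riemann_sum_tendsto[OF cont_strip_path[OF generator_cont w] m r])
  show "(\<lambda>n. grid_value f n (m n) \<omega>) \<longlonglongrightarrow> process \<rho> \<omega>"
    unfolding grid_value_def process_def by (intro tendsto_diff val int)
  assume nr: "norm (\<omega> \<rho>) \<le> r"
  have "continuous_on {0..1} (\<lambda>t. norm (\<omega> t))" using path_continuous[OF w] by (intro continuous_intros)
  from continuous_on_tendsto_compose[OF this r \<rho>]
  have "(\<lambda>n. norm (\<omega> (real (m n) / real n))) \<longlonglongrightarrow> norm (\<omega> \<rho>)" using in01 by auto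
  from order_tendstoD(2)[OF this, of "r + 1"] nr
  have "\<forall>\<^sub>F n in sequentially. f (real (m n) / real n) (\<omega> (real (m n) / real n))
      = truncated r (real (m n) / real n) (\<omega> (real (m n) / real n))"
    by (auto elim!: eventually_mono simp: truncated_eq)
  from Lim_transform_eventually[OF val this]
  show "(\<lambda>n. grid_value (truncated r) n (m n) \<omega>) \<longlonglongrightarrow> process \<rho> \<omega>"
    unfolding grid_value_def process_def by (intro tendsto_diff int)
qed

lemma slice_measurable:
  assumes "cont_strip (g :: real \<Rightarrow> real ^ 3 \<Rightarrow> real)" "s \<in> {0..1}"
  shows "g s \<in> borel_measurable borel"
  by (rule borel_measurable_continuous_onI[OF cont_strip_slice[OF assms]])

lemma truncated_measurable:
  assumes "s \<in> {0..1}"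
  shows "truncated r s \<in> borel_measurable borel"
proof -
  have [measurable]: "f s \<in> borel_measurable borel" by (rule slice_measurable[OF f_cont assms])
  show ?thesis unfolding truncated_def[abs_def]
    by (intro borel_measurable_times borel_measurable_indicator borel_closed closed_cball) simp
qed

lemma grid_slice_measurable:
  assumes g: "g (real k / real n) \<in> borel_measurable borel" and k: "k \<le> n" "real k / real n \<le> t"
  shows "(\<lambda>\<omega>. g (real k / real n) (\<omega> (real k / real n))) \<in> borel_measurable (natural_filtration t)"
  using measurable_compose[OF measurable_evaluation_filtration g] grid_time[OF k(1)] k(2) by blast

lemma alive_measurable:
  assumes "k \<le> n" "real k / real n \<le> t"
  shows "alive r n k \<in> borel_measurable (natural_filtration t)"
proof -
  have "{\<omega> \<in> space (natural_filtration t). \<forall>j\<in>{..k}. norm (\<omega> (real j / real n)) \<le> r} \<in> sets (natural_filtration t)"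
  proof (rule sets.sets_Collect_finite_All)
    fix j assume "j \<in> {..k}"
    then have "real j / real n \<le> t" "j \<le> n" using order_trans[OF grid_time_mono[of j k n] assms(2)] assms(1) by auto
    then have [measurable]: "(\<lambda>\<omega>. \<omega> (real j / real n)) \<in> borel_measurable (natural_filtration t)"
      using grid_time[of j n] by (intro measurable_evaluation_filtration) auto
    show "{\<omega> \<in> space (natural_filtration t). norm (\<omega> (real j / real n)) \<le> r} \<in> sets (natural_filtration t)"
      by measurable
  qed simp
  then have S: "{\<omega> \<in> space (natural_filtration t). \<forall>j\<le>k. norm (\<omega> (real j / real n)) \<le> r} \<in> sets (natural_filtration t)"
    by (simp only: Ball_def atMost_iff)
  show ?thesis
    unfolding alive_def[abs_def] by (rule measurable_If[OF _ _ S]) simp_all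
qed

lemma grid_defect_measurable:
  assumes F: "F (real (Suc k) / real n) \<in> borel_measurable borel" and k: "k < n" "real (Suc k) / real n \<le> t"
  shows "grid_defect F n k \<in> borel_measurable (natural_filtration t)"
proof -
  have kt: "real k / real n \<le> t" using order_trans[OF grid_time_mono[of k "Suc k" n] k(2)] by simp
  show ?thesis
    unfolding grid_defect_def[abs_def]
    by (intro borel_measurable_diff borel_measurable_divide borel_measurable_const grid_slice_measurable
        slice_measurable[OF f_cont] slice_measurable[OF generator_cont] F kt k grid_time)
      (use k in auto)
qed

end


section \<open>The stopped process under the weighted measure\<close>

lemma real_min_divide: "real (min a b) / real n = min (real a / real n) (real b / real n)"
  by (cases "n = 0") (auto simp: min_def divide_le_cancel)

context drifted_test
begin

text \<open>Half of \<open>e\<close> is spent on the Taylor remainder and half on the terms of order \<open>1 / n\<^sup>2\<close>, whose constants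
  are uniform in the step and in the point.\<close>

lemma one_step_estimate:
  assumes r: "0 \<le> r" and e: "e > 0"
  shows "\<exists>N>0. \<forall>n\<ge>N. \<forall>k<n. \<forall>x. norm x \<le> r \<longrightarrow>
    \<bar>\<integral>\<omega>. tilt (v (real k / real n) x) (1 / real n) (grid_step n k \<omega>) *
       (truncated r (real (Suc k) / real n) (x + grid_step n k \<omega>) - f (real k / real n) x
         - generator (real k / real n) x / real n) \<partial>\<mu>\<bar> \<le> e / real n"
proof -
  define e' where "e' = e / (2 * (4 + M\<^sup>2))"
  have M4: "0 < 4 + M\<^sup>2" by (simp add: add_pos_nonneg)
  have e': "e' > 0" "e' * (4 + M\<^sup>2) = e / 2" proof -
    show "e' > 0" unfolding e'_def using e M4 by (intro divide_pos_pos mult_pos_pos) auto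
    have "e / (2 * X) * X = e / 2" if "X > 0" for X :: real using that by simp
    from this[OF M4] show "e' * (4 + M\<^sup>2) = e / 2" unfolding e'_def .
  qed
  obtain d C where d: "d > 0" and C: "C \<ge> 0" and est:
    "\<And>t h x y. t \<in> {0..1} \<Longrightarrow> t + h \<in> {0..1} \<Longrightarrow> 0 \<le> h \<Longrightarrow> h < d \<Longrightarrow> norm x \<le> r \<Longrightarrow>
     \<bar>truncated r (t + h) (x + y) - f t x - second_order t x h y\<bar> \<le> e' * (h + (norm y)\<^sup>2) + C * norm y ^ 4"
    using truncated_estimate[OF r e'(1)] by metis
  obtain B where B: "\<And>i j t x. t \<in> {0..1} \<Longrightarrow> x \<in> cball 0 r \<Longrightarrow> \<bar>DD i j t x\<bar> \<le> B i j"
    using strip_bounded[OF DD_cont, of r] by metis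
  define K where "K = Max (range (\<lambda>(i, j). B i j))"
  have BK: "B i j \<le> K" for i j unfolding K_def by (rule Max_ge) auto
  define K' where "K' = 9 / 2 * K * M\<^sup>2 + 9 * C * (3 + 6 * M\<^sup>2 + M ^ 4)"
  obtain N :: nat where N: "max (1 / d) (max (2 * K' / e) 0) < real N" using reals_Archimedean2 by blast
  show ?thesis
  proof (intro exI[of _ N] conjI allI impI)
    show "0 < N" using N by simp
    fix n k x assume n: "n \<ge> N" and k: "k < n" and x: "norm (x :: real ^ 3) \<le> r"
    define s t h where "s = real k / real n" and "t = real (Suc k) / real n" and "h = 1 / real n"
    have st: "0 \<le> s" "s < t" "t \<le> 1" "h = t - s" using grid_lt[OF k] by (auto simp: s_def t_def h_def)
    have n0: "real N \<le> real n" "0 < real n" using n k by auto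
    have hd: "h < d" 
    proof -
      have "1 / d < real n" using N n0 by simp
      then show ?thesis unfolding h_def using n0 d by (simp add: field_simps)
    qed
    have hK: "K' * h \<le> e / 2"
    proof -
      have "2 * K' / e < real n" using N n0 by simp
      then have "2 * K' < real n * e" using e by (simp add: pos_divide_less_eq)
      then show ?thesis unfolding h_def using n0 by (simp add: field_simps)
    qed
    have h0: "0 < h" using st by simp
    have th: "t = s + h" using st by simp
    have s01: "s \<in> {0..1}" "s + h \<in> {0..1}" using st by auto
    have mt: "truncated r t \<in> borel_measurable borel" by (rule truncated_measurable) (use st in auto)
    have "\<bar>truncated r t (x + y) - f s x - (h * ft s x + (\<chi> i. D i s x) \<bullet> y
        + (\<Sum>i\<in>UNIV. \<Sum>j\<in>UNIV. DD i j s x * (y $ i * y $ j)) / 2)\<bar> \<le> e' * (h + (norm y)\<^sup>2) + C * norm y ^ 4" for y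
      using est[OF s01 _ hd x, of y] h0 unfolding second_order_def th by simp
    note approx = this
    have [measurable]: "truncated r t \<in> borel_measurable borel" by (rule mt)
    have \<phi>: "(\<lambda>y. truncated r t (x + y) - f s x) \<in> borel_measurable borel" by measurable
    have Q: "\<bar>DD i j s x\<bar> \<le> K" for i j using order_trans[OF B[OF s01(1), of x i j] BK] x by simp
    note T = tilted_quadratic_estimate[OF st \<phi> v_bound[OF s01(1), of x] Q less_imp_le[OF e'(1)] C approx]
    note int = T(1) and bound = T(2)[folded K'_def]
    note m1 = tilted_moments(1)[OF st, of "v s x"]
    have gen: "ft s x - v s x \<bullet> (\<chi> i. D i s x) + (\<Sum>i\<in>UNIV. DD i i s x) / 2 = generator s x"
      by (simp add: generator_def inner_vec_def)
    have "(\<integral>\<omega>. tilt (v s x) h (\<omega> t - \<omega> s) * (truncated r t (x + (\<omega> t - \<omega> s)) - f s x - generator s x / real n) \<partial>\<mu>)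
      = (\<integral>\<omega>. tilt (v s x) h (\<omega> t - \<omega> s) * (truncated r t (x + (\<omega> t - \<omega> s)) - f s x)
           - generator s x / real n * tilt (v s x) h (\<omega> t - \<omega> s) \<partial>\<mu>)"
      by (simp add: algebra_simps)
    also have "\<dots> = (\<integral>\<omega>. tilt (v s x) h (\<omega> t - \<omega> s) * (truncated r t (x + (\<omega> t - \<omega> s)) - f s x) \<partial>\<mu>) - h * generator s x"
      using int m1 by (simp add: has_bochner_integral_iff h_def)
    finally have eq: "(\<integral>\<omega>. tilt (v s x) h (\<omega> t - \<omega> s) * (truncated r t (x + (\<omega> t - \<omega> s)) - f s x - generator s x / real n) \<partial>\<mu>)
      = (\<integral>\<omega>. tilt (v s x) h (\<omega> t - \<omega> s) * (truncated r t (x + (\<omega> t - \<omega> s)) - f s x) \<partial>\<mu>) - h * generator s x" .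
    have "e' * (4 + M\<^sup>2) * h + K' * h\<^sup>2 = (e / 2 + K' * h) * h" unfolding e'(2) by (simp add: power2_eq_square algebra_simps)
    also have "\<dots> \<le> e * h" using hK h0 by (intro mult_right_mono) auto
    finally have fin: "e' * (4 + M\<^sup>2) * h + K' * h\<^sup>2 \<le> e / real n" by (simp add: h_def)
    show "\<bar>\<integral>\<omega>. tilt (v (real k / real n) x) (1 / real n) (grid_step n k \<omega>) *
       (truncated r (real (Suc k) / real n) (x + grid_step n k \<omega>) - f (real k / real n) x
         - generator (real k / real n) x / real n) \<partial>\<mu>\<bar> \<le> e / real n"
      unfolding grid_step_def s_def[symmetric] t_def[symmetric] h_def[symmetric] eq
      using order_trans[OF bound[unfolded gen] fin] .
  qed
qed

lemma local_bounds:
  obtains B0 Bg where "0 \<le> B0" "0 \<le> Bg" "\<forall>t\<in>{0..1}. \<forall>x. \<bar>truncated r t x\<bar> \<le> B0"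
    "\<forall>t\<in>{0..1}. \<forall>x\<in>cball 0 r. \<bar>f t x\<bar> \<le> B0" "\<forall>t\<in>{0..1}. \<forall>x\<in>cball 0 r. \<bar>generator t x\<bar> \<le> Bg"
proof -
  obtain B where B: "\<And>t x. t \<in> {0..1} \<Longrightarrow> x \<in> cball 0 (r + 1) \<Longrightarrow> \<bar>f t x\<bar> \<le> B"
    using strip_bounded[OF f_cont, of "r + 1"] by blast
  obtain G where G: "\<And>t x. t \<in> {0..1} \<Longrightarrow> x \<in> cball 0 r \<Longrightarrow> \<bar>generator t x\<bar> \<le> G"
  proof -
    have "\<exists>B. \<forall>t\<in>{0..1}. \<forall>x\<in>cball 0 r. \<bar>generator t x\<bar> \<le> B" by (rule strip_bounded[OF generator_cont])
    then show ?thesis using that by blast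
  qed
  show ?thesis
  proof (rule that[of "\<bar>B\<bar>" "\<bar>G\<bar>"])
    show "\<forall>t\<in>{0..1}. \<forall>x. \<bar>truncated r t x\<bar> \<le> \<bar>B\<bar>"
    proof (intro ballI allI)
      fix t x assume "t \<in> {0..1::real}"
      then show "\<bar>truncated r t x\<bar> \<le> \<bar>B\<bar>" using B[of t x] by (auto simp: truncated_def indicator_def)
    qed
    show "\<forall>t\<in>{0..1}. \<forall>x\<in>cball 0 r. \<bar>f t x\<bar> \<le> \<bar>B\<bar>"
    proof (intro ballI)
      fix t x assume "t \<in> {0..1::real}" "x \<in> cball (0 :: real ^ 3) r"
      then show "\<bar>f t x\<bar> \<le> \<bar>B\<bar>" using B[of t x] by simp
    qed
    show "\<forall>t\<in>{0..1}. \<forall>x\<in>cball 0 r. \<bar>generator t x\<bar> \<le> \<bar>G\<bar>"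
    proof (intro ballI)
      fix t x assume "t \<in> {0..1::real}" "x \<in> cball (0 :: real ^ 3) r"
      then show "\<bar>generator t x\<bar> \<le> \<bar>G\<bar>" using G[of t x] by simp
    qed
  qed auto
qed

lemma alive_defect_bound:
  obtains C where "0 \<le> C" "\<forall>n k \<omega>. k < n \<longrightarrow> \<bar>alive r n k \<omega> * grid_defect (truncated r) n k \<omega>\<bar> \<le> C"
proof -
  obtain B0 Bg where B: "0 \<le> B0" "0 \<le> Bg" "\<forall>t\<in>{0..1}. \<forall>x. \<bar>truncated r t x\<bar> \<le> B0"
    "\<forall>t\<in>{0..1}. \<forall>x\<in>cball 0 r. \<bar>f t x\<bar> \<le> B0" "\<forall>t\<in>{0..1}. \<forall>x\<in>cball 0 r. \<bar>generator t x\<bar> \<le> Bg"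
    by (rule local_bounds[of r])
  show ?thesis
  proof (rule that[of "2 * B0 + Bg"], safe)
    fix n k :: nat and \<omega> assume k: "k < n"
    show "\<bar>alive r n k \<omega> * grid_defect (truncated r) n k \<omega>\<bar> \<le> 2 * B0 + Bg"
    proof (cases "\<forall>j\<le>k. norm (\<omega> (real j / real n)) \<le> r")
      case True
      then have x': "\<omega> (real k / real n) \<in> cball 0 r" by simp
      have s: "real k / real n \<in> {0..1}" "real (Suc k) / real n \<in> {0..1}" using k by (auto intro!: grid_time simp del: of_nat_Suc)
      have "\<bar>generator (real k / real n) (\<omega> (real k / real n)) / real n\<bar> \<le> Bg / 1"
        unfolding abs_divide using B(2) B(5)[rule_format, OF s(1) x'] k by (intro frac_le) auto
      moreover have "alive r n k \<omega> = 1" using True by (simp add: alive_def)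
      ultimately show ?thesis
        using B(3)[rule_format, OF s(2), of "\<omega> (real (Suc k) / real n)"] B(4)[rule_format, OF s(1) x']
        unfolding grid_defect_def by (simp only: mult_1)
    next
      case False
      then have "alive r n k \<omega> = 0" by (simp add: alive_def)
      then show ?thesis using B(1,2) by simp
    qed
  qed (use B in simp)
qed

lemma grid_value_bound:
  obtains C where "0 \<le> C" "\<forall>n m \<omega>. m \<le> n \<longrightarrow> m \<le> exit_index r n \<omega> \<longrightarrow> \<bar>grid_value (truncated r) n m \<omega>\<bar> \<le> C"
proof -
  obtain B0 Bg where B: "0 \<le> B0" "0 \<le> Bg" "\<forall>t\<in>{0..1}. \<forall>x. \<bar>truncated r t x\<bar> \<le> B0"
    "\<forall>t\<in>{0..1}. \<forall>x\<in>cball 0 r. \<bar>f t x\<bar> \<le> B0" "\<forall>t\<in>{0..1}. \<forall>x\<in>cball 0 r. \<bar>generator t x\<bar> \<le> Bg"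
    by (rule local_bounds[of r])
  show ?thesis
  proof (rule that[of "B0 + Bg"], safe)
    fix n m :: nat and \<omega> assume m: "m \<le> n" and mK: "m \<le> exit_index r n \<omega>"
    have "\<bar>\<Sum>k<m. generator (real k / real n) (\<omega> (real k / real n)) / real n\<bar> \<le> (\<Sum>k<m. Bg / real n)"
    proof (intro order_trans[OF sum_abs] sum_mono)
      fix k assume "k \<in> {..<m}"
      then have kn: "k < n" and "k < exit_index r n \<omega>" using m mK by auto
      then have "\<omega> (real k / real n) \<in> cball 0 r" using less_exit_index[OF kn, of r \<omega>] by simp
      then show "\<bar>generator (real k / real n) (\<omega> (real k / real n)) / real n\<bar> \<le> Bg / real n"
        unfolding abs_divide using B(5)[rule_format, OF grid_time] kn by (intro divide_mono) auto
    qed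
    also have "\<dots> = Bg * (real m / real n)" by simp
    also have "\<dots> \<le> Bg * 1" using grid_time[OF m] B(2) by (intro mult_left_mono) auto
    finally show "\<bar>grid_value (truncated r) n m \<omega>\<bar> \<le> B0 + Bg"
      using B(3)[rule_format, OF grid_time[OF m], of "\<omega> (real m / real n)"] unfolding grid_value_def by simp
  qed (use B in simp)
qed

text \<open>The weights of the steps after \<open>k\<close> integrate to one. What is left is the factor of step \<open>k\<close> times a
  variable \<open>G\<close> of the past, and freezing the past turns the claim into the estimate for a single
  step.\<close>

lemma euler_term:
  assumes k: "k < n" and A: "A \<in> sets (natural_filtration (real k / real n))" and e: "0 \<le> e"
    and step: "\<And>x. norm x \<le> r \<Longrightarrow> \<bar>\<integral>\<omega>. tilt (v (real k / real n) x) (1 / real n) (grid_step n k \<omega>) *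
       (truncated r (real (Suc k) / real n) (x + grid_step n k \<omega>) - f (real k / real n) x
         - generator (real k / real n) x / real n) \<partial>\<mu>\<bar> \<le> e"
  shows "integrable \<mu> (\<lambda>\<omega>. euler_weight 1 n 0 n \<omega> * (indicat_real A \<omega> * (alive r n k \<omega> * grid_defect (truncated r) n k \<omega>)))"
    and "\<bar>\<integral>\<omega>. euler_weight 1 n 0 n \<omega> * (indicat_real A \<omega> * (alive r n k \<omega> * grid_defect (truncated r) n k \<omega>)) \<partial>\<mu>\<bar> \<le> e"
proof -
  define s t h where "s = real k / real n" and "t = real (Suc k) / real n" and "h = 1 / real n"
  have st: "0 \<le> s" "s < t" "t \<le> 1" "h = t - s" using grid_lt[OF k] by (auto simp: s_def t_def h_def)
  have s01: "s \<in> {0..1}" "t \<in> {0..1}" using st by auto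
  have A'[measurable]: "A \<in> sets (natural_filtration s)" using A by (simp add: s_def)
  have At: "A \<in> sets (natural_filtration t)" using A' sets_natural_filtration_mono[of s t] st by auto
  define X where "X \<omega> = indicat_real A \<omega> * (alive r n k \<omega> * grid_defect (truncated r) n k \<omega>)" for \<omega>
  define G where "G \<omega> = indicat_real A \<omega> * alive r n k \<omega> * euler_weight 1 n 0 k \<omega>" for \<omega>
  define ev where "ev \<omega> = \<omega> s" for \<omega> :: path
  have ev[measurable]: "ev \<in> borel_measurable (natural_filtration s)"
    unfolding ev_def[abs_def] using s01 by (intro measurable_evaluation_filtration) auto
  have al: "alive r n k \<in> borel_measurable (natural_filtration s)"
    by (rule alive_measurable) (use k in \<open>auto simp: s_def\<close>)
  have w: "euler_weight 1 n 0 k \<in> borel_measurable (natural_filtration s)"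
    by (rule euler_weight_measurable) (use k in \<open>auto simp: s_def\<close>)
  have G[measurable]: "G \<in> borel_measurable (natural_filtration s)"
    unfolding G_def[abs_def] using al w by (intro borel_measurable_times borel_measurable_indicator A') auto
  have wi: "integrable \<mu> (euler_weight 1 n 0 m)" "(\<integral>\<omega>. euler_weight 1 n 0 m \<omega> \<partial>\<mu>) = 1" if "m \<le> n" for m
    by (rule euler_weight_mean[OF that])+
  have Gi: "integrable \<mu> G" and G1: "(\<integral>\<omega>. \<bar>G \<omega>\<bar> \<partial>\<mu>) \<le> 1"
  proof -
    have le: "\<bar>G \<omega>\<bar> \<le> euler_weight 1 n 0 k \<omega>" for \<omega>
      using euler_weight_nonneg[of 1 n 0 k \<omega>] by (auto simp: G_def alive_def indicator_def)
    show i: "integrable \<mu> G"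
      using filtration_measurable[OF G] le
      by (intro Bochner_Integration.integrable_bound[OF wi(1)[of k]]) (use k in \<open>auto intro!: AE_I2 simp: euler_weight_nonneg\<close>)
    have "(\<integral>\<omega>. \<bar>G \<omega>\<bar> \<partial>\<mu>) \<le> (\<integral>\<omega>. euler_weight 1 n 0 k \<omega> \<partial>\<mu>)"
      using i wi(1)[of k] k le by (intro integral_mono) auto
    then show "(\<integral>\<omega>. \<bar>G \<omega>\<bar> \<partial>\<mu>) \<le> 1" using wi(2)[of k] k by simp
  qed
  have fs[measurable]: "f s \<in> borel_measurable borel" by (rule slice_measurable[OF f_cont s01(1)])
  have gs[measurable]: "generator s \<in> borel_measurable borel" by (rule slice_measurable[OF generator_cont s01(1)])
  have vs[measurable]: "v s \<in> borel_measurable borel" by (rule v_measurable[OF s01(1)])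
  have tt[measurable]: "truncated r t \<in> borel_measurable borel" by (rule truncated_measurable[OF s01(2)])
  \<comment> \<open>the first component is the past path, the second the increment of the step\<close>
  define F where "F z = G (fst z) * (tilt (v s (ev (fst z))) h (snd z) *
     (truncated r t (ev (fst z) + snd z) - f s (ev (fst z)) - generator s (ev (fst z)) / real n))" for z :: "path \<times> (real ^ 3)"
  have F[measurable]: "F \<in> borel_measurable (natural_filtration s \<Otimes>\<^sub>M borel)"
    unfolding F_def[abs_def] by measurable
  have FX: "F (\<omega>, \<omega> t - \<omega> s) = X \<omega> * euler_weight 1 n 0 (Suc k) \<omega>" for \<omega>
    by (simp add: F_def G_def X_def ev_def euler_weight_Suc grid_defect_def grid_drift_def grid_step_def s_def t_def h_def)
  have Xt: "X \<in> borel_measurable (natural_filtration t)"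
  proof -
    have "alive r n k \<in> borel_measurable (natural_filtration t)"
      by (rule measurable_natural_filtration_mono[OF al]) (use st in simp)
    moreover have "grid_defect (truncated r) n k \<in> borel_measurable (natural_filtration t)"
      by (rule grid_defect_measurable) (use k tt in \<open>auto simp: t_def\<close>)
    ultimately show ?thesis unfolding X_def[abs_def] using At
      by (intro borel_measurable_times borel_measurable_indicator)
  qed
  obtain C where C: "0 \<le> C" "\<And>n k \<omega>. k < n \<Longrightarrow> \<bar>alive r n k \<omega> * grid_defect (truncated r) n k \<omega>\<bar> \<le> C"
    using alive_defect_bound[of r] by blast
  have Xb: "\<bar>X \<omega>\<bar> \<le> C" for \<omega> using C(2)[OF k, of \<omega>] C(1) by (auto simp: X_def indicator_def)
  define Y where "Y \<omega> = X \<omega> * euler_weight 1 n 0 (Suc k) \<omega>" for \<omega>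
  have wt: "euler_weight 1 n 0 (Suc k) \<in> borel_measurable (natural_filtration t)"
    by (rule euler_weight_measurable) (use k in \<open>auto simp: t_def\<close>)
  have Ym: "Y \<in> borel_measurable (natural_filtration (real (Suc k) / real n))"
    unfolding Y_def[abs_def] using Xt wt unfolding t_def by (intro borel_measurable_times)
  have Yi: "integrable \<mu> Y"
  proof (rule Bochner_Integration.integrable_bound)
    show "integrable \<mu> (\<lambda>\<omega>. C * euler_weight 1 n 0 (Suc k) \<omega>)" using wi(1)[of "Suc k"] k by simp
    show "Y \<in> borel_measurable \<mu>" by (rule filtration_measurable[OF Ym])
    show "AE \<omega> in \<mu>. norm (Y \<omega>) \<le> norm (C * euler_weight 1 n 0 (Suc k) \<omega>)"
      unfolding Y_def using Xb C(1) by (intro AE_I2) (simp add: abs_mult euler_weight_nonneg mult_right_mono)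
  qed
  have Sk: "Suc k \<le> n" using k by simp
  have eq: "euler_weight 1 n 0 n \<omega> * X \<omega> = Y \<omega> * euler_weight 1 n (Suc k) n \<omega>" for \<omega>
    using euler_weight_split[of 0 "Suc k" n 1 n \<omega>] Sk by (simp add: Y_def)
  show "integrable \<mu> (\<lambda>\<omega>. euler_weight 1 n 0 n \<omega> * (indicat_real A \<omega> * (alive r n k \<omega> * grid_defect (truncated r) n k \<omega>)))"
    unfolding X_def[symmetric] eq by (rule euler_weight_integral[OF Sk order_refl Ym Yi])
  have "(\<integral>\<omega>. euler_weight 1 n 0 n \<omega> * X \<omega> \<partial>\<mu>) = (\<integral>\<omega>. Y \<omega> \<partial>\<mu>)"
    unfolding eq by (rule euler_weight_integral[OF Sk order_refl Ym Yi])
  also have "\<dots> = (\<integral>\<omega>. F (\<omega>, \<omega> t - \<omega> s) \<partial>\<mu>)" unfolding FX Y_def ..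
  also have "\<dots> = (\<integral>\<omega>. \<integral>\<omega>'. F (\<omega>, \<omega>' t - \<omega>' s) \<partial>\<mu> \<partial>\<mu>)"
    by (rule decoupling_integral[OF st(1-3) F]) (use Yi in \<open>simp add: FX Y_def[abs_def]\<close>)
  finally have main: "(\<integral>\<omega>. euler_weight 1 n 0 n \<omega> * X \<omega> \<partial>\<mu>) = (\<integral>\<omega>. \<integral>\<omega>'. F (\<omega>, \<omega>' t - \<omega>' s) \<partial>\<mu> \<partial>\<mu>)" .
  have inner: "\<bar>\<integral>\<omega>'. F (\<omega>, \<omega>' t - \<omega>' s) \<partial>\<mu>\<bar> \<le> e * \<bar>G \<omega>\<bar>" for \<omega>
  proof (cases "G \<omega> = 0")
    case False
    then have "norm (ev \<omega>) \<le> r" by (auto simp: G_def alive_def ev_def s_def split: if_splits)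
    from step[OF this]
    have "\<bar>\<integral>\<omega>'. tilt (v s (ev \<omega>)) h (\<omega>' t - \<omega>' s) *
       (truncated r t (ev \<omega> + (\<omega>' t - \<omega>' s)) - f s (ev \<omega>) - generator s (ev \<omega>) / real n) \<partial>\<mu>\<bar> \<le> e"
      unfolding s_def t_def h_def grid_step_def .
    then show ?thesis unfolding F_def fst_conv snd_conv integral_mult_right_zero abs_mult
      by (subst mult.commute) (rule mult_right_mono, auto)
  qed (simp add: F_def)
  have "\<bar>\<integral>\<omega>. \<integral>\<omega>'. F (\<omega>, \<omega>' t - \<omega>' s) \<partial>\<mu> \<partial>\<mu>\<bar> \<le> (\<integral>\<omega>. e * \<bar>G \<omega>\<bar> \<partial>\<mu>)"
  proof (cases "integrable \<mu> (\<lambda>\<omega>. \<integral>\<omega>'. F (\<omega>, \<omega>' t - \<omega>' s) \<partial>\<mu>)")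
    case True
    have "\<bar>\<integral>\<omega>. \<integral>\<omega>'. F (\<omega>, \<omega>' t - \<omega>' s) \<partial>\<mu> \<partial>\<mu>\<bar> \<le> (\<integral>\<omega>. \<bar>\<integral>\<omega>'. F (\<omega>, \<omega>' t - \<omega>' s) \<partial>\<mu>\<bar> \<partial>\<mu>)"
      by (rule integral_abs_bound)
    also have "\<dots> \<le> (\<integral>\<omega>. e * \<bar>G \<omega>\<bar> \<partial>\<mu>)"
      using True Gi by (intro integral_mono integrable_abs integrable_mult_right inner)
    finally show ?thesis .
  next
    case False
    then show ?thesis using e by (simp add: not_integrable_integral_eq)
  qed
  also have "\<dots> \<le> e * 1" using mult_left_mono[OF G1 e] by simp
  finally show "\<bar>\<integral>\<omega>. euler_weight 1 n 0 n \<omega> * (indicat_real A \<omega> * (alive r n k \<omega> * grid_defect (truncated r) n k \<omega>)) \<partial>\<mu>\<bar> \<le> e"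
    unfolding X_def[symmetric] main by simp
qed

lemma euler_sum:
  assumes r: "0 \<le> r" and e: "e > 0"
  shows "\<exists>N. \<forall>n\<ge>N. \<forall>a b s A. b \<le> n \<longrightarrow> s \<le> real a / real n \<longrightarrow> A \<in> sets (natural_filtration s) \<longrightarrow>
    \<bar>\<integral>\<omega>. euler_weight 1 n 0 n \<omega> * (indicat_real A \<omega> * (\<Sum>k\<in>{a..<b}. alive r n k \<omega> * grid_defect (truncated r) n k \<omega>)) \<partial>\<mu>\<bar> \<le> e"
proof -
  obtain N where N: "N > 0" "\<And>n k x. n \<ge> N \<Longrightarrow> k < n \<Longrightarrow> norm x \<le> r \<Longrightarrow>
    \<bar>\<integral>\<omega>. tilt (v (real k / real n) x) (1 / real n) (grid_step n k \<omega>) *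
       (truncated r (real (Suc k) / real n) (x + grid_step n k \<omega>) - f (real k / real n) x
         - generator (real k / real n) x / real n) \<partial>\<mu>\<bar> \<le> e / real n"
    using one_step_estimate[OF r e] by blast
  show ?thesis
  proof (intro exI[of _ N] allI impI)
    fix n a b :: nat and s A
    assume n: "n \<ge> N" and b: "b \<le> n" and s: "s \<le> real a / real n" and A: "A \<in> sets (natural_filtration s)"
    have T: "integrable \<mu> (\<lambda>\<omega>. euler_weight 1 n 0 n \<omega> * (indicat_real A \<omega> * (alive r n k \<omega> * grid_defect (truncated r) n k \<omega>)))"
      "\<bar>\<integral>\<omega>. euler_weight 1 n 0 n \<omega> * (indicat_real A \<omega> * (alive r n k \<omega> * grid_defect (truncated r) n k \<omega>)) \<partial>\<mu>\<bar> \<le> e / real n"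
      if k: "k \<in> {a..<b}" for k
    proof -
      have kn: "k < n" using k b by simp
      have "s \<le> real k / real n" using s grid_time_mono[of a k n] k by simp
      then have Ak: "A \<in> sets (natural_filtration (real k / real n))"
        using A sets_natural_filtration_mono by blast
      have e0: "0 \<le> e / real n" using e by simp
      note T = euler_term[OF kn Ak e0 N(2)[OF n kn]]
      show "integrable \<mu> (\<lambda>\<omega>. euler_weight 1 n 0 n \<omega> * (indicat_real A \<omega> * (alive r n k \<omega> * grid_defect (truncated r) n k \<omega>)))"
        by (rule T(1))
      show "\<bar>\<integral>\<omega>. euler_weight 1 n 0 n \<omega> * (indicat_real A \<omega> * (alive r n k \<omega> * grid_defect (truncated r) n k \<omega>)) \<partial>\<mu>\<bar> \<le> e / real n"
        by (rule T(2))
    qed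
    have "(\<integral>\<omega>. euler_weight 1 n 0 n \<omega> * (indicat_real A \<omega> * (\<Sum>k\<in>{a..<b}. alive r n k \<omega> * grid_defect (truncated r) n k \<omega>)) \<partial>\<mu>)
      = (\<Sum>k\<in>{a..<b}. \<integral>\<omega>. euler_weight 1 n 0 n \<omega> * (indicat_real A \<omega> * (alive r n k \<omega> * grid_defect (truncated r) n k \<omega>)) \<partial>\<mu>)"
      unfolding sum_distrib_left by (rule Bochner_Integration.integral_sum) (rule T(1))
    also have "\<bar>\<dots>\<bar> \<le> (\<Sum>k\<in>{a..<b}. e / real n)"
      by (rule order_trans[OF sum_abs sum_mono]) (rule T(2))
    also have "\<dots> = e * (real (b - a) / real n)" by simp
    also have "\<dots> \<le> e * 1" using grid_time[of "b - a" n] b e by (intro mult_left_mono) auto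
    finally show "\<bar>\<integral>\<omega>. euler_weight 1 n 0 n \<omega> * (indicat_real A \<omega> * (\<Sum>k\<in>{a..<b}. alive r n k \<omega> * grid_defect (truncated r) n k \<omega>)) \<partial>\<mu>\<bar> \<le> e"
      by simp
  qed
qed

abbreviation stopped :: "real \<Rightarrow> real \<Rightarrow> path \<Rightarrow> real" where
  "stopped r t \<omega> \<equiv> process (min t (exit_time r \<omega>)) \<omega>"

lemma stopped_index_tendsto:
  assumes w: "\<omega> \<in> paths" and m: "(\<lambda>n. real (m n) / real n) \<longlonglongrightarrow> t"
  shows "(\<lambda>n. real (min (m n) (exit_index r n \<omega>)) / real n) \<longlonglongrightarrow> min t (exit_time r \<omega>)"
  unfolding real_min_divide by (intro tendsto_min m exit_index_tendsto[OF w])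

lemma process_measurable:
  assumes t: "t \<in> {0..1}"
  shows "process t \<in> borel_measurable (natural_filtration t)"
proof (rule borel_measurable_LIMSEQ_metric)
  fix \<omega> assume "\<omega> \<in> space (natural_filtration t)"
  then show "(\<lambda>n. grid_value f n (nat \<lfloor>t * real n\<rfloor>) \<omega>) \<longlonglongrightarrow> process t \<omega>"
    by (intro grid_value_tendsto(1) grid_floor t) simp
next
  fix n
  define m where "m = nat \<lfloor>t * real n\<rfloor>"
  have m: "m \<le> n" "real m / real n \<le> t" using grid_floor[OF t] by (auto simp: m_def)
  have "grid_value f n m \<in> borel_measurable (natural_filtration t)"
    unfolding grid_value_def[abs_def]
  proof (intro borel_measurable_diff borel_measurable_sum borel_measurable_divide borel_measurable_const)
    show "(\<lambda>\<omega>. f (real m / real n) (\<omega> (real m / real n))) \<in> borel_measurable (natural_filtration t)"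
      by (intro grid_slice_measurable slice_measurable[OF f_cont] grid_time m)
    fix k assume "k \<in> {..<m}"
    then show "(\<lambda>\<omega>. generator (real k / real n) (\<omega> (real k / real n))) \<in> borel_measurable (natural_filtration t)"
      using m grid_time_mono[of k m n] by (intro grid_slice_measurable slice_measurable[OF generator_cont] grid_time) auto
  qed
  then show "grid_value f n (nat \<lfloor>t * real n\<rfloor>) \<in> borel_measurable (natural_filtration t)" by (simp add: m_def)
qed

text \<open>Stopped grid sums up to \<open>\<lfloor>t n\<rfloor>\<close> only use the path up to time \<open>t\<close>.\<close>

lemma stopped_measurable:
  assumes t: "t \<in> {0..1}"
  shows "stopped r t \<in> borel_measurable (natural_filtration t)"
proof (rule borel_measurable_LIMSEQ_metric)
  fix \<omega> assume "\<omega> \<in> space (natural_filtration t)"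
  then have w: "\<omega> \<in> paths" by simp
  have "(\<lambda>n. grid_value f n (min (nat \<lfloor>t * real n\<rfloor>) (exit_index r n \<omega>)) \<omega>) \<longlonglongrightarrow> stopped r t \<omega>"
    by (intro grid_value_tendsto(1) stopped_index_tendsto grid_floor t w) (use grid_floor(1)[OF t] in \<open>auto intro: min.coboundedI1\<close>)
  moreover have "grid_value f n (min (nat \<lfloor>t * real n\<rfloor>) (exit_index r n \<omega>)) \<omega>
      = (\<Sum>k\<in>{0..<nat \<lfloor>t * real n\<rfloor>}. alive r n k \<omega> * grid_defect f n k \<omega>) + grid_value f n 0 \<omega>" for n
    by (subst stopped_telescope) (use grid_floor(1)[OF t] in auto)
  ultimately show "(\<lambda>n. (\<Sum>k\<in>{0..<nat \<lfloor>t * real n\<rfloor>}. alive r n k \<omega> * grid_defect f n k \<omega>) + grid_value f n 0 \<omega>) \<longlonglongrightarrow> stopped r t \<omega>"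
    by simp
next
  fix n
  define m where "m = nat \<lfloor>t * real n\<rfloor>"
  have m: "m \<le> n" "real m / real n \<le> t" using grid_floor[OF t] by (auto simp: m_def)
  have "(\<lambda>\<omega>. (\<Sum>k\<in>{0..<m}. alive r n k \<omega> * grid_defect f n k \<omega>) + grid_value f n 0 \<omega>) \<in> borel_measurable (natural_filtration t)"
  proof (intro borel_measurable_add borel_measurable_sum borel_measurable_times)
    fix k assume "k \<in> {0..<m}"
    then have k: "k < n" "real (Suc k) / real n \<le> t" "real k / real n \<le> t"
      using m grid_time_mono[of "Suc k" m n] grid_time_mono[of k m n] by auto
    show "alive r n k \<in> borel_measurable (natural_filtration t)" by (rule alive_measurable) (use k in auto)
    show "grid_defect f n k \<in> borel_measurable (natural_filtration t)"
      by (rule grid_defect_measurable[OF slice_measurable[OF f_cont]]) (use k grid_time[of "Suc k" n] in auto)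
  next
    show "grid_value f n 0 \<in> borel_measurable (natural_filtration t)"
      unfolding grid_value_def[abs_def]
      by (simp, rule grid_slice_measurable[where k = 0 and n = 1, simplified]) (use slice_measurable[OF f_cont, of 0] t in auto)
  qed
  then show "(\<lambda>\<omega>. (\<Sum>k\<in>{0..<nat \<lfloor>t * real n\<rfloor>}. alive r n k \<omega> * grid_defect f n k \<omega>) + grid_value f n 0 \<omega>) \<in> borel_measurable (natural_filtration t)"
    by (simp add: m_def)
qed

text \<open>Both limits are taken along the subsequence of grids on which the weights converge: the stopped sums
  converge for every path starting at 0 and are bounded, and their weighted expectations vanish in
  the limit. Grid times are rounded up, so that the event of the past at time \<open>s\<close> precedes all
  steps.\<close>

lemma stopped_increment_orthogonal:
  assumes I: "ito_integral \<mu> (\<lambda>t \<omega>. v t (\<omega> t)) I" and r: "0 \<le> r"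
    and st: "s \<in> {0..1}" "t \<in> {0..1}" "s \<le> t" and A: "A \<in> sets (natural_filtration s)"
  shows "integrable \<mu> (\<lambda>\<omega>. girsanov_density I \<omega> * (indicat_real A \<omega> * (stopped r t \<omega> - stopped r s \<omega>)))"
    and "(\<integral>\<omega>. girsanov_density I \<omega> * (indicat_real A \<omega> * (stopped r t \<omega> - stopped r s \<omega>)) \<partial>\<mu>) = 0"
proof -
  obtain q where q: "strict_mono q" "AE \<omega> in \<mu>. (\<lambda>n. euler_weight 1 (q n) 0 (q n) \<omega>) \<longlonglongrightarrow> girsanov_density I \<omega>"
    by (rule euler_weight_tendsto_girsanov[OF I])
  define a b where "a n = nat \<lceil>s * real n\<rceil>" and "b n = nat \<lceil>t * real n\<rceil>" for n
  have an: "a n \<le> n" "a n \<le> b n" "b n \<le> n" "n > 0 \<Longrightarrow> s \<le> real (a n) / real n" for n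
  proof -
    have "s * real n \<le> t * real n" using st by (intro mult_right_mono) auto
    then show "a n \<le> b n" unfolding a_def b_def by (intro nat_mono ceiling_mono)
  qed (use grid_ceiling[OF st(1)] grid_ceiling[OF st(2)] in \<open>auto simp: a_def b_def\<close>)
  define Q where "Q n \<omega> = indicat_real A \<omega> * (\<Sum>k\<in>{a n..<b n}. alive r n k \<omega> * grid_defect (truncated r) n k \<omega>)" for n \<omega>
  have Q_eq: "Q n \<omega> = indicat_real A \<omega> * (grid_value (truncated r) n (min (b n) (exit_index r n \<omega>)) \<omega>
      - grid_value (truncated r) n (min (a n) (exit_index r n \<omega>)) \<omega>)" for n \<omega>
    unfolding Q_def by (subst stopped_telescope[OF an(2,3)]) (auto simp: truncated_eq)
  have A'[measurable]: "A \<in> sets \<mu>" by (rule filtration_subset_events[OF A])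
  have Qm: "Q n \<in> borel_measurable \<mu>" for n
    unfolding Q_def[abs_def]
  proof (intro borel_measurable_times borel_measurable_indicator borel_measurable_sum A')
    fix k assume "k \<in> {a n..<b n}"
    then have k: "k < n" using an(3)[of n] by simp
    show "alive r n k \<in> borel_measurable \<mu>"
      by (rule filtration_measurable[OF alive_measurable[OF _ order_refl]]) (use k in simp)
    show "grid_defect (truncated r) n k \<in> borel_measurable \<mu>"
      by (rule filtration_measurable, rule grid_defect_measurable[OF _ k order_refl], rule truncated_measurable, rule grid_time)
        (use k in simp)
  qed
  have Qm': "(\<lambda>\<omega>. indicat_real A \<omega> * (stopped r t \<omega> - stopped r s \<omega>)) \<in> borel_measurable \<mu>"
    by (intro borel_measurable_times borel_measurable_indicator borel_measurable_diff A'
        filtration_measurable[OF stopped_measurable] st)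
  obtain C where C: "0 \<le> C" "\<And>n m \<omega>. m \<le> n \<Longrightarrow> m \<le> exit_index r n \<omega> \<Longrightarrow> \<bar>grid_value (truncated r) n m \<omega>\<bar> \<le> C"
    using grid_value_bound[of r] by blast
  have Qb: "\<bar>Q n \<omega>\<bar> \<le> 2 * C" for n \<omega>
  proof -
    have "\<bar>grid_value (truncated r) n (min (b n) (exit_index r n \<omega>)) \<omega>\<bar> \<le> C"
      "\<bar>grid_value (truncated r) n (min (a n) (exit_index r n \<omega>)) \<omega>\<bar> \<le> C"
      using an by (auto intro!: C(2) intro: min.coboundedI1)
    then show ?thesis unfolding Q_eq using C(1) by (auto simp: indicator_def)
  qed
  have lim: "AE \<omega> in \<mu>. (\<lambda>n. Q (q n) \<omega>) \<longlonglongrightarrow> indicat_real A \<omega> * (stopped r t \<omega> - stopped r s \<omega>)"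
    using starts_at_zero AE_space
  proof eventually_elim
    case (elim \<omega>)
    then have w: "\<omega> \<in> paths" "norm (\<omega> 0) \<le> r" using r by auto
    have T: "exit_time r \<omega> \<in> {0..1}" by (rule exit_time_range)
    have V: "(\<lambda>n. grid_value (truncated r) n (min (m n) (exit_index r n \<omega>)) \<omega>) \<longlonglongrightarrow> stopped r u \<omega>"
      if u: "u \<in> {0..1}" and m: "\<And>n. m n \<le> n" "(\<lambda>n. real (m n) / real n) \<longlonglongrightarrow> u" for u m
    proof (rule grid_value_tendsto(2)[OF w(1)])
      show "min (m n) (exit_index r n \<omega>) \<le> n" for n using m(1)[of n] by (rule min.coboundedI1)
      show "(\<lambda>n. real (min (m n) (exit_index r n \<omega>)) / real n) \<longlonglongrightarrow> min u (exit_time r \<omega>)"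
        by (rule stopped_index_tendsto[OF w(1) m(2)])
      show "norm (\<omega> (min u (exit_time r \<omega>))) \<le> r" by (rule until_exit[OF w]) (use u T in auto)
    qed
    have "(\<lambda>n. Q n \<omega>) \<longlonglongrightarrow> indicat_real A \<omega> * (stopped r t \<omega> - stopped r s \<omega>)"
      unfolding Q_eq
      by (intro tendsto_intros V st) (use an grid_ceiling(2)[OF st(1)] grid_ceiling(2)[OF st(2)] in \<open>auto simp: a_def b_def\<close>)
    from LIMSEQ_subseq_LIMSEQ[OF this q(1)] show ?case by (simp add: o_def)
  qed
  note L = girsanov_limit[OF I q(2), of "\<lambda>n. Q (q n)", OF Qm Qm' Qb lim]
  show "integrable \<mu> (\<lambda>\<omega>. girsanov_density I \<omega> * (indicat_real A \<omega> * (stopped r t \<omega> - stopped r s \<omega>)))"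
    by (rule L(1))
  have "(\<lambda>n. \<integral>\<omega>. euler_weight 1 (q n) 0 (q n) \<omega> * Q (q n) \<omega> \<partial>\<mu>) \<longlonglongrightarrow> 0"
  proof (rule LIMSEQ_I)
    fix e :: real assume e: "e > 0"
    obtain N where N: "\<forall>n\<ge>N. \<forall>a b s A. b \<le> n \<longrightarrow> s \<le> real a / real n \<longrightarrow> A \<in> sets (natural_filtration s) \<longrightarrow>
      \<bar>\<integral>\<omega>. euler_weight 1 n 0 n \<omega> * (indicat_real A \<omega> * (\<Sum>k\<in>{a..<b}. alive r n k \<omega> * grid_defect (truncated r) n k \<omega>)) \<partial>\<mu>\<bar> \<le> e / 2"
      using euler_sum[OF r half_gt_zero[OF e]] by (rule exE)
    show "\<exists>no. \<forall>n\<ge>no. norm ((\<integral>\<omega>. euler_weight 1 (q n) 0 (q n) \<omega> * Q (q n) \<omega> \<partial>\<mu>) - 0) < e"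
    proof (intro exI[of _ "N + 1"] allI impI)
      fix n assume "n \<ge> N + 1"
      then have qn: "q n \<ge> N" "q n > 0" using seq_suble[OF q(1), of n] by auto
      have "\<bar>\<integral>\<omega>. euler_weight 1 (q n) 0 (q n) \<omega> * Q (q n) \<omega> \<partial>\<mu>\<bar> \<le> e / 2"
        unfolding Q_def by (rule N[rule_format, OF qn(1) an(3) an(4)[OF qn(2)] A])
      then show "norm ((\<integral>\<omega>. euler_weight 1 (q n) 0 (q n) \<omega> * Q (q n) \<omega> \<partial>\<mu>) - 0) < e" using e by simp
    qed
  qed
  from LIMSEQ_unique[OF L(2) this]
  show "(\<integral>\<omega>. girsanov_density I \<omega> * (indicat_real A \<omega> * (stopped r t \<omega> - stopped r s \<omega>)) \<partial>\<mu>) = 0" .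
qed

lemma stopped_bounded:
  assumes "0 \<le> r"
  obtains C where "0 \<le> C" "\<And>\<omega> t. \<omega> \<in> paths \<Longrightarrow> \<omega> 0 = 0 \<Longrightarrow> t \<in> {0..1} \<Longrightarrow> \<bar>stopped r t \<omega>\<bar> \<le> C"
proof -
  obtain C where C: "0 \<le> C" "\<And>n m \<omega>. m \<le> n \<Longrightarrow> m \<le> exit_index r n \<omega> \<Longrightarrow> \<bar>grid_value (truncated r) n m \<omega>\<bar> \<le> C"
    using grid_value_bound[of r] by blast
  show ?thesis
  proof (rule that[OF C(1)])
    fix \<omega> :: path and t :: real assume w: "\<omega> \<in> paths" and 0: "\<omega> 0 = 0" and t: "t \<in> {0..1}"
    have n: "norm (\<omega> (min t (exit_time r \<omega>))) \<le> r"
      by (rule until_exit) (use w 0 assms t exit_time_range[of r \<omega>] in auto)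
    have m: "min (nat \<lceil>t * real n\<rceil>) (exit_index r n \<omega>) \<le> n" for n
      using grid_ceiling(1)[OF t] by (rule min.coboundedI1)
    have "(\<lambda>n. grid_value (truncated r) n (min (nat \<lceil>t * real n\<rceil>) (exit_index r n \<omega>)) \<omega>) \<longlonglongrightarrow> stopped r t \<omega>"
      by (rule grid_value_tendsto(2)[OF w m stopped_index_tendsto[OF w grid_ceiling(2)[OF t]] n])
    from tendsto_rabs[OF this] show "\<bar>stopped r t \<omega>\<bar> \<le> C"
      by (rule LIMSEQ_le_const2) (use C(2)[OF m] in auto)
  qed
qed

end


section \<open>The usual augmentation and local martingales\<close>

text \<open>By continuity, a path that has left the closed ball before \<open>u\<close> is outside of it at some grid time
  before \<open>u\<close>.\<close>

lemma exit_time_less_measurable: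
  assumes u: "u \<le> 1"
  shows "{\<omega> \<in> paths. exit_time r \<omega> < u} \<in> sets (natural_filtration u)"
proof -
  define E where "E n k = (if k \<le> n \<and> real k / real n < u then {\<omega> \<in> paths. norm (\<omega> (real k / real n)) > r} else {})" for n k :: nat
  have "{\<omega> \<in> paths. exit_time r \<omega> < u} = (\<Union>n. \<Union>k. E n k)"
  proof (intro equalityI subsetI)
    fix \<omega> assume "\<omega> \<in> {\<omega> \<in> paths. exit_time r \<omega> < u}"
    then obtain s where w: "\<omega> \<in> paths" and s: "s \<in> {0..1}" "s < u" "norm (\<omega> s) > r"
      using exit_time_less_iff[OF u] by auto
    have "continuous_on {0..1} (\<lambda>t. norm (\<omega> t))" using path_continuous[OF w] by (intro continuous_intros)
    from continuous_on_tendsto_compose[OF this grid_floor(2)[OF s(1)] s(1)]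
    have "(\<lambda>n. norm (\<omega> (real (nat \<lfloor>s * real n\<rfloor>) / real n))) \<longlonglongrightarrow> norm (\<omega> s)"
      using grid_time[OF grid_floor(1)[OF s(1)]] by (auto intro: always_eventually)
    from eventually_happens[OF order_tendstoD(1)[OF this s(3)]]
    obtain n where n: "norm (\<omega> (real (nat \<lfloor>s * real n\<rfloor>) / real n)) > r" by auto
    have "real (nat \<lfloor>s * real n\<rfloor>) / real n < u" using grid_floor(3)[OF s(1), of n] s(2) by linarith
    then have "\<omega> \<in> E n (nat \<lfloor>s * real n\<rfloor>)" using n w grid_floor(1)[OF s(1), of n] by (simp add: E_def)
    then show "\<omega> \<in> (\<Union>n. \<Union>k. E n k)" by blast
  next
    fix \<omega> assume "\<omega> \<in> (\<Union>n. \<Union>k. E n k)"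
    then obtain n k where "\<omega> \<in> E n k" by blast
    then have "k \<le> n" "real k / real n < u" "\<omega> \<in> paths" "norm (\<omega> (real k / real n)) > r"
      by (auto simp: E_def split: if_splits)
    then show "\<omega> \<in> {\<omega> \<in> paths. exit_time r \<omega> < u}"
      using exit_time_less_iff[OF u, of r \<omega>] grid_time[of k n] by blast
  qed
  moreover have "E n k \<in> sets (natural_filtration u)" for n k
  proof (cases "k \<le> n \<and> real k / real n < u")
    case True
    then have [measurable]: "(\<lambda>\<omega>. \<omega> (real k / real n)) \<in> borel_measurable (natural_filtration u)"
      using grid_time[of k n] by (intro measurable_evaluation_filtration) auto
    have "{\<omega> \<in> space (natural_filtration u). norm (\<omega> (real k / real n)) > r} \<in> sets (natural_filtration u)"
      by measurable
    then show ?thesis using True by (simp add: E_def)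
  next
    case False
    then have "E n k = {}" unfolding E_def by (rule if_not_P)
    then show ?thesis by simp
  qed
  ultimately show ?thesis by (simp only:) (intro sets.countable_UN'' sets.countable_UN, auto)
qed

context
  fixes P :: "path measure"
  assumes P_prob: "prob_space P" and P_sets: "sets P = sets path_borel"
begin

definition augmented_sets :: "real \<Rightarrow> path set set" where
  "augmented_sets s = sigma_sets paths (sets (natural_filtration s) \<union> null_sets (completion P))"

lemma P_space: "space P = paths"
  using sets_eq_imp_space_eq[OF P_sets] by simp

lemma augmented_sets_subset: "augmented_sets s \<subseteq> sets (completion P)"
proof -
  have "sets (natural_filtration s) \<union> null_sets (completion P) \<subseteq> sets (completion P)"
    using sets_natural_filtration_path_borel[of s] sets_completionI_sets[of _ P] by (auto simp: P_sets)
  from sets.sigma_sets_subset[OF this] show ?thesis by (simp add: augmented_sets_def P_space)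
qed

lemma augmented_sets_Pow: "augmented_sets s \<subseteq> Pow paths"
  using augmented_sets_subset sets.sets_into_space[of _ "completion P"] by (fastforce simp: P_space)

lemma natural_subset_augmented: "s \<le> t \<Longrightarrow> sets (natural_filtration s) \<subseteq> augmented_sets t"
  unfolding augmented_sets_def using sets_natural_filtration_mono[of s t] by (auto intro: sigma_sets.Basic)

lemma space_usual_augmentation: "space (usual_augmentation P t) = paths"
  by (simp add: usual_augmentation_def space_measure_of_conv)

lemma sets_usual_augmentation:
  "sets (usual_augmentation P t) = sigma_sets paths (\<Inter>s\<in>{t<..}. augmented_sets s)"
  unfolding usual_augmentation_def augmented_sets_def[symmetric]
proof (rule sets_measure_of)
  show "(\<Inter>s\<in>{t<..}. augmented_sets s) \<subseteq> Pow paths"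
  proof
    fix A assume "A \<in> (\<Inter>s\<in>{t<..}. augmented_sets s)"
    then have "A \<in> augmented_sets (t + 1)" by auto
    then show "A \<in> Pow paths" using augmented_sets_Pow by blast
  qed
qed

lemma usual_augmentation_subset:
  assumes "t < s"
  shows "sets (usual_augmentation P t) \<subseteq> augmented_sets s"
proof -
  have "sigma_sets paths (\<Inter>s\<in>{t<..}. augmented_sets s) \<subseteq> sigma_sets paths (augmented_sets s)"
    using assms by (intro sigma_sets_mono') auto
  also have "\<dots> = augmented_sets s"
    unfolding augmented_sets_def
    by (rule sigma_sets_sigma_sets_eq) (use augmented_sets_Pow[of s] in \<open>auto simp: augmented_sets_def intro: sigma_sets.Basic\<close>)
  finally show ?thesis by (simp add: sets_usual_augmentation)
qed

lemma natural_subset_usual: "sets (natural_filtration t) \<subseteq> sets (usual_augmentation P t)"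
proof
  fix A assume A: "A \<in> sets (natural_filtration t)"
  have "A \<in> augmented_sets s" if "t < s" for s using natural_subset_augmented[of t s] A that by auto
  then show "A \<in> sets (usual_augmentation P t)"
    unfolding sets_usual_augmentation by (intro sigma_sets.Basic) auto
qed

lemma usual_augmentation_mono:
  "s \<le> t \<Longrightarrow> sets (usual_augmentation P s) \<subseteq> sets (usual_augmentation P t)"
  unfolding sets_usual_augmentation by (intro sigma_sets_mono' INT_anti_mono) auto

lemma measurable_usual_augmentation:
  "g \<in> borel_measurable (natural_filtration t) \<Longrightarrow> g \<in> borel_measurable (usual_augmentation P t)"
  using natural_subset_usual[of t] by (auto simp: measurable_def space_usual_augmentation)

lemma usual_augmentation_filtered: "filtered_prob_space (completion P) (usual_augmentation P)"
  unfolding filtered_prob_space_def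
proof (intro conjI allI)
  interpret P: prob_space P by (rule P_prob)
  show "prob_space (completion P)"
    by (rule prob_spaceI) (simp add: P.emeasure_space_1)
  show "filtration (space (completion P)) (usual_augmentation P)"
    by unfold_locales (use usual_augmentation_mono in \<open>auto simp: space_usual_augmentation P_space\<close>)
  show "subalgebra (completion P) (usual_augmentation P t)" for t
    unfolding subalgebra_def using usual_augmentation_subset[of t "t + 1"] augmented_sets_subset[of "t + 1"]
    by (auto simp: space_usual_augmentation P_space)
qed

text \<open>Null sets only blur the events of the natural filtration: agreement almost everywhere with an event
  of the natural filtration is inherited by complements and countable unions.\<close>

lemma augmented_set_approximation:
  assumes "A \<in> augmented_sets s"
  shows "\<exists>B\<in>sets (natural_filtration s). AE \<omega> in completion P. \<omega> \<in> A \<longleftrightarrow> \<omega> \<in> B"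
  using assms unfolding augmented_sets_def
proof (induction rule: sigma_sets.induct)
  case (Basic A)
  then consider "A \<in> sets (natural_filtration s)" | "A \<in> null_sets (completion P)" by blast
  then show ?case
  proof cases
    case 2
    from AE_not_in[OF this] have "AE \<omega> in completion P. \<omega> \<in> A \<longleftrightarrow> \<omega> \<in> {}" by eventually_elim simp
    then show ?thesis using sets.empty_sets by blast
  next
    case 1
    have "AE \<omega> in completion P. \<omega> \<in> A \<longleftrightarrow> \<omega> \<in> A" by simp
    with 1 show ?thesis by blast
  qed
next
  case Empty
  have "AE \<omega> in completion P. \<omega> \<in> {} \<longleftrightarrow> \<omega> \<in> {}" by simp
  then show ?case using sets.empty_sets by blast
next
  case (Compl A)
  then obtain B where B: "B \<in> sets (natural_filtration s)" "AE \<omega> in completion P. \<omega> \<in> A \<longleftrightarrow> \<omega> \<in> B" by blast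
  have "paths - B \<in> sets (natural_filtration s)" using sets.compl_sets[OF B(1)] by simp
  moreover have "AE \<omega> in completion P. \<omega> \<in> paths - A \<longleftrightarrow> \<omega> \<in> paths - B"
    using B(2) by eventually_elim auto
  ultimately show ?case by blast
next
  case (Union A)
  then have "\<forall>i. \<exists>B. B \<in> sets (natural_filtration s) \<and> (AE \<omega> in completion P. \<omega> \<in> A i \<longleftrightarrow> \<omega> \<in> B)" by blast
  from choice[OF this] obtain B where
    B': "\<forall>i. B i \<in> sets (natural_filtration s) \<and> (AE \<omega> in completion P. \<omega> \<in> A i \<longleftrightarrow> \<omega> \<in> B i)" by (rule exE)
  then have B: "\<And>i. B i \<in> sets (natural_filtration s)" "\<And>i. AE \<omega> in completion P. \<omega> \<in> A i \<longleftrightarrow> \<omega> \<in> B i" by simp_all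
  have "AE \<omega> in completion P. \<forall>i. \<omega> \<in> A i \<longleftrightarrow> \<omega> \<in> B i" using B(2) by (simp add: AE_all_countable)
  then have "AE \<omega> in completion P. \<omega> \<in> (\<Union>i. A i) \<longleftrightarrow> \<omega> \<in> (\<Union>i. B i)" by eventually_elim auto
  moreover have "(\<Union>i. B i) \<in> sets (natural_filtration s)" using B(1) by (intro sets.countable_UN) auto
  ultimately show ?case by blast
qed

text \<open>The event that the exit occurs no later than \<open>t\<close> is decided immediately after \<open>t\<close>, not at \<open>t\<close>; this
  is where right continuity of the filtration enters.\<close>

lemma exit_time_stopping_time: "stopping_time (usual_augmentation P) (exit_time r)"
  unfolding stopping_time_def
proof
  fix t :: real
  have "{\<omega> \<in> paths. exit_time r \<omega> \<le> t} \<in> sets (usual_augmentation P t)"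
  proof -
    consider "t < 0" | "1 \<le> t" | "0 \<le> t" "t < 1" by linarith
    then show ?thesis
    proof cases
      case 1
      have "{\<omega> \<in> paths. exit_time r \<omega> \<le> t} = {}"
      proof -
        have "\<not> exit_time r \<omega> \<le> t" for \<omega> using exit_time_range[of r \<omega>] 1 by auto
        then show ?thesis by blast
      qed
      then show ?thesis by (simp only: sets.empty_sets)
    next
      case 2
      have "{\<omega> \<in> paths. exit_time r \<omega> \<le> t} = space (usual_augmentation P t)"
      proof -
        have "exit_time r \<omega> \<le> t" for \<omega> using exit_time_range[of r \<omega>] 2 by auto
        then show ?thesis by (auto simp: space_usual_augmentation)
      qed
      then show ?thesis by (simp only: sets.top)
    next
      case 3
      have "{\<omega> \<in> paths. exit_time r \<omega> \<le> t} \<in> augmented_sets s" if s: "t < s" for s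
      proof -
        define u where "u m = t + (min s 1 - t) / real (Suc m)" for m
        have pos: "0 < min s 1 - t" using s 3 by auto
        have u: "t < u m" "u m \<le> min s 1" for m
        proof -
          show "t < u m" using pos by (simp add: u_def)
          have "(min s 1 - t) / real (Suc m) \<le> (min s 1 - t) / 1" using pos by (intro divide_left_mono) auto
          then have "(min s 1 - t) / real (Suc m) \<le> min s 1 - t" by (simp only: div_by_1)
          then show "u m \<le> min s 1" unfolding u_def by linarith
        qed
        have ut: "u \<longlonglongrightarrow> t"
          using tendsto_add[OF tendsto_const tendsto_mult[OF tendsto_const LIMSEQ_inverse_real_of_nat], of t "min s 1 - t"]
          by (simp add: u_def[abs_def] divide_inverse)
        have "{\<omega> \<in> paths. exit_time r \<omega> \<le> t} = (\<Inter>m. {\<omega> \<in> paths. exit_time r \<omega> < u m})"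
        proof (intro equalityI subsetI)
          fix \<omega> assume "\<omega> \<in> {\<omega> \<in> paths. exit_time r \<omega> \<le> t}"
          then show "\<omega> \<in> (\<Inter>m. {\<omega> \<in> paths. exit_time r \<omega> < u m})" using u(1) by (auto intro: le_less_trans)
        next
          fix \<omega> assume "\<omega> \<in> (\<Inter>m. {\<omega> \<in> paths. exit_time r \<omega> < u m})"
          then have "\<omega> \<in> paths" "\<And>m. exit_time r \<omega> \<le> u m" by (auto intro: less_imp_le)
          then show "\<omega> \<in> {\<omega> \<in> paths. exit_time r \<omega> \<le> t}" using LIMSEQ_le_const[OF ut, of "exit_time r \<omega>"] by auto
        qed
        also have "\<dots> \<in> sets (natural_filtration s)"
        proof -
          have "{\<omega> \<in> paths. exit_time r \<omega> < u m} \<in> sets (natural_filtration s)" for m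
          proof -
            have "{\<omega> \<in> paths. exit_time r \<omega> < u m} \<in> sets (natural_filtration (u m))"
              using u(2)[of m] by (intro exit_time_less_measurable) auto
            then show ?thesis using sets_natural_filtration_mono[of "u m" s] u(2)[of m] by auto
          qed
          then show ?thesis by (intro sets.countable_INT') auto
        qed
        finally show ?thesis using natural_subset_augmented[of s s] by auto
      qed
      then show ?thesis unfolding sets_usual_augmentation by (intro sigma_sets.Basic) auto
    qed
  qed
  then show "Measurable.pred (usual_augmentation P t) (\<lambda>\<omega>. exit_time r \<omega> \<le> t)"
    by (simp add: pred_def space_usual_augmentation)
qed

end

lemma continuous_imp_cadlag:
  fixes g :: "real \<Rightarrow> real"
  assumes g: "continuous_on {0..1} g"
  shows "cadlag_on 0 1 g"
  unfolding cadlag_on_def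
proof (intro conjI ballI)
  fix t :: real assume t: "t \<in> {0..<1}"
  then have "(g \<longlongrightarrow> g t) (at t within {0..1})" using g by (auto simp: continuous_on)
  then have "(g \<longlongrightarrow> g t) (at t within {t..1})" by (rule tendsto_within_subset) (use t in auto)
  then show "(g \<longlongrightarrow> g t) (at_right t)" using t by (simp add: at_within_Icc_at_right)
next
  fix t :: real assume t: "t \<in> {0<..1}"
  then have "(g \<longlongrightarrow> g t) (at t within {0..1})" using g by (auto simp: continuous_on)
  then have "(g \<longlongrightarrow> g t) (at t within {0..t})" by (rule tendsto_within_subset) (use t in auto)
  then show "\<exists>l. (g \<longlongrightarrow> l) (at_left t)" using t by (auto simp: at_within_Icc_at_left)
qed

context drifted_test
begin

lemma process_continuous:
  assumes w: "\<omega> \<in> paths"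
  shows "continuous_on {0..1} (\<lambda>t. process t \<omega>)"
proof -
  have c: "continuous_on {0..1} (\<lambda>s. generator s (\<omega> s))" by (rule cont_strip_path[OF generator_cont w])
  have eq: "(LINT s:{0..t}|lborel. generator s (\<omega> s)) = integral {0..t} (\<lambda>s. generator s (\<omega> s))" if "t \<in> {0..1}" for t
    using that by (intro set_borel_integral_eq_integral(2) borel_integrable_atLeastAtMost' continuous_on_subset[OF c]) auto
  have "continuous_on {0..1} (\<lambda>t. integral {0..t} (\<lambda>s. generator s (\<omega> s)))"
    by (intro indefinite_integral_continuous_1 integrable_continuous_real c)
  then have "continuous_on {0..1} (\<lambda>t. LINT s:{0..t}|lborel. generator s (\<omega> s))"
    by (rule continuous_on_eq) (rule eq[symmetric])
  then show ?thesis unfolding process_def by (intro continuous_intros cont_strip_path[OF f_cont w])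
qed

lemma stopped_continuous:
  assumes w: "\<omega> \<in> paths"
  shows "continuous_on {0..1} (\<lambda>t. stopped r t \<omega>)"
proof (rule continuous_on_compose2[OF process_continuous[OF w], where f = "\<lambda>t. min t (exit_time r \<omega>)"])
  show "continuous_on {0..1} (\<lambda>t. min t (exit_time r \<omega>))" by (intro continuous_intros)
  show "(\<lambda>t. min t (exit_time r \<omega>)) ` {0..1} \<subseteq> {0..1}" using exit_time_range[of r \<omega>] by auto
qed

lemma girsanov_density_pos: "0 < girsanov_density I \<omega>"
  by (simp add: girsanov_density_def)

text \<open>An event of the augmentation at time \<open>s\<close> agrees up to a null set with an event of the natural
  filtration at any later time \<open>u\<close>. So the stopped increments from \<open>u\<close> to \<open>t\<close> are orthogonal to it,
  and \<open>u\<close> decreases to \<open>s\<close>: the stopped paths are continuous and, almost surely, uniformly bounded.\<close>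

theorem process_local_martingale:
  assumes I: "ito_integral \<mu> (\<lambda>t \<omega>. v t (\<omega> t)) I"
    and P: "P = density \<mu> (\<lambda>\<omega>. ennreal (girsanov_density I \<omega>))"
  shows "local_martingale (completion P) (usual_augmentation P) process"
proof -
  have Zm[measurable]: "girsanov_density I \<in> borel_measurable \<mu>"
    using I by (intro girsanov_density_measurable) (simp add: ito_integral_def)
  have Z0: "0 \<le> girsanov_density I \<omega>" for \<omega> using girsanov_density_pos[of I \<omega>] by simp
  have P_sets: "sets P = sets path_borel" by (simp add: P sets_wiener)
  have P_space: "space P = paths" by (simp add: P)
  have P_prob: "prob_space P"
  proof (rule prob_spaceI)
    have "emeasure P (space P) = (\<integral>\<^sup>+\<omega>. ennreal (girsanov_density I \<omega>) \<partial>\<mu>)"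
      unfolding P using sets.top[of \<mu>] by (subst emeasure_density) (auto intro!: nn_integral_cong)
    also have "\<dots> = 1"
      using girsanov_density_integral[OF I] Z0 by (subst nn_integral_eq_integral) auto
    finally show "emeasure P (space P) = 1" .
  qed
  interpret P: prob_space P by (rule P_prob)
  note aug = usual_augmentation_filtered[OF P_prob P_sets]
  let ?C = "completion P" and ?F = "usual_augmentation P"
  interpret C: prob_space ?C using aug by (simp add: filtered_prob_space_def)
  have AE0: "AE \<omega> in P. \<omega> 0 = 0" unfolding P
    by (subst AE_density) (use starts_at_zero in auto)
  have meas: "g \<in> borel_measurable P" if "g \<in> borel_measurable (natural_filtration t)" for g :: "path \<Rightarrow> real" and t
    using filtration_measurable[OF that] by (simp add: P)
  have stopped_P: "stopped r t \<in> borel_measurable P" if "t \<in> {0..1}" for r t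
    by (rule meas[OF stopped_measurable[OF that]])
  have mart: "martingale ?C ?F (stopped r)" if r: "0 \<le> r" for r
  proof -
    obtain K where K: "0 \<le> K" "\<And>\<omega> t. \<omega> \<in> paths \<Longrightarrow> \<omega> 0 = 0 \<Longrightarrow> t \<in> {0..1} \<Longrightarrow> \<bar>stopped r t \<omega>\<bar> \<le> K"
      by (rule stopped_bounded[OF r]) blast
    have bd: "AE \<omega> in P. \<forall>t\<in>{0..1}. \<bar>stopped r t \<omega>\<bar> \<le> K"
      using AE0 AE_space by eventually_elim (use K(2) P_space in auto)
    then have bdC: "AE \<omega> in ?C. \<forall>t\<in>{0..1}. \<bar>stopped r t \<omega>\<bar> \<le> K" by (rule AE_completion)
    have stopped_C: "stopped r t \<in> borel_measurable ?C" if "t \<in> {0..1}" for t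
      by (rule measurable_completion[OF stopped_P[OF that]])
    have int: "integrable ?C (stopped r t)" if t: "t \<in> {0..1}" for t
      using bdC t by (intro C.integrable_const_bound[OF _ stopped_C]) (auto elim!: eventually_mono)
    have orth: "(\<integral>\<omega>. indicat_real A \<omega> * (stopped r t \<omega> - stopped r s \<omega>) \<partial>?C) = 0"
      if st: "s \<in> {0..1}" "t \<in> {0..1}" "s \<le> t" and A: "A \<in> augmented_sets P s" for s t A
    proof -
      obtain B where B: "B \<in> sets (natural_filtration s)" "AE \<omega> in ?C. \<omega> \<in> A \<longleftrightarrow> \<omega> \<in> B"
        using augmented_set_approximation[OF P_prob P_sets A] by blast
      have As: "A \<in> sets ?C" using A augmented_sets_subset[OF P_prob P_sets] by blast
      have Bs: "B \<in> sets P" using B(1) sets_natural_filtration_path_borel P_sets by blast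
      have m: "(\<lambda>\<omega>. indicat_real B \<omega> * (stopped r t \<omega> - stopped r s \<omega>)) \<in> borel_measurable P"
        by (intro borel_measurable_times borel_measurable_indicator borel_measurable_diff Bs stopped_P st)
      have "(\<integral>\<omega>. indicat_real A \<omega> * (stopped r t \<omega> - stopped r s \<omega>) \<partial>?C)
          = (\<integral>\<omega>. indicat_real B \<omega> * (stopped r t \<omega> - stopped r s \<omega>) \<partial>?C)"
      proof (rule integral_cong_AE)
        show "(\<lambda>\<omega>. indicat_real A \<omega> * (stopped r t \<omega> - stopped r s \<omega>)) \<in> borel_measurable ?C"
          by (intro borel_measurable_times borel_measurable_indicator borel_measurable_diff As stopped_C st)
        show "(\<lambda>\<omega>. indicat_real B \<omega> * (stopped r t \<omega> - stopped r s \<omega>)) \<in> borel_measurable ?C"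
          by (rule measurable_completion[OF m])
        show "AE \<omega> in ?C. indicat_real A \<omega> * (stopped r t \<omega> - stopped r s \<omega>) = indicat_real B \<omega> * (stopped r t \<omega> - stopped r s \<omega>)"
          using B(2) by eventually_elim (simp add: indicator_def)
      qed
      also have "\<dots> = (\<integral>\<omega>. indicat_real B \<omega> * (stopped r t \<omega> - stopped r s \<omega>) \<partial>P)"
        by (rule integral_completion[OF m])
      also have "\<dots> = (\<integral>\<omega>. girsanov_density I \<omega> * (indicat_real B \<omega> * (stopped r t \<omega> - stopped r s \<omega>)) \<partial>\<mu>)"
        unfolding P by (subst integral_real_density) (use m Z0 in \<open>auto simp: P\<close>)
      also have "\<dots> = 0" by (rule stopped_increment_orthogonal(2)[OF I r st B(1)])
      finally show ?thesis .
    qed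
    have charact: "(\<integral>\<omega>. indicat_real A \<omega> * stopped r t \<omega> \<partial>?C) = (\<integral>\<omega>. indicat_real A \<omega> * stopped r s \<omega> \<partial>?C)"
      if st: "s \<in> {0..1}" "t \<in> {0..1}" "s \<le> t" and A: "A \<in> sets (?F s)" for s t A
    proof (cases "s = t")
      case False
      then have lt: "s < t" using st by simp
      define u where "u m = s + (t - s) / real (Suc m)" for m
      have u: "s < u m" "u m \<le> t" "u m \<in> {0..1}" for m
      proof -
        show 1: "s < u m" using lt by (simp add: u_def)
        have "(t - s) / real (Suc m) \<le> (t - s) / 1" using lt by (intro divide_left_mono) auto
        then show 2: "u m \<le> t" by (simp add: u_def)
        show "u m \<in> {0..1}" using 1 2 st by auto
      qed
      have us: "u \<longlonglongrightarrow> s"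
        using tendsto_add[OF tendsto_const tendsto_mult[OF tendsto_const LIMSEQ_inverse_real_of_nat], of s "t - s"]
        by (simp add: u_def[abs_def] divide_inverse)
      have As: "A \<in> sets ?C"
        using A usual_augmentation_subset[OF P_prob P_sets u(1)] augmented_sets_subset[OF P_prob P_sets] by blast
      have iA: "integrable ?C (\<lambda>\<omega>. indicat_real A \<omega> * stopped r w \<omega>)" if "w \<in> {0..1}" for w
        using integrable_real_mult_indicator[OF As int[OF that]] by (simp add: mult.commute)
      have eq: "(\<integral>\<omega>. indicat_real A \<omega> * stopped r (u m) \<omega> \<partial>?C) = (\<integral>\<omega>. indicat_real A \<omega> * stopped r t \<omega> \<partial>?C)" for m
      proof -
        have "A \<in> augmented_sets P (u m)" using A usual_augmentation_subset[OF P_prob P_sets u(1)] by blast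
        from orth[OF u(3) st(2) u(2) this]
        have "(\<integral>\<omega>. indicat_real A \<omega> * stopped r t \<omega> - indicat_real A \<omega> * stopped r (u m) \<omega> \<partial>?C) = 0"
          by (simp add: right_diff_distrib)
        then show ?thesis using iA[OF st(2)] iA[OF u(3)] by (subst (asm) Bochner_Integration.integral_diff) auto
      qed
      have "(\<lambda>m. \<integral>\<omega>. indicat_real A \<omega> * stopped r (u m) \<omega> \<partial>?C) \<longlonglongrightarrow> (\<integral>\<omega>. indicat_real A \<omega> * stopped r s \<omega> \<partial>?C)"
      proof (rule integral_dominated_convergence[where w = "\<lambda>_. K"])
        show "(\<lambda>\<omega>. indicat_real A \<omega> * stopped r s \<omega>) \<in> borel_measurable ?C"
          using iA[OF st(1)] by (rule borel_measurable_integrable)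
        show "(\<lambda>\<omega>. indicat_real A \<omega> * stopped r (u m) \<omega>) \<in> borel_measurable ?C" for m
          using iA[OF u(3)] by (rule borel_measurable_integrable)
        show "AE \<omega> in ?C. norm (indicat_real A \<omega> * stopped r (u m) \<omega>) \<le> K" for m
          using bdC by eventually_elim (use u(3)[of m] K(1) in \<open>auto simp: indicator_def\<close>)
        show "AE \<omega> in ?C. (\<lambda>m. indicat_real A \<omega> * stopped r (u m) \<omega>) \<longlonglongrightarrow> indicat_real A \<omega> * stopped r s \<omega>"
        proof (rule AE_I2)
          fix \<omega> assume "\<omega> \<in> space ?C"
          then have "\<omega> \<in> paths" by (simp add: P_space)
          from continuous_on_tendsto_compose[OF stopped_continuous[OF this, of r] us st(1)] u(3)
          show "(\<lambda>m. indicat_real A \<omega> * stopped r (u m) \<omega>) \<longlonglongrightarrow> indicat_real A \<omega> * stopped r s \<omega>"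
            by (intro tendsto_mult tendsto_const) (auto intro: always_eventually)
        qed
      qed simp
      then have "(\<lambda>m. \<integral>\<omega>. indicat_real A \<omega> * stopped r t \<omega> \<partial>?C) \<longlonglongrightarrow> (\<integral>\<omega>. indicat_real A \<omega> * stopped r s \<omega> \<partial>?C)"
        unfolding eq .
      from LIMSEQ_unique[OF tendsto_const this] show ?thesis .
    qed simp
    show ?thesis
      unfolding martingale_def
    proof (intro conjI ballI)
      show "filtered_prob_space ?C ?F" by (rule aug)
      show "stopped r t \<in> borel_measurable (?F t)" if "t \<in> {0..1}" for t
        by (rule measurable_usual_augmentation[OF P_prob P_sets stopped_measurable[OF that]])
      show "integrable ?C (stopped r t)" if "t \<in> {0..1}" for t by (rule int[OF that])
      fix s t :: real assume s: "s \<in> {0..1}" and t: "t \<in> {s..1}"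
      then have t': "t \<in> {0..1}" "s \<le> t" by auto
      interpret S: finite_measure_subalgebra ?C "?F s"
        by unfold_locales (use aug in \<open>simp add: filtered_prob_space_def\<close>)
      show "AE \<omega> in ?C. real_cond_exp ?C (?F s) (stopped r t) \<omega> = stopped r s \<omega>"
      proof (rule S.real_cond_exp_charact)
        show "stopped r s \<in> borel_measurable (?F s)"
          by (rule measurable_usual_augmentation[OF P_prob P_sets stopped_measurable[OF s]])
        fix A assume "A \<in> sets (?F s)"
        from charact[OF s t' this]
        show "(\<integral>\<omega>\<in>A. stopped r t \<omega> \<partial>?C) = (\<integral>\<omega>\<in>A. stopped r s \<omega> \<partial>?C)"
          by (simp add: set_lebesgue_integral_def)
      qed (rule int[OF t'(1)], rule int[OF s])
    qed
  qed
  show ?thesis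
    unfolding local_martingale_def
  proof (intro conjI)
    show "filtered_prob_space ?C ?F" by (rule aug)
    show "\<forall>t\<in>{0..1}. process t \<in> borel_measurable (?F t)"
      using measurable_usual_augmentation[OF P_prob P_sets process_measurable] by blast
    show "\<forall>\<omega>\<in>space ?C. cadlag_on 0 1 (\<lambda>t. process t \<omega>)"
      using continuous_imp_cadlag[OF process_continuous] by (simp add: P_space)
    show "\<exists>T :: nat \<Rightarrow> path \<Rightarrow> real.
        (\<forall>n. stopping_time ?F (T n)) \<and>
        (\<forall>n. \<forall>\<omega>\<in>space ?C. 0 \<le> T n \<omega> \<and> T n \<omega> \<le> T (Suc n) \<omega> \<and> T n \<omega> \<le> 1) \<and>
        (AE \<omega> in ?C. \<exists>n. T n \<omega> = 1) \<and>
        (\<forall>n. martingale ?C ?F (\<lambda>t \<omega>. process (min t (T n \<omega>)) \<omega>))"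
    proof (intro exI[of _ "\<lambda>n. exit_time (real n)"] conjI allI ballI)
      show "stopping_time ?F (exit_time (real n))" for n by (rule exit_time_stopping_time[OF P_prob P_sets])
      show "0 \<le> exit_time (real n) \<omega>" "exit_time (real n) \<omega> \<le> 1" for n \<omega>
        using exit_time_range[of "real n" \<omega>] by auto
      show "exit_time (real n) \<omega> \<le> exit_time (real (Suc n)) \<omega>" for n \<omega> by (rule exit_time_mono) simp
      show "martingale ?C ?F (\<lambda>t \<omega>. process (min t (exit_time (real n) \<omega>)) \<omega>)" for n by (rule mart) simp
      show "AE \<omega> in ?C. \<exists>n. exit_time (real n) \<omega> = 1"
      proof (rule AE_I2)
        fix \<omega> assume "\<omega> \<in> space ?C"
        then have "continuous_on {0..1} \<omega>" using path_continuous by (simp add: P_space)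
        then have "bounded (\<omega> ` {0..1})" by (intro compact_imp_bounded compact_continuous_image) auto
        then obtain b where b: "\<forall>t\<in>{0..1}. norm (\<omega> t) \<le> b" unfolding bounded_iff by blast
        obtain n :: nat where "b < real n" using reals_Archimedean2 by blast
        then have "exit_time (real n) \<omega> = 1" using b by (intro exit_time_eq_1) force
        then show "\<exists>n. exit_time (real n) \<omega> = 1" by blast
      qed
    qed
  qed
qed

end


section \<open>Angular momentum about the third axis\<close>

lemma pd_has_derivative:
  fixes g :: "real ^ 3 \<Rightarrow> 'b::real_normed_vector"
  assumes "g differentiable (at x)"
  shows "(g has_derivative (\<lambda>y. \<Sum>i\<in>UNIV. y $ i *\<^sub>R pd i g x)) (at x)"
proof -
  let ?g' = "frechet_derivative g (at x)"
  have g': "(g has_derivative ?g') (at x)" using assms by (simp add: frechet_derivative_works)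
  then interpret bounded_linear ?g' by (rule has_derivative_bounded_linear)
  have "?g' y = (\<Sum>i\<in>UNIV. y $ i *\<^sub>R pd i g x)" for y
  proof -
    have "?g' (\<Sum>i\<in>UNIV. y $ i *\<^sub>R axis i 1) = (\<Sum>i\<in>UNIV. y $ i *\<^sub>R pd i g x)"
      by (simp add: sum scaleR pd_def)
    moreover have "(\<Sum>i\<in>UNIV. y $ i *\<^sub>R axis i 1) = y"
      using basis_expansion[of y] by (simp add: scalar_mult_eq_scaleR)
    ultimately show ?thesis by simp
  qed
  then have "?g' = (\<lambda>y. \<Sum>i\<in>UNIV. y $ i *\<^sub>R pd i g x)" by (rule ext)
  then show ?thesis using g' by simp
qed

lemma pd_has_derivative_component:
  fixes g :: "real ^ 3 \<Rightarrow> real ^ 3"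
  assumes "g differentiable (at x)"
  shows "((\<lambda>x. g x $ k) has_derivative (\<lambda>y. \<Sum>i\<in>UNIV. y $ i * pd i g x $ k)) (at x)"
  using bounded_linear.has_derivative[OF bounded_linear_vec_nth pd_has_derivative[OF assms], of k]
  by simp

text \<open>Differentiate along the rotation orbit at angle 0.\<close>

lemma rotation_invariant_gradient:
  assumes q: "q differentiable (at x)" and inv: "\<And>\<epsilon>. q (rotation_e3 \<epsilon> x) = q x"
  shows "x $ 1 * grad q x $ 2 = x $ 2 * grad q x $ 1"
proof -
  have eq: "rotation_e3 \<epsilon> x = (cos \<epsilon> * x $ 1 - sin \<epsilon> * x $ 2) *\<^sub>R axis 1 1
      + (sin \<epsilon> * x $ 1 + cos \<epsilon> * x $ 2) *\<^sub>R axis 2 1 + x $ 3 *\<^sub>R axis 3 1" for \<epsilon>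
    by (simp add: rotation_e3_def vec_eq_iff forall_3 axis_def)
  have 0: "rotation_e3 0 x = x"
    by (simp add: rotation_e3_def vec_eq_iff forall_3)
  have rot: "((\<lambda>\<epsilon>. rotation_e3 \<epsilon> x) has_derivative (\<lambda>s. (- s * x $ 2) *\<^sub>R axis 1 1 + (s * x $ 1) *\<^sub>R axis 2 1)) (at 0)"
    unfolding eq by (auto intro!: derivative_eq_intros)
  have q0: "(q has_derivative (\<lambda>y. \<Sum>i\<in>UNIV. y $ i *\<^sub>R pd i q x)) (at (rotation_e3 0 x))"
    using pd_has_derivative[OF q] by (simp only: 0)
  from has_derivative_compose[OF rot q0]
  have "((\<lambda>\<epsilon>. q (rotation_e3 \<epsilon> x)) has_derivative
      (\<lambda>s. \<Sum>i\<in>UNIV. ((- s * x $ 2) *\<^sub>R axis 1 1 + (s * x $ 1) *\<^sub>R axis 2 1) $ i *\<^sub>R pd i q x)) (at 0)" .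
  moreover have "((\<lambda>\<epsilon>. q (rotation_e3 \<epsilon> x)) has_derivative (\<lambda>s. 0)) (at 0)"
    by (simp add: inv)
  ultimately have "(\<lambda>s. \<Sum>i\<in>UNIV. ((- s * x $ 2) *\<^sub>R axis 1 1 + (s * x $ 1) *\<^sub>R axis 2 1) $ i *\<^sub>R pd i q x) = (\<lambda>s. 0)"
    by (rule has_derivative_unique)
  from fun_cong[OF this, of 1] show ?thesis
    by (simp add: sum_3 axis_def grad_def)
qed

lemma cont_strip_reverse:
  assumes "cont_strip g"
  shows "cont_strip (\<lambda>t. g (1 - t))"
proof -
  have "continuous_on ({0..1} \<times> UNIV) ((\<lambda>(t, x). g t x) \<circ> (\<lambda>(t, x). (1 - t, x)))"
    using assms unfolding cont_strip_def split_beta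
    by (intro continuous_on_compose continuous_intros) (auto elim!: continuous_on_subset)
  then show ?thesis by (simp add: cont_strip_def o_def split_beta)
qed

lemma reversed_time_derivative:
  fixes u :: "real \<Rightarrow> real ^ 3 \<Rightarrow> real ^ 3"
  assumes u: "time_differentiable u" and t: "t \<in> {0..1}"
  shows "((\<lambda>s. u (1 - s) x $ k) has_real_derivative - dt u (1 - t) x $ k) (at t within {0..1})"
proof -
  have img: "(\<lambda>s. 1 - s) ` {0..1} = {0..1::real}" by (auto simp: image_iff intro!: bexI[of _ "1 - _"])
  have "((\<lambda>s. u s x) has_vector_derivative dt u (1 - t) x) (at (1 - t) within {0..1})"
    using u t unfolding time_differentiable_def dt_def by (subst vector_derivative_works[symmetric]) auto
  then have "((\<lambda>s. u s x) has_vector_derivative dt u (1 - t) x) (at (1 - t) within (\<lambda>s. 1 - s) ` {0..1})"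
    by (simp only: img)
  moreover have "((\<lambda>s. 1 - s) has_vector_derivative - 1) (at t within {0..1})"
    by (auto intro!: derivative_eq_intros)
  ultimately have "((\<lambda>s. u s x) \<circ> (\<lambda>s. 1 - s) has_vector_derivative (- 1) *\<^sub>R dt u (1 - t) x) (at t within {0..1})"
    by (intro vector_diff_chain_within)
  from bounded_linear.has_vector_derivative[OF bounded_linear_vec_nth this, of k]
  show ?thesis by (simp add: has_real_derivative_iff_has_vector_derivative o_def)
qed

theorem mainTheorem4:
  fixes p :: "real \<Rightarrow> real ^ 3 \<Rightarrow> real"
    and u :: "real \<Rightarrow> real ^ 3 \<Rightarrow> real ^ 3"
    and \<mu> P :: "path measure"
    and l :: "real \<Rightarrow> path \<Rightarrow> real"
  assumes "smooth_bounded_derivatives p"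
    and "\<forall>t\<in>{0..1}. \<forall>x. 0 \<le> p t x"
    and "u \<in> C12_b_div"
    and "navier_stokes p u"
    and "\<forall>t\<in>{0..1}. \<forall>x \<epsilon>. p t (rotation_e3 \<epsilon> x) = p t x"
    and "wiener_measure \<mu>"
    and "drifted_law \<mu> u P"
  defines "l \<equiv> \<lambda>t \<omega>. (\<omega> t \<bullet> axis 1 1) * (drift u t \<omega> \<bullet> axis 2 1)
                    - (\<omega> t \<bullet> axis 2 1) * (drift u t \<omega> \<bullet> axis 1 1)"
  shows "local_martingale (completion P) (usual_augmentation P)
           (\<lambda>t \<omega>. l t \<omega> + (LINT s:{0..t}|lborel. rot (u (1 - s)) (\<omega> s) \<bullet> axis 3 1))"
proof -
  have C: "C12 u" "bounded_strip u" using assms(3) by (auto simp: C12_b_div_def)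
  have u_diff: "t \<in> {0..1} \<Longrightarrow> u t differentiable (at x)"
    and pd_diff: "t \<in> {0..1} \<Longrightarrow> pd i (u t) differentiable (at x)" for t x i
    using C(1) by (auto simp: C12_def space_differentiable_def)
  have conts: "cont_strip u" "cont_strip (\<lambda>t. pd i (u t))" "cont_strip (\<lambda>t. pd j (pd i (u t)))" for i j
    using C(1) by (auto simp: C12_def)
  have u_time: "time_differentiable u" using C(1) by (simp add: C12_def)
  define v where "v t = u (1 - t)" for t
  obtain M where M: "\<And>t x. t \<in> {0..1} \<Longrightarrow> norm (v t x) \<le> M"
  proof -
    obtain M where "\<forall>z\<in>(\<lambda>(t, x). u t x) ` ({0..1} \<times> UNIV). norm z \<le> M"
      using C(2) unfolding bounded_strip_def bounded_iff by blast
    then have "norm (v t x) \<le> M" if "t \<in> {0..1}" for t x using that by (force simp: v_def)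
    then show ?thesis by (rule that)
  qed
  define f where "f t x = x $ 2 * v t x $ 1 - x $ 1 * v t x $ 2" for t and x :: "real ^ 3"
  define D where "D i t x = (if i = 2 then v t x $ 1 else 0) + x $ 2 * pd i (v t) x $ 1
    - ((if i = 1 then v t x $ 2 else 0) + x $ 1 * pd i (v t) x $ 2)" for i :: 3 and t and x :: "real ^ 3"
  define DD where "DD i j t x =
      ((if i = 2 then pd j (v t) x $ 1 else 0) + (if j = 2 then pd i (v t) x $ 1 else 0) + x $ 2 * pd j (pd i (v t)) x $ 1)
    - ((if i = 1 then pd j (v t) x $ 2 else 0) + (if j = 1 then pd i (v t) x $ 2 else 0) + x $ 1 * pd j (pd i (v t)) x $ 2)"
    for i j :: 3 and t and x :: "real ^ 3"
  \<comment> \<open>chosen such that the generator is minus the curl component by construction; the equation of motion enters when this is shown to be the time derivative of \<open>f\<close>\<close>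
  define ft where "ft t x = (\<Sum>i\<in>UNIV. v t x $ i * D i t x) - (\<Sum>i\<in>UNIV. DD i i t x) / 2 - rot (v t) x $ 3" for t x
  have v_diff: "v t differentiable (at x)" "pd i (v t) differentiable (at x)" if "t \<in> {0..1}" for t x i
    using that u_diff[of "1 - t"] pd_diff[of "1 - t"] by (auto simp: v_def)
  have v_conts: "cont_strip v" "cont_strip (\<lambda>t. pd i (v t))" "cont_strip (\<lambda>t. pd j (pd i (v t)))" for i j
    unfolding v_def[abs_def]
    using cont_strip_reverse[OF conts(1)] cont_strip_reverse[OF conts(2)[of i]] cont_strip_reverse[OF conts(3)[of j i]] by simp_all
  have time: "((\<lambda>s. f s x) has_real_derivative ft t x) (at t within {0..1})" if t: "t \<in> {0..1}" for t x
  proof -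
    have "((\<lambda>s. f s x) has_real_derivative x $ 2 * (- dt u (1 - t) x $ 1) - x $ 1 * (- dt u (1 - t) x $ 2)) (at t within {0..1})"
      unfolding f_def v_def
      by (intro DERIV_diff DERIV_cmult reversed_time_derivative[OF u_time t])
    moreover have "x $ 2 * (- dt u (1 - t) x $ 1) - x $ 1 * (- dt u (1 - t) x $ 2) = ft t x"
    proof -
      have t': "1 - t \<in> {0..1}" using t by auto
      have ns: "dt u (1 - t) x $ k + advection (v t) (v t) x $ k = - grad (p (1 - t)) x $ k + (1 / 2) * laplacian (v t) x $ k" for k
      proof -
        have "dt u (1 - t) x + advection (v t) (v t) x = - grad (p (1 - t)) x + (1 / 2) *\<^sub>R laplacian (v t) x"
          using assms(4) t' unfolding navier_stokes_def v_def by blast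
        from arg_cong[OF this, of "\<lambda>y. y $ k"] show ?thesis by simp
      qed
      have "p (1 - t) differentiable (at x)"
      proof -
        have "space_differentiable (iterated_pd [] p)"
          using assms(1) unfolding smooth_bounded_derivatives_def by blast
        then show ?thesis using t' by (simp add: space_differentiable_def)
      qed
      then have sym: "x $ 1 * grad (p (1 - t)) x $ 2 = x $ 2 * grad (p (1 - t)) x $ 1"
        using assms(5) t' by (intro rotation_invariant_gradient) auto
      have d: "dt u (1 - t) x $ k = - advection (v t) (v t) x $ k - grad (p (1 - t)) x $ k + laplacian (v t) x $ k / 2" for k
        using ns[of k] by simp
      show ?thesis
        unfolding d ft_def D_def DD_def using sym
        by (simp add: advection_def laplacian_def rot_def sum_3 algebra_simps add_divide_distrib diff_divide_distrib)
    qed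
    ultimately show ?thesis by simp
  qed
  have space: "(f t has_derivative (\<lambda>y. \<Sum>i\<in>UNIV. D i t x * y $ i)) (at x)" if t: "t \<in> {0..1}" for t x
    unfolding f_def
    by (rule has_derivative_eq_rhs[OF has_derivative_diff[OF
          has_derivative_mult[OF bounded_linear_imp_has_derivative[OF bounded_linear_vec_nth] pd_has_derivative_component[OF v_diff(1)[OF t]]]
          has_derivative_mult[OF bounded_linear_imp_has_derivative[OF bounded_linear_vec_nth] pd_has_derivative_component[OF v_diff(1)[OF t]]]]])
      (simp add: fun_eq_iff D_def sum_3 algebra_simps)
  have scaled: "((\<lambda>x. if b then v t x $ k else 0) has_derivative (\<lambda>y. if b then \<Sum>j\<in>UNIV. y $ j * pd j (v t) x $ k else 0)) (at x)"
    if t: "t \<in> {0..1}" for b t x k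
    using pd_has_derivative_component[OF v_diff(1)[OF t]] by (cases b) auto
  have space2: "(D i t has_derivative (\<lambda>y. \<Sum>j\<in>UNIV. DD i j t x * y $ j)) (at x)" if t: "t \<in> {0..1}" for i t x
    unfolding D_def
    by (rule has_derivative_eq_rhs[OF has_derivative_diff[OF
          has_derivative_add[OF scaled[OF t] has_derivative_mult[OF bounded_linear_imp_has_derivative[OF bounded_linear_vec_nth] pd_has_derivative_component[OF v_diff(2)[OF t]]]]
          has_derivative_add[OF scaled[OF t] has_derivative_mult[OF bounded_linear_imp_has_derivative[OF bounded_linear_vec_nth] pd_has_derivative_component[OF v_diff(2)[OF t]]]]]])
      (simp add: fun_eq_iff DD_def sum_3 algebra_simps)
  have c1: "cont_strip (\<lambda>t x. v t x $ k)" and c2: "cont_strip (\<lambda>t x. pd i (v t) x $ k)"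
    and c3: "cont_strip (\<lambda>t x. pd j (pd i (v t)) x $ k)" and c4: "cont_strip (\<lambda>t x. x $ k)" for i j k
    using v_conts(1) v_conts(2)[of i] v_conts(3)[of j i] unfolding cont_strip_def split_beta
    by (auto intro!: continuous_intros)
  have cif: "cont_strip g \<Longrightarrow> cont_strip (\<lambda>t x. if b then g t x else (0::real))" for b g
    by (cases b) (auto simp: cont_strip_def)
  have cadd: "cont_strip (\<lambda>t x. g t x + h t x)" "cont_strip (\<lambda>t x. g t x - h t x)" "cont_strip (\<lambda>t x. g t x * h t x)"
    if "cont_strip g" "cont_strip h" for g h :: "real \<Rightarrow> real ^ 3 \<Rightarrow> real"
    using that unfolding cont_strip_def split_beta by (auto intro!: continuous_intros)
  have f_c: "cont_strip f" unfolding f_def[abs_def] by (intro cadd c1 c4)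
  have D_c: "cont_strip (D i)" for i unfolding D_def[abs_def] by (intro cadd cif c1 c2 c4)
  have DD_c: "cont_strip (DD i j)" for i j unfolding DD_def[abs_def] by (intro cadd cif c1 c2 c3 c4)
  have rot_c: "cont_strip (\<lambda>t x. rot (v t) x $ 3)" unfolding rot_def by (simp, intro cadd c2)
  have half: "cont_strip (\<lambda>t x. g t x / 2)" if "cont_strip g" for g :: "real \<Rightarrow> real ^ 3 \<Rightarrow> real"
    using that unfolding cont_strip_def split_beta by (auto intro!: continuous_intros)
  have ft_c: "cont_strip ft" unfolding ft_def[abs_def] sum_3 by (intro cadd half D_c DD_c c1 rot_c)
  interpret drifted_test \<mu> v M f ft D DD
    by unfold_locales (rule assms(6) M v_conts time space space2 f_c ft_c D_c DD_c | assumption)+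
  obtain I where I: "ito_integral \<mu> (\<lambda>t \<omega>. v t (\<omega> t)) I" and P: "P = density \<mu> (\<lambda>\<omega>. ennreal (girsanov_density I \<omega>))"
    using assms(7) unfolding drifted_law_def girsanov_density_def v_def by blast
  have gen: "generator t x = - rot (v t) x $ 3" for t x
    by (simp add: generator_def ft_def)
  have "process t \<omega> = l t \<omega> + (LINT s:{0..t}|lborel. rot (u (1 - s)) (\<omega> s) \<bullet> axis 3 1)" for t \<omega>
    unfolding process_def gen
    by (simp add: l_def f_def drift_def v_def inner_axis set_lebesgue_integral_def)
  then have "process = (\<lambda>t \<omega>. l t \<omega> + (LINT s:{0..t}|lborel. rot (u (1 - s)) (\<omega> s) \<bullet> axis 3 1))"
    by (intro ext)
  with process_local_martingale[OF I P] show ?thesis by simp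
qed

end
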